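(* Let $n$ be a positive integer, $\lambda\in\mathbb R$ (possibly depending on $n$), $k$ an integer, $a=k/n^{2/3}$, and let $v$ be any vertex of the Erdős–Rényi graph $G(n,p_{n,\lambda})$ with $p_{n,\lambda}=n^{-1}+\lambda n^{-4/3}$ and law $\mathbb P_{n,\lambda}$. Let $|\mathcal C(v)|$ be the number of vertices of the connected component containing $v$. (a) If $|\lambda| \le n^{1/12}$ and $n^{2/3}\le k \le n^{3/4}$, then $\displaystyle \mathbb P_{n,\lambda}(|\mathcal C(v)|=k) = \frac{k^{3/2}}{(8\pi)^{1/2}n^2} e^{-G_\lambda(a)} (1+O(E_1))$. (b) If $-n^{1/12}\le\lambda \le \frac15 n^{1/12}$ and $(3\lambda\vee 1)n^{2/3}\le k\le n^{3/4}$, then $\displaystyle \mathbb P_{n,\lambda}(|\mathcal C(v)|\ge k) = \frac{a^{3/2}}{(8\pi)^{1/2}n^{1/3} G'_\lambda(a)} e^{-G_\lambda(a)} (1+O(E_1)) + O(E_2)$. Here $E_1=E_1(k,n,\lambda) = \frac{k^4}{n^3} + \frac{|\lambda|}{n^{1/12}} + \frac{|\lambda|^3 k}{n} + \frac{n^{2/3}}{k} + \frac{1}{n^{1/10}}$ and $E_2=n^{1/4}e^{-n^{1/4}/80}$.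
   Context: $G(n,p)$ is the random graph on $n$ labelled vertices with each pair joined independently with probability $p$. $G_\lambda(x) = \frac{x}{8}(x-2\lambda)^2=\frac{x^3}{8} - \frac{\lambda x^2}{2} + \frac{\lambda^2 x}{2}$, $G'_\lambda$ its derivative. $x\vee y=\max(x,y)$. Asymptotic notation: $f=g(1+O(h))+O(h')$ means there is an absolute constant $C$ (independent of $n,k,\lambda$) with $|f-g|\le C|g|h+Ch'$ for all sufficiently large $n$ and all parameters satisfying the hypotheses. *)

theory Defs
  imports Complex_Main
begin

definition all_edges :: "nat \<Rightarrow> nat set set" where
  "all_edges n = {e. e \<subseteq> {..<n} \<and> card e = 2}"

definition adj :: "nat set set \<Rightarrow> (nat \<times> nat) set" where
  "adj E = {(x, y). {x, y} \<in> E}"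

definition component :: "nat set set \<Rightarrow> nat \<Rightarrow> nat set" where
  "component E v = {w. (v, w) \<in> (adj E)\<^sup>*}"

definition ER_prob :: "nat \<Rightarrow> real \<Rightarrow> (nat set set \<Rightarrow> bool) \<Rightarrow> real" where
  "ER_prob n p P = (\<Sum>E\<in>Pow (all_edges n).
      if P E then p ^ card E * (1 - p) ^ (card (all_edges n) - card E) else 0)"

definition p_crit :: "nat \<Rightarrow> real \<Rightarrow> real" where
  "p_crit n lam = 1 / real n + lam * real n powr (-4/3)"

definition G_fun :: "real \<Rightarrow> real \<Rightarrow> real" where
  "G_fun lam x = x / 8 * (x - 2 * lam)^2"

definition G_deriv :: "real \<Rightarrow> real \<Rightarrow> real" where
  "G_deriv lam x = 3 * x^2 / 8 - lam * x + lam^2 / 2"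

definition E1 :: "nat \<Rightarrow> nat \<Rightarrow> real \<Rightarrow> real" where
  "E1 k n lam = real k ^ 4 / real n ^ 3 + \<bar>lam\<bar> / real n powr (1/12)
     + \<bar>lam\<bar>^3 * real k / real n + real n powr (2/3) / real k + 1 / real n powr (1/10)"

definition E2 :: "nat \<Rightarrow> real" where
  "E2 n = real n powr (1/4) * exp (- (real n powr (1/4)) / 80)"

end

theory Submission
  imports Defs "HOL-Analysis.Analysis"
begin

text \<open>Let \<^term>\<open>f t\<close> be the probability that $G(t,p)$ is connected and $q = 1 - p$. The component of a
  fixed vertex of $G(n,p)$ has size $k$ with probability
  ${n-1 \choose k-1} f_k q^{k(n-k)}$, so these numbers sum to one over $k \le n$, for every $n$. Expanding
  in powers of $z$ upgrades this family of identities to the polynomial identity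
  $\sum_{t \le k} {k-1 \choose t-1} f_t (q^t - z)^{k-t} = (1-z)^{k-1}$. Dividing by $(1 - q^k)^{k-1}$
  at $z = q^k$ gives a probability distribution $\varphi_{k,t}$ with
  $\varphi_{k,k} = \rho_k = f_k / (1-q^k)^{k-1}$, which is the law of the first failure in the
  exploration of $G(k,p)$. Combining the identity at $z = q^k e^{-y}$ with its $z$-derivative
  at $q^k$ expresses $\rho_k$ as an explicit main term plus a $\varphi$-average of a function of
  $k - t$ that vanishes to first order at $t = 0$. A suitable $y$ makes this function
  nonnegative, which bounds $\rho_k$ above; inserting this bound into $\varphi_{k,t}$, which is $\rho_t$
  times a binomial probability, shows for $y = X^2$, $X = - k \ln q$, that
  $\rho_k = X^2/2 + O(X^3 + 1/k)$. Stirling's formula turns this into (a). For (b) the sum of the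
  local estimates is compared with the explicit primitive, and sizes beyond $n^{3/4}$
  are controlled by comparing with the distribution on a larger vertex set, for which the
  component sizes again have total mass one.\<close>

section \<open>The component size distribution\<close>

text \<open>The factor (1-q^k)^(k-1) carries the exponential smallness of f_k. What is left,
  \<open>rho k\<close>, is of order X^2: a small atom at t = k of a distribution concentrated on
  small t, and the difficulty is to see this atom. The mean of \<open>ell\<close> alone does not
  show it: that mean is close to X/2, which is already the contribution of small t. Subtracting a
  multiple of \<open>Phi\<close> normalised at t = 0 cancels this contribution; rho_k plus the
  average of the remainder is then about y/2. Put sigma = y/X. Near t = 0 the logarithm of
  \<open>Phi\<close> changes by about t (sigma/2)(X - sigma). It is stationary for sigma = X, hence
  y = X^2 for the asymptotics, while a larger sigma gives the sign needed for the upper bound. The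
  upper bound has to come first, because the error for y = X^2 is an average over
  \<open>phi\<close>, which contains \<open>rho t\<close> for all smaller t.\<close>

definition edges :: "nat set \<Rightarrow> nat set set" where
  "edges V = {e. e \<subseteq> V \<and> card e = 2}"

text \<open>The law of a random subset of \<open>A\<close> that contains each element independently
  with probability \<open>p\<close>; for \<open>A = edges V\<close> it is the random graph on
  \<open>V\<close>.\<close>

definition wt :: "real \<Rightarrow> 'a set \<Rightarrow> 'a set \<Rightarrow> real" where
  "wt p A E = p ^ card E * (1 - p) ^ (card A - card E)"

text \<open>For \<open>E\<close> inside \<open>edges T\<close> the condition says that the graph on
  \<open>T\<close> is connected. Expressing this through a root \<open>v\<close> requires no notion
  beyond \<open>component\<close>; that the value depends only on the size of \<open>T\<close> is
  shown later.\<close>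

definition conn_wt :: "real \<Rightarrow> nat \<Rightarrow> nat set \<Rightarrow> real" where
  "conn_wt p v T = (\<Sum>E\<in>Pow (edges T). of_bool (component E v = T) * wt p (edges T) E)"

lemma finite_edges: "finite V \<Longrightarrow> finite (edges V)"
  by (rule finite_subset[of _ "Pow V"]) (auto simp: edges_def)

lemma sum_wt: "finite A \<Longrightarrow> (\<Sum>E\<in>Pow A. wt p A E) = 1"
proof -
  assume A: "finite A"
  have "(\<Sum>E\<in>Pow A. wt p A E) = (\<Sum>E\<in>Pow A. (\<Prod>x\<in>E. p) * (\<Prod>x\<in>A - E. 1 - p))"
    by (rule sum.cong) (use A in \<open>auto simp: wt_def card_Diff_subset finite_subset\<close>)
  also have "\<dots> = (\<Prod>x\<in>A. p + (1 - p))"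
    by (rule prod_add[OF A, symmetric])
  finally show ?thesis by simp
qed

lemma wt_Un:
  assumes "finite A" "finite B" "A \<inter> B = {}" "X \<subseteq> A" "Y \<subseteq> B"
  shows "wt p (A \<union> B) (X \<union> Y) = wt p A X * wt p B Y"
proof -
  have f: "finite X" "finite Y" using assms finite_subset by blast+
  have "card (X \<union> Y) = card X + card Y" using assms f by (intro card_Un_disjoint) auto
  moreover have "card (A \<union> B) = card A + card B" using assms by (intro card_Un_disjoint) auto
  moreover have "card X \<le> card A" "card Y \<le> card B" using assms by (auto intro: card_mono)
  ultimately have "card (A \<union> B) - card (X \<union> Y) = (card A - card X) + (card B - card Y)"
    "card (X \<union> Y) = card X + card Y" by auto
  then show ?thesis by (simp add: wt_def power_add)
qed

text \<open>Independence of the edges in two disjoint sets, as a factorisation of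
  expectations.\<close>

lemma sum_wt_Un:
  assumes "finite A" "finite B" "A \<inter> B = {}"
  shows "(\<Sum>E\<in>Pow (A \<union> B). g (E \<inter> A) * h (E \<inter> B) * wt p (A \<union> B) E)
    = (\<Sum>X\<in>Pow A. g X * wt p A X) * (\<Sum>Y\<in>Pow B. h Y * wt p B Y)"
proof -
  have "(\<Sum>X\<in>Pow A. g X * wt p A X) * (\<Sum>Y\<in>Pow B. h Y * wt p B Y)
    = (\<Sum>(X,Y)\<in>Pow A \<times> Pow B. (g X * wt p A X) * (h Y * wt p B Y))"
    by (simp add: sum_product sum.cartesian_product)
  also have "\<dots> = (\<Sum>E\<in>Pow (A \<union> B). g (E \<inter> A) * h (E \<inter> B) * wt p (A \<union> B) E)"
  proof (rule sum.reindex_bij_witness[of _ "\<lambda>E. (E \<inter> A, E \<inter> B)" "\<lambda>(X, Y). X \<union> Y"])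
    fix a assume "a \<in> Pow A \<times> Pow B"
    then obtain X Y where a: "a = (X, Y)" "X \<subseteq> A" "Y \<subseteq> B" by auto
    have "(X \<union> Y) \<inter> A = X" "(X \<union> Y) \<inter> B = Y" using a assms by auto
    then show "(case case a of (X, Y) \<Rightarrow> X \<union> Y of E \<Rightarrow> (E \<inter> A, E \<inter> B)) = a"
      "g ((case a of (X, Y) \<Rightarrow> X \<union> Y) \<inter> A) * h ((case a of (X, Y) \<Rightarrow> X \<union> Y) \<inter> B)
        * wt p (A \<union> B) (case a of (X, Y) \<Rightarrow> X \<union> Y) =
        (case a of (X, Y) \<Rightarrow> g X * wt p A X * (h Y * wt p B Y))"
      using a wt_Un[OF assms a(2,3)] by auto
  qed auto
  finally show ?thesis by simp
qed

section \<open>Components and the edges that determine them\<close>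

lemma component_self: "v \<in> component E v"
  by (simp add: component_def)

lemma component_subset:
  assumes "E \<subseteq> edges V" "v \<in> V"
  shows "component E v \<subseteq> V"
proof
  fix w assume "w \<in> component E v"
  then have "(v, w) \<in> (adj E)\<^sup>*" by (simp add: component_def)
  then show "w \<in> V"
    by (cases rule: rtranclE) (use assms in \<open>auto simp: adj_def edges_def\<close>)
qed

text \<open>The two conditions on the right concern disjoint edge sets and leave the edges inside
  \<open>V - T\<close> free, which is what turns the probability into a product. An edge leaving
  \<open>T\<close> would enlarge the component; without such edges no path from \<open>v\<close>
  leaves \<open>T\<close>.\<close>

lemma component_eq_iff:
  assumes "E \<subseteq> edges V" "v \<in> T" "T \<subseteq> V"
  shows "component E v = T \<longleftrightarrow>
    component (E \<inter> edges T) v = T \<and> E \<inter> (edges V - edges T - edges (V - T)) = {}"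
    (is "_ \<longleftrightarrow> _ \<and> E \<inter> ?X = {}")
proof
  assume c: "component E v = T"
  have cl: "z \<in> T" if "y \<in> T" "{y, z} \<in> E" for y z
    using that c by (auto simp: component_def adj_def intro: rtrancl_into_rtrancl)
  have "E \<inter> ?X = {}"
  proof (rule ccontr)
    assume "E \<inter> ?X \<noteq> {}"
    then obtain e where e: "e \<in> E" "e \<subseteq> V" "card e = 2" "\<not> e \<subseteq> T" "\<not> e \<subseteq> V - T"
      by (auto simp: edges_def)
    then obtain x y where "e = {x, y}" by (auto simp: card_2_iff)
    with e cl[of x y] cl[of y x] show False by (auto simp: insert_commute)
  qed
  moreover have "w \<in> component (E \<inter> edges T) v" if "w \<in> T" for w
  proof -
    have "(v, w) \<in> (adj E)\<^sup>*" using that c by (auto simp: component_def)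
    then have "(v, w) \<in> (adj (E \<inter> edges T))\<^sup>* \<and> w \<in> T"
    proof (induction rule: rtrancl_induct)
      case (step y z)
      then have yz: "{y, z} \<in> E" by (simp add: adj_def)
      then have "z \<in> T" using cl step by blast
      then have "{y, z} \<in> edges T" using step yz assms by (auto simp: edges_def)
      then show ?case using step yz \<open>z \<in> T\<close>
        by (auto simp: adj_def intro: rtrancl_into_rtrancl)
    qed (use assms in auto)
    then show ?thesis by (simp add: component_def)
  qed
  moreover have "component (E \<inter> edges T) v \<subseteq> T"
    by (rule component_subset) (use assms in auto)
  ultimately show "component (E \<inter> edges T) v = T \<and> E \<inter> ?X = {}" by auto
next
  assume c: "component (E \<inter> edges T) v = T \<and> E \<inter> ?X = {}"
  have "adj (E \<inter> edges T) \<subseteq> adj E" by (auto simp: adj_def)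
  then have "T \<subseteq> component E v"
    using c rtrancl_mono[of "adj (E \<inter> edges T)" "adj E"] unfolding component_def by blast
  moreover have "w \<in> T" if "(v, w) \<in> (adj E)\<^sup>*" for w
    using that
  proof (induction rule: rtrancl_induct)
    case (step y z)
    then have "{y, z} \<in> E" by (simp add: adj_def)
    then have "{y, z} \<notin> ?X" "{y, z} \<in> edges V" using c assms by auto
    then show ?case using step by (auto simp: edges_def)
  qed (use assms in auto)
  ultimately show "component E v = T" by (auto simp: component_def)
qed

lemma card_cross_edges:
  assumes "finite V" "T \<subseteq> V"
  shows "card (edges V - edges T - edges (V - T)) = card T * (card V - card T)"
proof -
  have "edges V - edges T - edges (V - T) = (\<lambda>(x, y). {x, y}) ` (T \<times> (V - T))"
  proof (intro equalityI subsetI)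
    fix e assume "e \<in> edges V - edges T - edges (V - T)"
    then have e: "e \<subseteq> V" "card e = 2" "\<not> e \<subseteq> T" "\<not> e \<subseteq> V - T" by (auto simp: edges_def)
    then obtain x y where xy: "e = {x, y}" by (auto simp: card_2_iff)
    then have "(x \<in> T \<and> y \<in> V - T) \<or> (y \<in> T \<and> x \<in> V - T)" using e by auto
    then show "e \<in> (\<lambda>(x, y). {x, y}) ` (T \<times> (V - T))"
      using xy by (auto simp: image_iff doubleton_eq_iff)
  next
    fix e assume "e \<in> (\<lambda>(x, y). {x, y}) ` (T \<times> (V - T))"
    then obtain x y where "e = {x, y}" "x \<in> T" "y \<in> V" "y \<notin> T" by auto
    then show "e \<in> edges V - edges T - edges (V - T)" using assms by (auto simp: edges_def card_2_iff)
  qed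
  moreover have "inj_on (\<lambda>(x, y). {x, y}) (T \<times> (V - T))"
    by (auto simp: inj_on_def doubleton_eq_iff)
  ultimately show ?thesis using assms finite_subset[OF assms(2,1)]
    by (simp add: card_image card_cartesian_product card_Diff_subset)
qed

text \<open>Independence is used twice: to split off the edges inside \<open>T\<close>, and then to
  separate the cross edges, which must all be absent, from the free edges inside
  \<open>V - T\<close>.\<close>

lemma component_prob:
  assumes "finite V" "v \<in> T" "T \<subseteq> V"
  shows "(\<Sum>E\<in>Pow (edges V). of_bool (component E v = T) * wt p (edges V) E)
    = conn_wt p v T * (1 - p) ^ (card T * (card V - card T))"
proof -
  define X R where "X = edges V - edges T - edges (V - T)" and "R = edges (V - T)"
  have fin: "finite (edges T)" "finite X" "finite R"
    using assms by (auto simp: X_def R_def intro!: finite_edges intro: finite_subset)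
  have dTR: "edges T \<inter> R = {}"
  proof (rule ccontr)
    assume "edges T \<inter> R \<noteq> {}"
    then obtain e where e: "e \<subseteq> T" "e \<subseteq> V - T" "card e = 2" by (auto simp: edges_def R_def)
    then have "e = {}" by blast
    then show False using e by simp
  qed
  have V: "edges V = edges T \<union> (X \<union> R)"
    using assms by (auto simp: X_def R_def edges_def)
  have d: "edges T \<inter> (X \<union> R) = {}" "X \<inter> R = {}" using dTR by (auto simp: X_def R_def)
  have "(\<Sum>E\<in>Pow (edges V). of_bool (component E v = T) * wt p (edges V) E)
    = (\<Sum>E\<in>Pow (edges T \<union> (X \<union> R)). of_bool (component (E \<inter> edges T) v = T)
        * of_bool ((E \<inter> (X \<union> R)) \<inter> X = {}) * wt p (edges T \<union> (X \<union> R)) E)"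
    unfolding V[symmetric]
  proof (rule sum.cong[OF refl])
    fix E assume "E \<in> Pow (edges V)"
    then have "component E v = T \<longleftrightarrow> component (E \<inter> edges T) v = T \<and> E \<inter> X = {}"
      using component_eq_iff[of E V v T] assms by (simp add: X_def)
    moreover have "E \<inter> (X \<union> R) \<inter> X = E \<inter> X" by auto
    ultimately show "of_bool (component E v = T) * wt p (edges V) E = of_bool (component (E \<inter> edges T) v = T)
        * of_bool ((E \<inter> (X \<union> R)) \<inter> X = {}) * wt p (edges V) E" by simp
  qed
  also have "\<dots> = conn_wt p v T * (\<Sum>Y\<in>Pow (X \<union> R). of_bool (Y \<inter> X = {}) * wt p (X \<union> R) Y)"
    unfolding conn_wt_def by (rule sum_wt_Un) (use fin d in auto)
  also have "(\<Sum>Y\<in>Pow (X \<union> R). of_bool (Y \<inter> X = {}) * wt p (X \<union> R) Y)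
    = (\<Sum>Y\<in>Pow (X \<union> R). of_bool (Y \<inter> X = {}) * 1 * wt p (X \<union> R) Y)" by simp
  also have "\<dots> = (\<Sum>Y\<in>Pow X. of_bool (Y = {}) * wt p X Y) * (\<Sum>Z\<in>Pow R. 1 * wt p R Z)"
    by (rule sum_wt_Un) (use fin d in auto)
  also have "(\<Sum>Z\<in>Pow R. 1 * wt p R Z) = 1" using sum_wt[OF fin(3)] by simp
  also have "(\<Sum>Y\<in>Pow X. of_bool (Y = {}) * wt p X Y) = (\<Sum>Y\<in>{{}}. of_bool (Y = {}) * wt p X Y)"
    by (rule sum.mono_neutral_right) (use fin in auto)
  also have "\<dots> = (1 - p) ^ card X" by (simp add: wt_def)
  finally show ?thesis using card_cross_edges[OF assms(1,3)] by (simp add: X_def)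
qed

text \<open>For every edge set exactly one \<open>T\<close> is the component of
  \<open>v\<close>.\<close>

lemma conn_wt_sum:
  assumes "finite V" "v \<in> V"
  shows "(\<Sum>T | v \<in> T \<and> T \<subseteq> V. conn_wt p v T * (1 - p) ^ (card T * (card V - card T))) = 1"
proof -
  let ?S = "{T. v \<in> T \<and> T \<subseteq> V}"
  have fS: "finite ?S" using assms by (auto intro: finite_subset[of _ "Pow V"])
  have "(\<Sum>T\<in>?S. conn_wt p v T * (1 - p) ^ (card T * (card V - card T)))
    = (\<Sum>T\<in>?S. \<Sum>E\<in>Pow (edges V). of_bool (component E v = T) * wt p (edges V) E)"
    by (rule sum.cong) (use assms component_prob in auto)
  also have "\<dots> = (\<Sum>E\<in>Pow (edges V). \<Sum>T\<in>?S. of_bool (component E v = T) * wt p (edges V) E)"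
    by (rule sum.swap)
  also have "\<dots> = (\<Sum>E\<in>Pow (edges V). wt p (edges V) E)"
  proof (rule sum.cong[OF refl])
    fix E assume "E \<in> Pow (edges V)"
    then have "component E v \<in> ?S"
      using component_subset[of E V v] component_self[of v E] assms by auto
    then have "(\<Sum>T\<in>?S. of_bool (component E v = T)) = (1::real)"
      using fS by (simp add: of_bool_def)
    then show "(\<Sum>T\<in>?S. of_bool (component E v = T) * wt p (edges V) E) = wt p (edges V) E"
      by (simp add: sum_distrib_right[symmetric])
  qed
  also have "\<dots> = 1" by (rule sum_wt) (use assms finite_edges in auto)
  finally show ?thesis .
qed

section \<open>Grouping the vertex sets by size\<close>

lemma card_subsets_with_point:
  assumes "finite V" "v \<in> V" "1 \<le> k"
  shows "card {T. v \<in> T \<and> T \<subseteq> V \<and> card T = k} = (card V - 1) choose (k - 1)"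
proof -
  have "bij_betw (insert v) {U. U \<subseteq> V - {v} \<and> card U = k - 1} {T. v \<in> T \<and> T \<subseteq> V \<and> card T = k}"
  proof (rule bij_betw_byWitness[where f' = "\<lambda>T. T - {v}"])
    show "insert v ` {U. U \<subseteq> V - {v} \<and> card U = k - 1} \<subseteq> {T. v \<in> T \<and> T \<subseteq> V \<and> card T = k}"
    proof clarify
      fix U assume "U \<subseteq> V - {v}" "card U = k - 1"
      moreover have "finite U" using calculation assms finite_subset by blast
      moreover have "v \<notin> U" using calculation by auto
      ultimately show "v \<in> insert v U \<and> insert v U \<subseteq> V \<and> card (insert v U) = k"
        using assms by auto
    qed
    show "(\<lambda>T. T - {v}) ` {T. v \<in> T \<and> T \<subseteq> V \<and> card T = k} \<subseteq> {U. U \<subseteq> V - {v} \<and> card U = k - 1}"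
      using assms by (auto simp: card_Diff_singleton)
  qed (use assms in auto)
  then have "card {T. v \<in> T \<and> T \<subseteq> V \<and> card T = k} = card {U. U \<subseteq> V - {v} \<and> card U = k - 1}"
    by (simp add: bij_betw_same_card)
  also have "\<dots> = (card (V - {v})) choose (k - 1)"
    by (rule n_subsets) (use assms in auto)
  finally show ?thesis using assms by simp
qed

lemma sum_subsets_with_point:
  fixes g :: "nat \<Rightarrow> real"
  assumes "finite V" "v \<in> V" "K \<subseteq> {1..card V}"
  shows "(\<Sum>T | v \<in> T \<and> T \<subseteq> V \<and> card T \<in> K. g (card T))
    = (\<Sum>k\<in>K. real ((card V - 1) choose (k - 1)) * g k)"
proof -
  let ?S = "{T. v \<in> T \<and> T \<subseteq> V \<and> card T \<in> K}"
  have fS: "finite ?S" using assms by (auto intro: finite_subset[of _ "Pow V"])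
  have fK: "finite K" using assms finite_subset by blast
  have "(\<Sum>T\<in>?S. g (card T)) = (\<Sum>k\<in>K. \<Sum>T\<in>{x \<in> ?S. card x = k}. g (card T))"
    by (rule sum.group[symmetric]) (use fS fK in auto)
  also have "\<dots> = (\<Sum>k\<in>K. real ((card V - 1) choose (k - 1)) * g k)"
  proof (rule sum.cong[OF refl])
    fix k assume "k \<in> K"
    then have "{x \<in> ?S. card x = k} = {T. v \<in> T \<and> T \<subseteq> V \<and> card T = k}" "1 \<le> k"
      using assms by auto
    then show "(\<Sum>T\<in>{x \<in> ?S. card x = k}. g (card T)) = real ((card V - 1) choose (k - 1)) * g k"
      using card_subsets_with_point[OF assms(1,2), of k] by simp
  qed
  finally show ?thesis .
qed

definition conn_prob :: "real \<Rightarrow> nat \<Rightarrow> real" where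
  "conn_prob p k = conn_wt p 0 {..<k}"

text \<open>The component identity determines \<^term>\<open>conn_wt p v T\<close> recursively from the values on
  smaller sets, so no relabelling of graphs is needed.\<close>

lemma conn_wt_eq_conn_prob:
  assumes "finite T" "v \<in> T"
  shows "conn_wt p v T = conn_prob p (card T)"
  using assms
proof (induction "card T" arbitrary: T v rule: less_induct)
  case less
  define n where "n = card T"
  have n: "1 \<le> n" using less.prems by (auto simp: n_def Suc_le_eq card_gt_0_iff)
  \<comment> \<open>Solves the total mass identity for the summand \<open>T = U\<close>, whose
    cross-edge exponent is 0. By induction the right-hand side depends on \<open>w\<close> and
    \<open>U\<close> only through the size \<open>n\<close>.\<close>
  have key: "conn_wt p w U = 1 - (\<Sum>k\<in>{1..<n}. real ((n - 1) choose (k - 1)) * (conn_prob p k * (1 - p) ^ (k * (n - k))))"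
    if U: "finite U" "w \<in> U" "card U = n" for w U
  proof -
    let ?h = "\<lambda>T. conn_wt p w T * (1 - p) ^ (card T * (card U - card T))"
    have "{T. w \<in> T \<and> T \<subseteq> U} = insert U {T. w \<in> T \<and> T \<subseteq> U \<and> card T \<in> {1..<n}}"
    proof (intro equalityI subsetI)
      fix T assume "T \<in> {T. w \<in> T \<and> T \<subseteq> U}"
      then have T: "w \<in> T" "T \<subseteq> U" by auto
      have "finite T" using T U finite_subset by blast
      then have "card T \<ge> 1" using T by (auto simp: Suc_le_eq card_gt_0_iff)
      moreover have "T = U \<or> card T < n" using T U psubset_card_mono[of U T] by auto
      ultimately show "T \<in> insert U {T. w \<in> T \<and> T \<subseteq> U \<and> card T \<in> {1..<n}}" using T by auto
    qed (use U in auto)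
    then have "1 = (\<Sum>T\<in>insert U {T. w \<in> T \<and> T \<subseteq> U \<and> card T \<in> {1..<n}}. ?h T)"
      using conn_wt_sum[OF U(1,2), of p] by simp
    also have "\<dots> = ?h U + (\<Sum>T | w \<in> T \<and> T \<subseteq> U \<and> card T \<in> {1..<n}. ?h T)"
      by (rule sum.insert) (use U in \<open>auto intro: finite_subset[of _ "Pow U"]\<close>)
    also have "(\<Sum>T | w \<in> T \<and> T \<subseteq> U \<and> card T \<in> {1..<n}. ?h T)
      = (\<Sum>T | w \<in> T \<and> T \<subseteq> U \<and> card T \<in> {1..<n}. conn_prob p (card T) * (1 - p) ^ (card T * (card U - card T)))"
    proof (rule sum.cong[OF refl])
      fix T assume T: "T \<in> {T. w \<in> T \<and> T \<subseteq> U \<and> card T \<in> {1..<n}}"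
      then have "finite T" using U finite_subset by blast
      then show "?h T = conn_prob p (card T) * (1 - p) ^ (card T * (card U - card T))"
        using less.hyps[of T w] T by (simp add: n_def)
    qed
    also have "\<dots> = (\<Sum>k\<in>{1..<n}. real ((card U - 1) choose (k - 1)) * (conn_prob p k * (1 - p) ^ (k * (card U - k))))"
      by (rule sum_subsets_with_point) (use U in auto)
    finally show ?thesis using U by simp
  qed
  show ?case
    using key[of T v] key[of "{..<n}" 0] less.prems n by (simp add: n_def conn_prob_def)
qed

lemma conn_prob_nonneg: "0 \<le> p \<Longrightarrow> p \<le> 1 \<Longrightarrow> 0 \<le> conn_prob p k"
  by (auto simp: conn_prob_def conn_wt_def wt_def intro!: sum_nonneg)

text \<open>A set \<open>K\<close> of sizes is allowed so that one formula serves the point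
  probability, the tail and the total mass.\<close>

lemma ER_prob_component:
  assumes "v < n" "K \<subseteq> {1..n}"
  shows "ER_prob n p (\<lambda>E. card (component E v) \<in> K)
    = (\<Sum>k\<in>K. real ((n - 1) choose (k - 1)) * (conn_prob p k * (1 - p) ^ (k * (n - k))))"
proof -
  let ?V = "{..<n}"
  let ?S = "{T. v \<in> T \<and> T \<subseteq> ?V \<and> card T \<in> K}"
  have fS: "finite ?S" by (auto intro: finite_subset[of _ "Pow ?V"])
  have ae: "all_edges n = edges ?V" by (simp add: all_edges_def edges_def)
  have "ER_prob n p (\<lambda>E. card (component E v) \<in> K)
     = (\<Sum>E\<in>Pow (edges ?V). \<Sum>T\<in>?S. of_bool (component E v = T) * wt p (edges ?V) E)"
    unfolding ER_prob_def ae
  proof (rule sum.cong[OF refl])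
    fix E assume "E \<in> Pow (edges ?V)"
    then have "component E v \<in> ?S \<longleftrightarrow> card (component E v) \<in> K"
      using component_subset[of E ?V v] component_self[of v E] assms by auto
    then have "(\<Sum>T\<in>?S. of_bool (component E v = T)) = (of_bool (card (component E v) \<in> K) :: real)"
      using fS by (simp add: of_bool_def)
    then show "(if card (component E v) \<in> K then p ^ card E * (1 - p) ^ (card (edges ?V) - card E) else 0)
      = (\<Sum>T\<in>?S. of_bool (component E v = T) * wt p (edges ?V) E)"
      by (simp add: sum_distrib_right[symmetric] wt_def)
  qed
  also have "\<dots> = (\<Sum>T\<in>?S. \<Sum>E\<in>Pow (edges ?V). of_bool (component E v = T) * wt p (edges ?V) E)"
    by (rule sum.swap)
  also have "\<dots> = (\<Sum>T\<in>?S. conn_prob p (card T) * (1 - p) ^ (card T * (card ?V - card T)))"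
  proof (rule sum.cong[OF refl])
    fix T assume T: "T \<in> ?S"
    then have "finite T" using finite_subset by blast
    then show "(\<Sum>E\<in>Pow (edges ?V). of_bool (component E v = T) * wt p (edges ?V) E)
      = conn_prob p (card T) * (1 - p) ^ (card T * (card ?V - card T))"
      using component_prob[of ?V v T p] conn_wt_eq_conn_prob[of T v p] T by simp
  qed
  also have "\<dots> = (\<Sum>k\<in>K. real ((card ?V - 1) choose (k - 1)) * (conn_prob p k * (1 - p) ^ (k * (card ?V - k))))"
    by (rule sum_subsets_with_point) (use assms in auto)
  finally show ?thesis by simp
qed

lemma conn_prob_identity:
  assumes "1 \<le> n"
  shows "(\<Sum>k=1..n. real ((n - 1) choose (k - 1)) * conn_prob p k * (1 - p) ^ (k * (n - k))) = 1"
proof -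
  let ?V = "{..<n}"
  have c: "card (component E 0) \<in> {1..n}" if "E \<in> Pow (edges ?V)" for E
  proof -
    have s: "component E 0 \<subseteq> ?V" using component_subset[of E ?V 0] that assms by auto
    then have "finite (component E 0)" using finite_subset by blast
    then have "1 \<le> card (component E 0)"
      using component_self[of 0 E] by (auto simp: Suc_le_eq card_gt_0_iff)
    then show ?thesis using card_mono[OF _ s] by auto
  qed
  have ae: "all_edges n = edges ?V" by (simp add: all_edges_def edges_def)
  have "ER_prob n p (\<lambda>E. card (component E 0) \<in> {1..n}) = (\<Sum>E\<in>Pow (edges ?V). wt p (edges ?V) E)"
    unfolding ER_prob_def ae by (rule sum.cong) (use c in \<open>auto simp: wt_def\<close>)
  also have "\<dots> = 1" by (rule sum_wt) (simp add: finite_edges)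
  finally show ?thesis using ER_prob_component[of 0 n "{1..n}" p] assms by (simp add: mult.assoc)
qed

section \<open>Identities for connection probabilities\<close>

text \<open>Graphs are left behind here. The identities alone determine \<open>f\<close>
  recursively, since the summand t = n equals \<open>f n\<close>.\<close>

locale conn_seq =
  fixes q :: real and f :: "nat \<Rightarrow> real"
  assumes q_pos: "0 < q" and q_less_1: "q < 1"
    and f_nonneg: "\<And>t. 0 \<le> f t"
    and component_identity:
      "\<And>n. 1 \<le> n \<Longrightarrow> (\<Sum>t=1..n. real ((n - 1) choose (t - 1)) * f t * q ^ (t * (n - t))) = 1"
begin

definition mu :: real where "mu = - ln q"

lemma mu_pos: "0 < mu"
  using q_pos q_less_1 by (simp add: mu_def)

lemma q_power: "q ^ m = exp (- (mu * real m))"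
proof -
  have "exp (- (mu * real m)) = exp (real m * ln q)" by (simp add: mu_def)
  also have "\<dots> = exp (ln q) ^ m" by (simp add: exp_of_nat_mult)
  finally show ?thesis using q_pos by simp
qed

text \<open>The coefficient of (-z)^m is C(n-1,m) times the component identity for n - m, because
  C(n-1,t-1) C(n-t,m) = C(n-1,m) C(n-m-1,t-1).\<close>

lemma polynomial_identity:
  assumes n: "1 \<le> n"
  shows "(\<Sum>t=1..n. real ((n - 1) choose (t - 1)) * f t * (q ^ t - z) ^ (n - t)) = (1 - z) ^ (n - 1)"
proof -
  have "(\<Sum>t=1..n. real ((n - 1) choose (t - 1)) * f t * (q ^ t - z) ^ (n - t))
    = (\<Sum>t=1..n. \<Sum>m<n. real ((n - 1) choose (t - 1)) * f t * (real ((n - t) choose m) * (- z) ^ m * (q ^ t) ^ (n - t - m)))"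
  proof (rule sum.cong[OF refl])
    fix t assume t: "t \<in> {1..n}"
    have "(q ^ t - z) ^ (n - t) = (- z + q ^ t) ^ (n - t)" by simp
    also have "\<dots> = (\<Sum>m\<le>n - t. real ((n - t) choose m) * (- z) ^ m * (q ^ t) ^ (n - t - m))"
      by (rule binomial_ring)
    \<comment> \<open>The range of \<open>m\<close> is extended so as not to depend on
      \<open>t\<close>; the added binomial coefficients vanish. This permits the exchange of
      sums.\<close>
    also have "\<dots> = (\<Sum>m<n. real ((n - t) choose m) * (- z) ^ m * (q ^ t) ^ (n - t - m))"
      by (rule sum.mono_neutral_left) (use t in \<open>auto simp: binomial_eq_0\<close>)
    finally show "real ((n - 1) choose (t - 1)) * f t * (q ^ t - z) ^ (n - t)
      = (\<Sum>m<n. real ((n - 1) choose (t - 1)) * f t * (real ((n - t) choose m) * (- z) ^ m * (q ^ t) ^ (n - t - m)))"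
      by (simp add: sum_distrib_left)
  qed
  also have "\<dots> = (\<Sum>m<n. \<Sum>t=1..n. real ((n - 1) choose (t - 1)) * f t * (real ((n - t) choose m) * (- z) ^ m * (q ^ t) ^ (n - t - m)))"
    by (rule sum.swap)
  also have "\<dots> = (\<Sum>m<n. real ((n - 1) choose m) * (- z) ^ m)"
  proof (rule sum.cong[OF refl])
    fix m assume "m \<in> {..<n}"
    then have m: "m < n" by simp
    have "(\<Sum>t=1..n. real ((n - 1) choose (t - 1)) * f t * (real ((n - t) choose m) * (- z) ^ m * (q ^ t) ^ (n - t - m)))
       = (\<Sum>t=1..n - m. real ((n - 1) choose (t - 1)) * f t * (real ((n - t) choose m) * (- z) ^ m * (q ^ t) ^ (n - t - m)))"
      by (rule sum.mono_neutral_right) (auto simp: binomial_eq_0)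
    also have "\<dots> = (\<Sum>t=1..n - m. real ((n - 1) choose m) * (- z) ^ m * (real ((n - m - 1) choose (t - 1)) * f t * q ^ (t * (n - m - t))))"
    proof (rule sum.cong[OF refl])
      fix t assume t: "t \<in> {1..n - m}"
      have "((n - 1) choose (t - 1)) * ((n - t) choose m) = ((n - 1) choose (n - t)) * ((n - t) choose m)"
      proof -
        have "n - 1 - (t - 1) = n - t" "t - 1 \<le> n - 1" using t by auto
        then show ?thesis using binomial_symmetric[of "t - 1" "n - 1"] by simp
      qed
      also have "\<dots> = ((n - 1) choose m) * ((n - 1 - m) choose (n - t - m))"
        by (rule choose_mult) (use t m in auto)
      also have "(n - 1 - m) choose (n - t - m) = (n - 1 - m) choose (t - 1)"
      proof -
        have "n - 1 - m - (n - t - m) = t - 1" "n - t - m \<le> n - 1 - m" using t m by auto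
        then show ?thesis using binomial_symmetric[of "n - t - m" "n - 1 - m"] by simp
      qed
      finally have "real ((n - 1) choose (t - 1)) * real ((n - t) choose m)
         = real ((n - 1) choose m) * real ((n - m - 1) choose (t - 1))"
        by (simp only: of_nat_mult[symmetric] diff_commute[of n m 1] diff_commute[of "n - 1" m])
      moreover have "(q ^ t) ^ (n - t - m) = q ^ (t * (n - m - t))"
        by (simp add: power_mult[symmetric] add.commute)
      ultimately show "real ((n - 1) choose (t - 1)) * f t * (real ((n - t) choose m) * (- z) ^ m * (q ^ t) ^ (n - t - m))
        = real ((n - 1) choose m) * (- z) ^ m * (real ((n - m - 1) choose (t - 1)) * f t * q ^ (t * (n - m - t)))"
        by (simp add: algebra_simps)
    qed
    also have "\<dots> = real ((n - 1) choose m) * (- z) ^ m * (\<Sum>t=1..n - m. real ((n - m - 1) choose (t - 1)) * f t * q ^ (t * (n - m - t)))"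
      by (simp add: sum_distrib_left)
    also have "\<dots> = real ((n - 1) choose m) * (- z) ^ m"
      using component_identity[of "n - m"] m by simp
    finally show "(\<Sum>t=1..n. real ((n - 1) choose (t - 1)) * f t * (real ((n - t) choose m) * (- z) ^ m * (q ^ t) ^ (n - t - m)))
      = real ((n - 1) choose m) * (- z) ^ m" .
  qed
  also have "\<dots> = (\<Sum>m\<le>n - 1. real ((n - 1) choose m) * (- z) ^ m * 1 ^ (n - 1 - m))"
    by (rule sum.cong) (use n in auto)
  also have "\<dots> = (- z + 1) ^ (n - 1)" by (rule binomial_ring[symmetric])
  finally show ?thesis by simp
qed

text \<open>Differentiation in \<open>z\<close>. The truncated exponents \<open>n - t - 1\<close>
  and \<open>n - 2\<close> do no harm, since the factor in front vanishes where they are cut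
  off.\<close>

lemma polynomial_identity_deriv:
  assumes n: "1 \<le> n"
  shows "(\<Sum>t=1..n. real ((n - 1) choose (t - 1)) * f t * (real (n - t) * (q ^ t - z) ^ (n - t - 1)))
    = real (n - 1) * (1 - z) ^ (n - 2)"
proof -
  have "((\<lambda>z. \<Sum>t=1..n. real ((n - 1) choose (t - 1)) * f t * (q ^ t - z) ^ (n - t)) has_real_derivative
      (\<Sum>t=1..n. real ((n - 1) choose (t - 1)) * f t * (real (n - t) * (q ^ t - z) ^ (n - t - 1) * (0 - 1)))) (at z)"
    by (auto intro!: derivative_eq_intros sum.cong simp: algebra_simps)
  moreover have "((\<lambda>z. (1 - z) ^ (n - 1)) has_real_derivative real (n - 1) * (1 - z) ^ (n - 1 - 1) * (0 - 1)) (at z)"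
    by (auto intro!: derivative_eq_intros)
  moreover have "(\<lambda>z. \<Sum>t=1..n. real ((n - 1) choose (t - 1)) * f t * (q ^ t - z) ^ (n - t)) = (\<lambda>z. (1 - z) ^ (n - 1))"
    using polynomial_identity[OF n] by auto
  ultimately have "(\<Sum>t=1..n. real ((n - 1) choose (t - 1)) * f t * (real (n - t) * (q ^ t - z) ^ (n - t - 1) * (0 - 1)))
    = real (n - 1) * (1 - z) ^ (n - 1 - 1) * (0 - 1)"
    using DERIV_unique by force
  then show ?thesis by (simp add: sum_negf numeral_2_eq_2)
qed

text \<open>Give each of the k - 1 vertices other than the root a geometric discovery time
  conditioned to be at most k. For the connection probabilities \<open>f\<close>, this is the
  probability that t is the first time by which only t - 1 of them are discovered.\<close>

definition phi :: "nat \<Rightarrow> nat \<Rightarrow> real" where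
  "phi k t = real ((k - 1) choose (t - 1)) * f t * (q ^ t - q ^ k) ^ (k - t) / (1 - q ^ k) ^ (k - 1)"

definition rho :: "nat \<Rightarrow> real" where
  "rho k = f k / (1 - q ^ k) ^ (k - 1)"

text \<open>In the identities below the summand $t = k$ has exploration time $k - t = 0$; there
  \<^term>\<open>ell\<close> and \<^term>\<open>Phi\<close> take the required value one, because $0/0 = 0$ and $x^0 = 1$.\<close>

definition ell :: "real \<Rightarrow> real" where
  "ell x = 1 - x / (exp x - 1)"

definition Phi :: "real \<Rightarrow> nat \<Rightarrow> real" where
  "Phi y s = ((1 - exp (- (mu * real s + y))) / (1 - exp (- (mu * real s)))) ^ s"

lemma phi_self: "phi k k = rho k"
  by (simp add: phi_def rho_def)

lemma one_minus_q_power_pos: "1 \<le> k \<Longrightarrow> 0 < 1 - q ^ k"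
  using q_pos q_less_1 by (simp add: power_less_one_iff)

lemma phi_nonneg: "1 \<le> k \<Longrightarrow> t \<le> k \<Longrightarrow> 0 \<le> phi k t"
  using one_minus_q_power_pos[of k] power_decreasing[of t k q] q_pos q_less_1
  by (auto simp: phi_def f_nonneg intro!: divide_nonneg_pos mult_nonneg_nonneg)

lemma rho_nonneg: "1 \<le> k \<Longrightarrow> 0 \<le> rho k"
  using phi_nonneg[of k k] by (simp add: phi_self)

lemma sum_phi: "1 \<le> k \<Longrightarrow> (\<Sum>t=1..k. phi k t) = 1"
  using polynomial_identity[of k "q ^ k"] one_minus_q_power_pos[of k]
  by (simp add: phi_def sum_divide_distrib[symmetric])

text \<open>The derivative identity at z = q^k: dividing by q^t - q^k = q^k (exp (mu (k-t)) - 1)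
  lowers the exponent by one and produces x / (exp x - 1) with x = mu (k - t).\<close>

lemma sum_phi_ell:
  assumes k: "1 \<le> k"
  shows "(\<Sum>t=1..k. phi k t * ell (mu * real (k - t))) = 1 - real (k - 1) * mu / (exp (mu * real k) - 1)"
proof -
  define D where "D = 1 - q ^ k"
  have D: "0 < D" using one_minus_q_power_pos[OF k] by (simp add: D_def)
  have "(\<Sum>t=1..k. phi k t * (mu * real (k - t) / (exp (mu * real (k - t)) - 1)))
    = (\<Sum>t=1..k. mu * q ^ k / D ^ (k - 1) * (real ((k - 1) choose (t - 1)) * f t * (real (k - t) * (q ^ t - q ^ k) ^ (k - t - 1))))"
  proof (rule sum.cong[OF refl])
    fix t assume t: "t \<in> {1..k}"
    show "phi k t * (mu * real (k - t) / (exp (mu * real (k - t)) - 1))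
      = mu * q ^ k / D ^ (k - 1) * (real ((k - 1) choose (t - 1)) * f t * (real (k - t) * (q ^ t - q ^ k) ^ (k - t - 1)))"
    proof (cases "t = k")
      case False
      then have tk: "t < k" using t by auto
      have d: "q ^ t - q ^ k = q ^ k * (exp (mu * real (k - t)) - 1)"
        unfolding q_power using tk by (simp add: algebra_simps of_nat_diff flip: exp_add)
      define e where "e = exp (mu * real (k - t)) - 1"
      have "0 < e" using mu_pos tk by (simp add: e_def)
      moreover have "0 < q ^ k" using q_pos by simp
      moreover have "(q ^ t - q ^ k) ^ (k - t) = (q ^ t - q ^ k) ^ (k - t - 1) * (q ^ k * e)"
      proof -
        have "k - t = Suc (k - t - 1)" using tk by auto
        then show ?thesis by (metis d e_def power_Suc2)
      qed
      ultimately show ?thesis using D(1)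
        unfolding phi_def D_def[symmetric] e_def[symmetric] by simp
    qed simp
  qed
  also have "\<dots> = mu * q ^ k / D ^ (k - 1) * (real (k - 1) * D ^ (k - 2))"
    unfolding sum_distrib_left[symmetric] polynomial_identity_deriv[OF k, of "q ^ k"] D_def[symmetric] ..
  also have "\<dots> = real (k - 1) * mu / (exp (mu * real k) - 1)"
  proof (cases "k = 1")
    case False
    then have "k - 1 = Suc (k - 2)" using k by auto
    then have Dk: "D ^ (k - 1) = D ^ (k - 2) * D" by simp
    define e where "e = exp (mu * real k) - 1"
    have De: "D = q ^ k * e"
      unfolding D_def e_def q_power by (simp add: algebra_simps flip: exp_add)
    have "0 < e" "0 < q ^ k" using mu_pos q_pos k by (auto simp: e_def)
    have "mu * q ^ k / D ^ (k - 1) * (real (k - 1) * D ^ (k - 2)) = mu * q ^ k * real (k - 1) / D"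
      unfolding Dk using D(1) by simp
    also have "\<dots> = real (k - 1) * mu / e" using \<open>0 < e\<close> q_pos by (simp add: De)
    finally show ?thesis by (simp add: e_def)
  qed simp
  finally show ?thesis using sum_phi[OF k]
    by (simp add: ell_def right_diff_distrib sum_subtractf)
qed

text \<open>The polynomial identity at z = q^k exp (-y). The factor q^t common to q^t - z and q^t -
  q^k cancels, so the ratio depends on t only through k - t.\<close>

lemma sum_phi_Phi:
  assumes k: "1 \<le> k"
  shows "(\<Sum>t=1..k. phi k t * Phi y (k - t))
    = ((1 - exp (- (mu * real k + y))) / (1 - exp (- (mu * real k)))) ^ (k - 1)"
proof -
  define D where "D = 1 - q ^ k"
  have D: "0 < D" "D = 1 - exp (- (mu * real k))"
    using one_minus_q_power_pos[OF k] q_power[of k] by (auto simp: D_def)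
  define z where "z = exp (- (mu * real k + y))"
  have "(\<Sum>t=1..k. phi k t * Phi y (k - t))
    = (\<Sum>t=1..k. (real ((k - 1) choose (t - 1)) * f t * (q ^ t - z) ^ (k - t)) / D ^ (k - 1))"
  proof (rule sum.cong[OF refl])
    fix t assume t: "t \<in> {1..k}"
    show "phi k t * Phi y (k - t) = (real ((k - 1) choose (t - 1)) * f t * (q ^ t - z) ^ (k - t)) / D ^ (k - 1)"
    proof (cases "t = k")
      case False
      then have tk: "t < k" using t by auto
      have d: "q ^ t - q ^ k = q ^ t * (1 - exp (- (mu * real (k - t))))"
        "q ^ t - z = q ^ t * (1 - exp (- (mu * real (k - t) + y)))"
        unfolding q_power z_def using tk by (simp_all add: algebra_simps of_nat_diff flip: exp_add)
      define e where "e = 1 - exp (- (mu * real (k - t)))"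
      have "0 < e" using mu_pos tk by (simp add: e_def)
      then show ?thesis
        unfolding phi_def Phi_def d D_def[symmetric] e_def[symmetric] power_mult_distrib power_divide by simp
    qed (simp add: phi_def Phi_def D_def)
  qed
  also have "\<dots> = (1 - z) ^ (k - 1) / D ^ (k - 1)"
    using polynomial_identity[OF k, of z] by (simp add: sum_divide_distrib[symmetric])
  finally show ?thesis by (simp add: z_def D power_divide)
qed

text \<open>The \<open>ell\<close> identity minus B times the \<open>Phi\<close> identity. With this
  \<open>B\<close> the function of k - t vanishes at t = 0, and since \<open>ell\<close> and
  \<open>Phi\<close> are both one at zero, the summand t = k contributes rho_k (1 - B).\<close>

lemma rho_identity:
  assumes k: "1 \<le> k" and y: "0 \<le> y" and X: "X = mu * real k" and B: "B = ell X / Phi y k"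
  shows "rho k * (1 - B) + (\<Sum>t\<in>{1..<k}. phi k t * (ell (mu * real (k - t)) - B * Phi y (k - t)))
    = mu / (exp X - 1) + ell X * ((1 - exp (- y)) / (exp X - exp (- y)))"
proof -
  have X0: "0 < X" using X mu_pos k by simp
  define a b where "a = 1 - exp (- (X + y))" and "b = 1 - exp (- X)"
  have ab: "0 < a" "0 < b" using X0 y by (auto simp: a_def b_def)
  have Ph: "Phi y k = (a / b) ^ k" by (simp add: Phi_def a_def b_def X)
  have "rho k * (1 - B) + (\<Sum>t\<in>{1..<k}. phi k t * (ell (mu * real (k - t)) - B * Phi y (k - t)))
     = (\<Sum>t=1..k. phi k t * (ell (mu * real (k - t)) - B * Phi y (k - t)))"
  proof -
    have "{1..k} = insert k {1..<k}" using k by auto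
    then show ?thesis by (simp add: phi_self ell_def Phi_def)
  qed
  also have "\<dots> = (\<Sum>t=1..k. phi k t * ell (mu * real (k - t))) - B * (\<Sum>t=1..k. phi k t * Phi y (k - t))"
    by (simp add: sum_subtractf right_diff_distrib sum_distrib_left mult.left_commute)
  also have "\<dots> = 1 - real (k - 1) * mu / (exp X - 1) - B * (a / b) ^ (k - 1)"
    using sum_phi_ell[OF k] sum_phi_Phi[OF k, of y] by (simp add: X a_def b_def)
  also have "B * (a / b) ^ (k - 1) = ell X * (b / a)"
  proof -
    have "k = Suc (k - 1)" using k by auto
    then have "(a / b) ^ k = (a / b) ^ (k - 1) * (a / b)" by (metis power_Suc2)
    then show ?thesis unfolding B Ph using ab by (simp add: field_simps)
  qed
  also have "1 - real (k - 1) * mu / (exp X - 1) = mu / (exp X - 1) + ell X"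
    using k by (simp add: ell_def X of_nat_diff algebra_simps diff_divide_distrib)
  also have "b / a = 1 - (1 - exp (- y)) / (exp X - exp (- y))"
  proof -
    have "exp (- y) \<le> 1" "1 < exp X" using y X0 by auto
    then have "0 < exp X - exp (- y)" by linarith
    moreover have "a = (exp X - exp (- y)) * exp (- X)" "b = (exp X - 1) * exp (- X)"
      by (simp_all add: a_def b_def algebra_simps flip: exp_add)
    ultimately have "b / a = (exp X - 1) / (exp X - exp (- y))" "exp X - exp (- y) \<noteq> 0" by auto
    then show ?thesis by (simp add: field_simps)
  qed
  finally show ?thesis by (simp add: algebra_simps)
qed

end

section \<open>Elementary estimates\<close>

lemma nonneg_of_deriv_nonneg:
  fixes h :: "real \<Rightarrow> real"
  assumes "0 \<le> x" "0 \<le> h 0"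
    and "\<And>t. 0 \<le> t \<Longrightarrow> t \<le> x \<Longrightarrow> (h has_real_derivative h' t) (at t)"
    and "\<And>t. 0 \<le> t \<Longrightarrow> t \<le> x \<Longrightarrow> 0 \<le> h' t"
  shows "0 \<le> h x"
proof -
  have "h 0 \<le> h x"
    by (rule DERIV_nonneg_imp_nondecreasing[OF assms(1)]) (use assms in blast)
  then show ?thesis using assms by linarith
qed

lemma exp_lower_3:
  assumes "0 \<le> (x::real)"
  shows "1 + x + x^2/2 + x^3/6 \<le> exp x"
proof -
  have "0 \<le> exp x - (1 + x + x^2/2 + x^3/6)"
  proof (rule nonneg_of_deriv_nonneg[OF assms, where h' = "\<lambda>t. exp t - (1 + t + t^2/2)"])
    show "((\<lambda>x. exp x - (1 + x + x^2/2 + x^3/6)) has_real_derivative exp t - (1 + t + t^2/2)) (at t)" for t :: real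
      by (auto intro!: derivative_eq_intros simp: power2_eq_square)
  qed (use exp_lower_Taylor_quadratic in auto)
  then show ?thesis by simp
qed

lemma exp_upper_3:
  assumes "0 \<le> (x::real)" "x \<le> 1"
  shows "exp x \<le> 1 + x + x^2/2 + x^3/2"
proof -
  have e3: "exp t \<le> 3" if "t \<le> 1" for t :: real
    using exp_le that by (meson exp_le_cancel_iff order_trans)
  have a: "0 \<le> 1 + 3 * t - exp t" if "0 \<le> t" "t \<le> 1" for t :: real
    by (rule nonneg_of_deriv_nonneg[OF that(1), where h' = "\<lambda>t. 3 - exp t"])
      (use that e3 in \<open>auto intro!: derivative_eq_intros\<close>)
  have b: "0 \<le> 1 + t + 3 * t^2/2 - exp t" if "0 \<le> t" "t \<le> 1" for t :: real
    by (rule nonneg_of_deriv_nonneg[OF that(1), where h' = "\<lambda>t. 1 + 3 * t - exp t"])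
      (use that a in \<open>auto intro!: derivative_eq_intros\<close>)
  have "0 \<le> 1 + x + x^2/2 + x^3/2 - exp x"
    by (rule nonneg_of_deriv_nonneg[OF assms(1), where h' = "\<lambda>t. 1 + t + 3 * t^2/2 - exp t"])
      (use assms b in \<open>auto intro!: derivative_eq_intros simp: power2_eq_square\<close>)
  then show ?thesis by simp
qed

lemma exp_minus_lower_3:
  assumes "0 \<le> (x::real)"
  shows "1 - x + x^2/2 - x^3/6 \<le> exp (- x)"
proof -
  have a: "0 \<le> exp (-t) - (1 - t)" for t :: real using exp_ge_add_one_self[of "-t"] by simp
  have b: "0 \<le> (1 - t + t^2/2) - exp (-t)" if "0 \<le> t" for t :: real
    by (rule nonneg_of_deriv_nonneg[OF that, where h' = "\<lambda>t. exp (-t) - (1 - t)"])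
      (use a in \<open>auto intro!: derivative_eq_intros simp: algebra_simps\<close>)
  have "0 \<le> exp (-x) - (1 - x + x^2/2 - x^3/6)"
    by (rule nonneg_of_deriv_nonneg[OF assms, where h' = "\<lambda>t. (1 - t + t^2/2) - exp (-t)"])
      (use b in \<open>auto intro!: derivative_eq_intros simp: power2_eq_square\<close>)
  then show ?thesis by simp
qed

text \<open>Here $\chi(x) = \ln (\sinh(x/2) / (x/2))$, and \<^term>\<open>kap\<close> is its derivative $\coth(x/2)/2 - 1/x$.\<close>

definition kap :: "real \<Rightarrow> real" where
  "kap x = 1 / (exp x - 1) - 1 / x + 1 / 2"

definition chi :: "real \<Rightarrow> real" where
  "chi x = ln ((1 - exp (- x)) / x) + x / 2"

text \<open>After clearing denominators the numerator is (x - 2) exp x + x + 2, which vanishes at 0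
  together with its first derivative and has second derivative x exp x.\<close>

lemma kap_nonneg:
  assumes "0 < x"
  shows "0 \<le> kap x"
proof -
  have b: "0 \<le> (t - 1) * exp t + 1" if "0 \<le> t" for t :: real
    by (rule nonneg_of_deriv_nonneg[OF that, where h' = "\<lambda>t. t * exp t"])
      (auto intro!: derivative_eq_intros simp: algebra_simps)
  have "0 \<le> (x - 2) * exp x + x + 2"
    by (rule nonneg_of_deriv_nonneg[where h' = "\<lambda>t. (t - 1) * exp t + 1"])
      (use assms b in \<open>auto intro!: derivative_eq_intros simp: algebra_simps\<close>)
  moreover have "kap x = ((x - 2) * exp x + x + 2) / (2 * x * (exp x - 1))"
    using assms by (simp add: kap_def divide_simps) (simp add: algebra_simps)
  ultimately show ?thesis using assms by simp
qed

lemma kap_upper: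
  assumes "0 < x" "x \<le> 1"
  shows "kap x \<le> x / 2"
proof -
  \<comment> \<open>Chosen so that x (1 + v) is the cubic Taylor polynomial of exp x - 1. The true
    slope of \<open>kap\<close> at 0 is 1/12; the crude 1/2 leaves room for the quadratic bound on
    1/(1+v).\<close>
  define v where "v = x / 2 + x^2 / 6"
  have "x^2 \<le> x" using assms by (simp add: power2_eq_square mult_left_le)
  then have v: "0 < v" "v \<le> 2 * x / 3" using assms by (auto simp: v_def intro: add_pos_pos)
  have "x * (1 + v) \<le> exp x - 1"
    using exp_lower_3[of x] assms by (simp add: v_def algebra_simps power2_eq_square power3_eq_cube)
  then have "1 / (exp x - 1) \<le> 1 / (x * (1 + v))"
    using assms v by (intro divide_left_mono mult_pos_pos) auto
  also have "\<dots> \<le> (1 - v + v^2) / x"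
  proof -
    have "1 \<le> (1 - v + v^2) * (1 + v)" using v by (simp add: algebra_simps power2_eq_square)
    then have "1 / (1 + v) \<le> 1 - v + v^2" using v by (simp add: divide_le_eq)
    then have "1 / (1 + v) / x \<le> (1 - v + v^2) / x" using assms by (intro divide_right_mono) auto
    then show ?thesis by (simp add: mult.commute)
  qed
  also have "\<dots> \<le> (1 - x / 2 + x^2 / 2) / x"
  proof (rule divide_right_mono)
    have "v^2 \<le> (2 * x / 3)^2" using v by (intro power_mono) auto
    moreover have "(2 * x / 3)^2 = 4 / 9 * x^2" by (simp add: power2_eq_square)
    moreover have "0 \<le> x^2" by simp
    moreover have "1 - v = 1 - x / 2 - x^2 / 6" by (simp add: v_def)
    ultimately show "1 - v + v^2 \<le> 1 - x / 2 + x^2 / 2" by linarith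
  qed (use assms in auto)
  also have "\<dots> = 1 / x - 1 / 2 + x / 2" using assms by (simp add: field_simps power2_eq_square)
  finally show ?thesis by (simp add: kap_def)
qed

definition kap_deriv :: "real \<Rightarrow> real" where
  "kap_deriv x = 1 / x^2 - exp x / (exp x - 1)^2"

lemma kap_has_deriv: "0 < x \<Longrightarrow> (kap has_real_derivative kap_deriv x) (at x)"
  unfolding kap_def[abs_def] kap_deriv_def
  by (auto intro!: derivative_eq_intros simp: power2_eq_square)

text \<open>With d = 2 sinh (x/2) the derivative is 1/x^2 - 1/d^2, so it is enough that x <= d, and
  that d <= x + x^3/2 for x <= 1.\<close>

lemma kap_deriv_bounds:
  assumes "0 < x"
  shows "0 \<le> kap_deriv x" and "x \<le> 1 \<Longrightarrow> kap_deriv x \<le> 1"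
proof -
  define d where "d = exp (x / 2) - exp (- (x / 2))"
  have e: "exp x / (exp x - 1)^2 = 1 / d^2"
  proof -
    have "exp x - 1 = exp (x / 2) * d"
      by (simp add: d_def algebra_simps flip: exp_add)
    moreover have "exp x = exp (x / 2)^2" by (simp add: power2_eq_square flip: exp_add)
    ultimately show ?thesis by (simp add: power_mult_distrib)
  qed
  have dx: "x \<le> d"
  proof -
    have "0 \<le> (exp (x / 2) - exp (- (x / 2))) - x"
      by (rule nonneg_of_deriv_nonneg[where h' = "\<lambda>t. (exp (t / 2) + exp (- (t / 2))) / 2 - 1"])
        (use assms cosh_real_ge_1 in \<open>auto intro!: derivative_eq_intros simp: cosh_def field_simps\<close>)
    then show ?thesis by (simp add: d_def)
  qed
  then have "x^2 \<le> d^2" using assms by (intro power_mono) auto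
  then show "0 \<le> kap_deriv x"
    using assms dx by (simp add: kap_deriv_def e frac_le)
  assume x1: "x \<le> 1"
  have dx3: "d - x \<le> x^3 / 2"
  proof -
    have "exp (x / 2) \<le> 1 + x / 2 + (x / 2)^2 / 2 + (x / 2)^3 / 2"
      "1 - x / 2 + (x / 2)^2 / 2 - (x / 2)^3 / 6 \<le> exp (- (x / 2))"
      using exp_upper_3[of "x / 2"] exp_minus_lower_3[of "x / 2"] assms x1 by auto
    moreover have "(x / 2)^3 = x^3 / 8" "0 < x^3" using assms by (auto simp: power_divide)
    ultimately show ?thesis unfolding d_def by linarith
  qed
  have "kap_deriv x = (d - x) * (d + x) / (x^2 * d^2)"
  proof -
    have "kap_deriv x = 1 / x^2 - 1 / d^2" unfolding kap_deriv_def e ..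
    then show ?thesis using assms dx by (simp add: field_simps power2_eq_square)
  qed
  also have "\<dots> \<le> (x^3 / 2) * (2 * d) / (x^2 * d^2)"
    by (intro divide_right_mono mult_mono) (use dx dx3 assms in auto)
  also have "\<dots> = x / d" using assms dx by (simp add: field_simps power2_eq_square power3_eq_cube)
  also have "\<dots> \<le> 1" using assms dx by simp
  finally show "kap_deriv x \<le> 1" .
qed

lemma kap_mono: "0 < x \<Longrightarrow> x \<le> x' \<Longrightarrow> kap x \<le> kap x'"
  by (rule DERIV_nonneg_imp_nondecreasing)
    (use kap_has_deriv kap_deriv_bounds in \<open>meson less_le_trans\<close>)+

lemma kap_diff:
  assumes "0 < x" "x \<le> x'" "x' \<le> 1"
  shows "kap x' - kap x \<le> x' - x"
proof -
  have "x - kap x \<le> x' - kap x'"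
  proof (rule DERIV_nonneg_imp_nondecreasing[OF assms(2)])
    fix t assume "x \<le> t" "t \<le> x'"
    then show "\<exists>y. ((\<lambda>x. x - kap x) has_real_derivative y) (at t) \<and> 0 \<le> y"
      using kap_has_deriv[of t] kap_deriv_bounds[of t] assms
      by (intro exI[of _ "1 - kap_deriv t"]) (auto intro!: derivative_eq_intros)
  qed
  then show ?thesis by simp
qed

lemma chi_has_deriv:
  assumes "0 < x"
  shows "(chi has_real_derivative kap x) (at x)"
proof -
  have "exp (-x) / (1 - exp (-x)) = 1 / (exp x - 1)"
    using assms by (simp add: exp_minus field_simps)
  then have "kap x = ((exp (-x) * x - (1 - exp (-x)) * 1) / (x * x)) * inverse ((1 - exp (- x)) / x) + 1 / 2"
    using assms unfolding kap_def by (simp add: field_simps)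
  then show ?thesis
    unfolding chi_def[abs_def] using assms
    by (auto intro!: derivative_eq_intros)
qed

lemma chi_increment:
  assumes "0 < x" "0 \<le> y"
  shows "0 \<le> chi (x + y) - chi x" and "chi (x + y) - chi x \<le> y * kap (x + y)"
proof -
  have "chi x \<le> chi (x + y)"
  proof (rule DERIV_nonneg_imp_nondecreasing[where f = chi])
    fix t assume "x \<le> t" "t \<le> x + y"
    then have "0 < t" using assms by linarith
    then show "\<exists>z. (chi has_real_derivative z) (at t) \<and> 0 \<le> z"
      using chi_has_deriv kap_nonneg by blast
  qed (use assms in simp)
  then show "0 \<le> chi (x + y) - chi x" by simp
  have "x * kap (x + y) - chi x \<le> (x + y) * kap (x + y) - chi (x + y)"
  proof (rule DERIV_nonneg_imp_nondecreasing[where f = "\<lambda>t. t * kap (x + y) - chi t"])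
    fix t assume t: "x \<le> t" "t \<le> x + y"
    have "((\<lambda>t. t * kap (x + y) - chi t) has_real_derivative 1 * kap (x + y) - kap t) (at t)"
      by (intro DERIV_diff[OF DERIV_cmult_right[OF DERIV_ident] chi_has_deriv]) (use t assms in auto)
    then show "\<exists>z. ((\<lambda>t. t * kap (x + y) - chi t) has_real_derivative z) (at t) \<and> 0 \<le> z"
      using kap_mono[of t "x + y"] t assms by (intro exI[of _ "1 * kap (x + y) - kap t"]) auto
  qed (use assms in auto)
  then show "chi (x + y) - chi x \<le> y * kap (x + y)" by (simp add: algebra_simps)
qed

text \<open>\<open>chi\<close> is convex, so its increments over a fixed length grow; its derivative
  \<open>kap\<close> is 1-Lipschitz on (0,1], so they grow slowly.\<close>

lemma chi_increment_diff:
  assumes "0 < x" "x \<le> x'" "0 \<le> y"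
  shows "chi (x + y) - chi x \<le> chi (x' + y) - chi x'"
    and "x' + y \<le> 1 \<Longrightarrow> (chi (x' + y) - chi x') - (chi (x + y) - chi x) \<le> y * (x' - x)"
proof -
  have d: "((\<lambda>t. chi (t + y) - chi t) has_real_derivative kap (t + y) - kap t) (at t)" if "0 < t" for t
    using DERIV_shift[of chi "kap (t + y)" t y] chi_has_deriv[of "t + y"] chi_has_deriv[of t] that assms
    by (auto intro!: DERIV_diff)
  show "chi (x + y) - chi x \<le> chi (x' + y) - chi x'"
  proof (rule DERIV_nonneg_imp_nondecreasing[OF assms(2), where f = "\<lambda>t. chi (t + y) - chi t"])
    fix t assume "x \<le> t" "t \<le> x'"
    then show "\<exists>z. ((\<lambda>t. chi (t + y) - chi t) has_real_derivative z) (at t) \<and> 0 \<le> z"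
      using d[of t] kap_mono[of t "t + y"] assms by (intro exI[of _ "kap (t + y) - kap t"]) auto
  qed
  assume le1: "x' + y \<le> 1"
  have "y * x - (chi (x + y) - chi x) \<le> y * x' - (chi (x' + y) - chi x')"
  proof (rule DERIV_nonneg_imp_nondecreasing[OF assms(2), where f = "\<lambda>t. y * t - (chi (t + y) - chi t)"])
    fix t assume t: "x \<le> t" "t \<le> x'"
    then have "kap (t + y) - kap t \<le> y" using kap_diff[of t "t + y"] assms le1 by auto
    moreover have "((\<lambda>t. y * t - (chi (t + y) - chi t)) has_real_derivative y * 1 - (kap (t + y) - kap t)) (at t)"
      by (intro DERIV_diff[OF DERIV_cmult[OF DERIV_ident] d]) (use t assms in auto)
    ultimately show "\<exists>z. ((\<lambda>t. y * t - (chi (t + y) - chi t)) has_real_derivative z) (at t) \<and> 0 \<le> z"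
      by (intro exI[of _ "y * 1 - (kap (t + y) - kap t)"]) auto
  qed
  then show "(chi (x' + y) - chi x') - (chi (x + y) - chi x) \<le> y * (x' - x)"
    by (simp add: algebra_simps)
qed

text \<open>This expression is the derivative of v ln (1 + sigma/v) in v, at u = sigma/v. The lower
  bound is -ln (1 - w) >= w + w^2/2 with w = u/(1+u).\<close>

lemma ln_excess_bounds:
  assumes "0 \<le> (u::real)"
  shows "u^2 / (2 * (1 + u)^2) \<le> ln (1 + u) - u / (1 + u)"
    and "ln (1 + u) - u / (1 + u) \<le> u^2 / 2"
proof -
  have r: "u / (1 + u) = 1 - inverse (1 + u)" using assms by (simp add: field_simps)
  have "0 \<le> ln (1 + u) - (1 - inverse (1 + u)) - (1 - inverse (1 + u))^2 / 2"
  proof (rule nonneg_of_deriv_nonneg[OF assms, where h' = "\<lambda>t. inverse (1 + t) * (1 - inverse (1 + t))^2"])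
    fix t :: real assume t: "0 \<le> t"
    have alg: "r - (0 - - (r * r)) - 2 * (1 - r) * (r * r) / 2 = r * (1 - r)^2" for r :: real
      by (simp add: diff_divide_distrib algebra_simps power2_eq_square)
    have i: "((\<lambda>u. inverse (1 + u)) has_real_derivative - (inverse (1 + t) * inverse (1 + t))) (at t)"
      using t by (auto intro!: derivative_eq_intros)
    have i2: "((\<lambda>u. (1 - inverse (1 + u))^2) has_real_derivative
        2 * (1 - inverse (1 + t)) * (inverse (1 + t) * inverse (1 + t))) (at t)"
      using t by (auto intro!: derivative_eq_intros)
    have l: "((\<lambda>u. ln (1 + u)) has_real_derivative inverse (1 + t)) (at t)"
      using t by (auto intro!: derivative_eq_intros simp: divide_inverse)
    show "((\<lambda>u. ln (1 + u) - (1 - inverse (1 + u)) - (1 - inverse (1 + u))^2 / 2)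
        has_real_derivative inverse (1 + t) * (1 - inverse (1 + t))^2) (at t)"
      by (rule DERIV_cong[OF DERIV_diff[OF DERIV_diff[OF l DERIV_diff[OF DERIV_const i]] DERIV_cdivide[OF i2]]])
        (rule alg)
  qed (use assms in auto)
  then show "u^2 / (2 * (1 + u)^2) \<le> ln (1 + u) - u / (1 + u)"
    unfolding r[symmetric] by (simp add: power_divide)
  have "0 \<le> u^2 / 2 - (ln (1 + u) - (1 - inverse (1 + u)))"
  proof (rule nonneg_of_deriv_nonneg[OF assms, where h' = "\<lambda>t. t - (inverse (1 + t) - inverse (1 + t) * inverse (1 + t))"])
    fix t :: real assume t: "0 \<le> t"
    show "((\<lambda>u. u^2 / 2 - (ln (1 + u) - (1 - inverse (1 + u)))) has_real_derivative
        t - (inverse (1 + t) - inverse (1 + t) * inverse (1 + t))) (at t)"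
    proof -
      have i: "((\<lambda>u. inverse (1 + u)) has_real_derivative - (inverse (1 + t) * inverse (1 + t))) (at t)"
        using t by (auto intro!: derivative_eq_intros)
      have l: "((\<lambda>u. ln (1 + u)) has_real_derivative inverse (1 + t)) (at t)"
        using t by (auto intro!: derivative_eq_intros simp: divide_inverse)
      have p: "((\<lambda>u. u^2) has_real_derivative 2 * t) (at t)"
        by (auto intro!: derivative_eq_intros)
      show ?thesis
        by (rule DERIV_cong[OF DERIV_diff[OF DERIV_cdivide[OF p] DERIV_diff[OF l DERIV_diff[OF DERIV_const i]]]]) simp
    qed
    have "inverse (1 + t) - inverse (1 + t) * inverse (1 + t) = t * (inverse (1 + t))^2"
    proof -
      have "t * inverse (1 + t) = 1 - inverse (1 + t)" using t by (simp add: field_simps)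
      then show ?thesis by (simp add: power2_eq_square left_diff_distrib flip: mult.assoc)
    qed
    also have "\<dots> \<le> t * 1" using t by (intro mult_left_mono power_le_one) (auto simp: field_simps)
    finally show "0 \<le> t - (inverse (1 + t) - inverse (1 + t) * inverse (1 + t))" by simp
  qed simp
  then show "ln (1 + u) - u / (1 + u) \<le> u^2 / 2" unfolding r by simp
qed

text \<open>By \<open>ln_excess_bounds\<close> the derivative of v ln (1 + sigma/v) lies between
  sigma^2/(2 (v+sigma)^2) and sigma^2/(2 v^2). Integrate from xi to 1, replacing v by xi in the
  upper bound.\<close>

lemma perspective_ln_bounds:
  assumes "0 < (\<xi>::real)" "\<xi> \<le> 1" "0 \<le> \<sigma>"
  shows "\<sigma>^2 / 2 * (1 - \<xi>) / ((\<xi> + \<sigma>) * (1 + \<sigma>)) \<le> ln (1 + \<sigma>) - \<xi> * ln (1 + \<sigma> / \<xi>)"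
    and "ln (1 + \<sigma>) - \<xi> * ln (1 + \<sigma> / \<xi>) \<le> (1 - \<xi>) * \<sigma>^2 / (2 * \<xi>^2)"
proof -
  have d: "((\<lambda>v. v * ln (1 + \<sigma> / v)) has_real_derivative ln (1 + \<sigma> / v) - (\<sigma> / v) / (1 + \<sigma> / v)) (at v)"
    if "0 < v" for v
  proof -
    have pos: "0 < 1 + \<sigma> / v" using that assms by (simp add: add_pos_nonneg)
    have "((\<lambda>v. 1 + \<sigma> / v) has_real_derivative - (\<sigma> / v) / v) (at v)"
      using that by (auto intro!: derivative_eq_intros)
    from DERIV_mult[OF DERIV_ident DERIV_chain2[OF DERIV_ln_divide[OF pos] this]]
    have "((\<lambda>v. v * ln (1 + \<sigma> / v)) has_real_derivative
        1 * ln (1 + \<sigma> / v) + 1 / (1 + \<sigma> / v) * (- (\<sigma> / v) / v) * v) (at v)" .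
    then show ?thesis by (rule DERIV_cong) (use that in simp)
  qed
  have "\<xi> * ln (1 + \<sigma> / \<xi>) + \<sigma>^2 / 2 / (\<xi> + \<sigma>) \<le> 1 * ln (1 + \<sigma> / 1) + \<sigma>^2 / 2 / (1 + \<sigma>)"
  proof (rule DERIV_nonneg_imp_nondecreasing[OF assms(2), where f = "\<lambda>v. v * ln (1 + \<sigma> / v) + \<sigma>^2 / 2 / (v + \<sigma>)"])
    fix v assume v: "\<xi> \<le> v" "v \<le> 1"
    then have v0: "0 < v" "0 < v + \<sigma>" using assms by auto
    have "((\<lambda>v. inverse (v + \<sigma>)) has_real_derivative - (inverse (v + \<sigma>) * inverse (v + \<sigma>))) (at v)"
      using v0(2) by (auto intro!: derivative_eq_intros)
    from DERIV_cmult[OF this, of "\<sigma>^2 / 2"] have "((\<lambda>v. \<sigma>^2 / 2 / (v + \<sigma>)) has_real_derivative - (\<sigma>^2 / 2 / (v + \<sigma>)^2)) (at v)"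
      unfolding divide_inverse[of _ "_ + \<sigma>"] divide_inverse[of _ "(_ + \<sigma>)^2"] power_inverse[symmetric]
      by (rule DERIV_cong) (simp only: power2_eq_square mult_minus_right)
    from DERIV_add[OF d[OF v0(1)] this]
    have "((\<lambda>v. v * ln (1 + \<sigma> / v) + \<sigma>^2 / 2 / (v + \<sigma>)) has_real_derivative
        ln (1 + \<sigma> / v) - (\<sigma> / v) / (1 + \<sigma> / v) + - (\<sigma>^2 / 2 / (v + \<sigma>)^2)) (at v)" .
    moreover have sv: "(\<sigma> / v)^2 / (2 * (1 + \<sigma> / v)^2) = \<sigma>^2 / 2 / (v + \<sigma>)^2"
    proof -
      have "1 + \<sigma> / v = (v + \<sigma>) / v" using v0 by (simp add: field_simps)
      then show ?thesis using v0 by (simp add: power_divide)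
    qed
    have "0 \<le> ln (1 + \<sigma> / v) - (\<sigma> / v) / (1 + \<sigma> / v) + - (\<sigma>^2 / 2 / (v + \<sigma>)^2)"
      unfolding sv[symmetric] using ln_excess_bounds(1)[of "\<sigma> / v"] v0 assms by simp
    ultimately show "\<exists>y. ((\<lambda>v. v * ln (1 + \<sigma> / v) + \<sigma>^2 / 2 / (v + \<sigma>)) has_real_derivative y) (at v) \<and> 0 \<le> y"
      by blast
  qed
  moreover have "\<sigma>^2 / 2 / (\<xi> + \<sigma>) - \<sigma>^2 / 2 / (1 + \<sigma>) = \<sigma>^2 / 2 * (1 - \<xi>) / ((\<xi> + \<sigma>) * (1 + \<sigma>))"
  proof -
    have "A / a - A / b = A * (b - a) / (a * b)" if "a \<noteq> 0" "b \<noteq> 0" for A a b :: real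
      using that by (simp add: field_simps)
    from this[of "\<xi> + \<sigma>" "1 + \<sigma>" "\<sigma>^2 / 2"] show ?thesis using assms by simp
  qed
  ultimately show "\<sigma>^2 / 2 * (1 - \<xi>) / ((\<xi> + \<sigma>) * (1 + \<sigma>)) \<le> ln (1 + \<sigma>) - \<xi> * ln (1 + \<sigma> / \<xi>)"
    by simp
  have "\<xi> * (\<sigma>^2 / (2 * \<xi>^2)) - \<xi> * ln (1 + \<sigma> / \<xi>) \<le> 1 * (\<sigma>^2 / (2 * \<xi>^2)) - 1 * ln (1 + \<sigma> / 1)"
  proof (rule DERIV_nonneg_imp_nondecreasing[OF assms(2), where f = "\<lambda>v. v * (\<sigma>^2 / (2 * \<xi>^2)) - v * ln (1 + \<sigma> / v)"])
    fix v assume v: "\<xi> \<le> v" "v \<le> 1"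
    then have v0: "0 < v" using assms by auto
    have "(\<sigma> / v)^2 / 2 \<le> (\<sigma> / \<xi>)^2 / 2"
      using v assms by (intro divide_right_mono power_mono divide_left_mono) auto
    then have "0 \<le> 1 * (\<sigma>^2 / (2 * \<xi>^2)) - (ln (1 + \<sigma> / v) - (\<sigma> / v) / (1 + \<sigma> / v))"
      using ln_excess_bounds(2)[of "\<sigma> / v"] v0 assms by (simp add: power_divide)
    moreover have "((\<lambda>v. v * (\<sigma>^2 / (2 * \<xi>^2)) - v * ln (1 + \<sigma> / v)) has_real_derivative
        1 * (\<sigma>^2 / (2 * \<xi>^2)) - (ln (1 + \<sigma> / v) - (\<sigma> / v) / (1 + \<sigma> / v))) (at v)"
      by (intro DERIV_diff[OF DERIV_cmult_right[OF DERIV_ident] d[OF v0]])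
    ultimately show "\<exists>y. ((\<lambda>v. v * (\<sigma>^2 / (2 * \<xi>^2)) - v * ln (1 + \<sigma> / v)) has_real_derivative y) (at v) \<and> 0 \<le> y"
      by blast
  qed
  moreover have "(1 - \<xi>) * \<sigma>^2 / (2 * \<xi>^2) = 1 * (\<sigma>^2 / (2 * \<xi>^2)) - \<xi> * (\<sigma>^2 / (2 * \<xi>^2))"
    unfolding left_diff_distrib[symmetric] by simp
  ultimately show "ln (1 + \<sigma>) - \<xi> * ln (1 + \<sigma> / \<xi>) \<le> (1 - \<xi>) * \<sigma>^2 / (2 * \<xi>^2)"
    by simp
qed

section \<open>Stirling's formula and exponential sums\<close>

definition stirling_rest :: "nat \<Rightarrow> real" where
  "stirling_rest n = ln (fact n) - (real n + 1/2) * ln (real n) + real n"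

text \<open>The difference is (n + 1/2) ln (1 + 1/n) - 1. Its upper bound is put in telescoping
  form, which gives the error 1/n in Stirling's formula.\<close>

lemma stirling_rest_Suc:
  assumes "1 \<le> n"
  shows "0 \<le> stirling_rest n - stirling_rest (Suc n)"
    and "stirling_rest n - stirling_rest (Suc n) \<le> 1 / real n - 1 / real (Suc n)"
proof -
  have n0: "0 < real n" using assms by simp
  have eq: "stirling_rest n - stirling_rest (Suc n) = (real n + 1/2) * ln (1 + 1 / real n) - 1"
  proof -
    have a: "ln (1 + 1 / real n) = ln (real (Suc n)) - ln (real n)"
      using n0 ln_div[of "real (Suc n)" "real n"] by (simp add: add_divide_distrib add.commute)
    have b: "ln (fact (Suc n)) = ln (real (Suc n)) + ln (fact n :: real)"
      unfolding fact_Suc of_nat_mult by (simp add: ln_mult)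
    have c: "real (Suc n) = real n + 1" by simp
    show ?thesis unfolding stirling_rest_def a b by (simp only: c algebra_simps)
  qed
  \<comment> \<open>This is ln (1+t) >= 2t/(2+t) at t = 1/n; the right side then equals 1/(n + 1/2)
    exactly.\<close>
  have "0 \<le> ln (1 + 1 / real n) - 2 * (1 - 2 * inverse (2 + 1 / real n))"
  proof (rule nonneg_of_deriv_nonneg[where x = "1 / real n" and h = "\<lambda>t. ln (1 + t) - 2 * (1 - 2 * inverse (2 + t))"
      and h' = "\<lambda>t. 1 / (1 + t) - 4 / (2 + t)^2"])
    fix t :: real assume t: "0 \<le> t"
    show "((\<lambda>t. ln (1 + t) - 2 * (1 - 2 * inverse (2 + t))) has_real_derivative 1 / (1 + t) - 4 / (2 + t)^2) (at t)"
      using t by (auto intro!: derivative_eq_intros simp: divide_inverse power2_eq_square)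
    have "4 / (2 + t)^2 \<le> 4 / (4 * (1 + t))"
      using t by (intro frac_le) (auto simp: power2_eq_square algebra_simps)
    also have "4 / (4 * (1 + t)) = 1 / (1 + t)" using mult_divide_mult_cancel_left[of "4::real" 1 "1 + t"] by (simp only: mult_1_right)
    finally show "0 \<le> 1 / (1 + t) - 4 / (2 + t)^2" by simp
  qed (use n0 in auto)
  moreover have "2 * (1 - 2 * inverse (2 + 1 / real n)) = 1 / (real n + 1/2)"
    using n0 by (simp add: field_simps)
  ultimately have "1 / (real n + 1/2) \<le> ln (1 + 1 / real n)" by simp
  then have "(real n + 1/2) * (1 / (real n + 1/2)) \<le> (real n + 1/2) * ln (1 + 1 / real n)"
    by (intro mult_left_mono) auto
  then show "0 \<le> stirling_rest n - stirling_rest (Suc n)" unfolding eq by simp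
  have "ln (1 + 1 / real n) \<le> 1 / real n - (1 / real n)^2 / 2 + (1 / real n)^3 / 3"
  proof -
    define u where "u = 1 / real n"
    have "0 \<le> u - u^2 / 2 + u^3 / 3 - ln (1 + u)"
    proof (rule nonneg_of_deriv_nonneg[where x = u and h = "\<lambda>t. t - t^2 / 2 + t^3 / 3 - ln (1 + t)"
        and h' = "\<lambda>t. 1 - t + t^2 - inverse (1 + t)"])
      fix t :: real assume t: "0 \<le> t"
      show "((\<lambda>t. t - t^2 / 2 + t^3 / 3 - ln (1 + t)) has_real_derivative 1 - t + t^2 - inverse (1 + t)) (at t)"
      proof -
        have p: "((\<lambda>t. t - t^2 / 2 + t^3 / 3) has_real_derivative 1 - t + t^2) (at t)"
          by (auto intro!: derivative_eq_intros)
        have "((\<lambda>t. ln (1 + t)) has_real_derivative inverse (1 + t)) (at t)"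
          using t by (auto intro!: derivative_eq_intros simp: divide_inverse)
        with p show ?thesis by (rule DERIV_diff)
      qed
      have "1 \<le> (1 - t + t^2) * (1 + t)" using t by (simp add: algebra_simps power2_eq_square)
      then have "inverse (1 + t) \<le> 1 - t + t^2" using t by (simp add: inverse_eq_divide divide_le_eq)
      then show "0 \<le> 1 - t + t^2 - inverse (1 + t)" by simp
    qed (auto simp: u_def)
    then show ?thesis by (simp add: u_def)
  qed
  then have "(real n + 1/2) * ln (1 + 1 / real n) \<le> (real n + 1/2) * (1 / real n - (1 / real n)^2 / 2 + (1 / real n)^3 / 3)"
    by (intro mult_left_mono) auto
  also have "\<dots> = 1 + (1 / real n)^2 / 12 + (1 / real n)^3 / 6"
    using n0 by (simp add: field_simps power2_eq_square power3_eq_cube)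
  also have "\<dots> \<le> 1 + 1 / real n - 1 / real (Suc n)"
  proof -
    have "1 \<le> real n" using assms by simp
    then have "(1 / real n)^3 \<le> (1 / real n)^2" by (intro power_decreasing) auto
    then have "(1 / real n)^2 / 12 + (1 / real n)^3 / 6 \<le> (1 / real n)^2 / 2"
      using zero_le_power2[of "1 / real n"] by linarith
    also have "\<dots> = 1 / (real n * (2 * real n))" by (simp add: power2_eq_square)
    also have "\<dots> \<le> 1 / (real n * real (Suc n))"
      using \<open>1 \<le> real n\<close> by (intro divide_left_mono mult_left_mono) auto
    also have "\<dots> = 1 / real n - 1 / real (Suc n)" using n0 by (simp add: field_simps)
    finally show ?thesis by simp
  qed
  finally show "stirling_rest n - stirling_rest (Suc n) \<le> 1 / real n - 1 / real (Suc n)"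
    unfolding eq by simp
qed

lemma stirling_rest_diff:
  assumes "1 \<le> n" "n \<le> m"
  shows "0 \<le> stirling_rest n - stirling_rest m"
    and "stirling_rest n - stirling_rest m \<le> 1 / real n - 1 / real m"
proof -
  from assms(2) have "0 \<le> stirling_rest n - stirling_rest m \<and> stirling_rest n - stirling_rest m \<le> 1 / real n - 1 / real m"
  proof (induction rule: dec_induct)
    case (step m)
    then show ?case using stirling_rest_Suc[of m] assms(1) by linarith
  qed simp
  then show "0 \<le> stirling_rest n - stirling_rest m" "stirling_rest n - stirling_rest m \<le> 1 / real n - 1 / real m"
    by auto
qed

lemma wallis_fact:
  "(\<Prod>k=1..n. (4 * real k^2) / (4 * real k^2 - 1)) = (2^(2*n) * fact n ^ 2)^2 / (fact (2 * n) ^ 2 * (2 * real n + 1))"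
proof (induction n)
  case (Suc n)
  have f: "fact (2 * Suc n) = (2 * real n + 2) * (2 * real n + 1) * fact (2 * n)"
    by (simp add: algebra_simps)
  have a: "4 * real (Suc n)^2 - 1 = (2 * real n + 1) * (2 * real n + 3)"
    by (simp add: algebra_simps power2_eq_square)
  have "(\<Prod>k=1..Suc n. (4 * real k^2) / (4 * real k^2 - 1))
    = (2^(2*n) * fact n ^ 2)^2 / (fact (2 * n) ^ 2 * (2 * real n + 1)) * ((4 * (real n + 1)^2) / ((2 * real n + 1) * (2 * real n + 3)))"
    using Suc a by (simp add: add.commute)
  \<comment> \<open>Expanding by 4 (n+1)^2 = (2n+2)^2 supplies the missing factor of fact
    (2n+2)^2.\<close>
  also have "\<dots> = (2^(2*n) * fact n ^ 2)^2 * (4 * (real n + 1)^2) * (4 * (real n + 1)^2)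
      / ((4 * (real n + 1)^2) * ((fact (2 * n) ^ 2 * (2 * real n + 1)) * ((2 * real n + 1) * (2 * real n + 3))))"
  proof -
    have c: "a / b * (c / d) = a * c * c / (c * (b * d))" if "c \<noteq> 0" for a b c d :: real
      using that by simp
    show ?thesis by (rule c) simp
  qed
  also have "\<dots> = (2^(2*Suc n) * fact (Suc n) ^ 2)^2 / (fact (2 * Suc n) ^ 2 * (2 * real (Suc n) + 1))"
    unfolding f by (simp add: power2_eq_square algebra_simps)
  finally show ?case .
qed simp

text \<open>A decreasing sequence bounded below has a limit L. In four times the term at n minus
  twice the term at 2n the powers cancel up to a bounded factor and Wallis' product appears, so 2 L
  + ln (1/4) = ln (pi/2).\<close>

lemma stirling_rest_tendsto: "stirling_rest \<longlonglongrightarrow> ln (2 * pi) / 2"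
proof -
  have "decseq (\<lambda>n. stirling_rest (Suc n))"
    unfolding decseq_Suc_iff using stirling_rest_Suc(1) by simp
  moreover have "stirling_rest 1 - 1 \<le> stirling_rest (Suc n)" for n
    using stirling_rest_diff(2)[of 1 "Suc n"] by (simp add: algebra_simps) (smt (verit) divide_nonneg_nonneg of_nat_0_le_iff)
  ultimately obtain L where "(\<lambda>n. stirling_rest (Suc n)) \<longlonglongrightarrow> L"
    using decseq_convergent by metis
  then have L: "stirling_rest \<longlonglongrightarrow> L" by (simp only: filterlim_sequentially_Suc)
  have sm: "strict_mono (\<lambda>n::nat. 2 * n)" by (simp add: strict_mono_def)
  have "(\<lambda>n. stirling_rest (2 * n)) \<longlonglongrightarrow> L"
    using LIMSEQ_subseq_LIMSEQ[OF L sm] by (simp add: comp_def)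
  moreover have "(\<lambda>n. ln (real n / (2 * (2 * real n + 1)))) \<longlonglongrightarrow> ln (1 / 4)"
  proof (intro tendsto_ln)
    have "(\<lambda>n. 1 / (4 + 2 * (1 / real n))) \<longlonglongrightarrow> 1 / (4 + 2 * 0)"
      by (intro tendsto_intros lim_1_over_n) auto
    moreover have "\<forall>\<^sub>F n in sequentially. 1 / (4 + 2 * (1 / real n)) = real n / (2 * (2 * real n + 1))"
      using eventually_gt_at_top[of 0] by eventually_elim (simp add: field_simps)
    ultimately show "(\<lambda>n. real n / (2 * (2 * real n + 1))) \<longlonglongrightarrow> 1 / 4"
      by (simp add: filterlim_cong)
  qed simp
  ultimately have "(\<lambda>n. 4 * stirling_rest n - 2 * stirling_rest (2 * n) + ln (real n / (2 * (2 * real n + 1))))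
     \<longlonglongrightarrow> 4 * L - 2 * L + ln (1 / 4)"
    by (intro tendsto_add tendsto_diff tendsto_mult_left L)
  moreover have "\<forall>\<^sub>F n in sequentially. 4 * stirling_rest n - 2 * stirling_rest (2 * n) + ln (real n / (2 * (2 * real n + 1)))
     = ln (\<Prod>k=1..n. (4 * real k^2) / (4 * real k^2 - 1))"
    using eventually_gt_at_top[of 0]
  proof eventually_elim
    case (elim n)
    have "ln ((2^(2*n) * fact n ^ 2)^2 / (fact (2 * n) ^ 2 * (2 * real n + 1)))
      = 2 * (2 * real n * ln 2 + 2 * ln (fact n)) - (2 * ln (fact (2 * n)) + ln (2 * real n + 1))"
      by (simp add: ln_div ln_mult ln_realpow)
    moreover have "ln (real n / (2 * (2 * real n + 1))) = ln (real n) - (ln 2 + ln (2 * real n + 1))"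
    proof -
      have "ln (real n / X) = ln (real n) - ln X" if "0 < X" for X :: real
        using ln_div elim that by simp
      from this[of "2 * (2 * real n + 1)"]
      have "ln (real n / (2 * (2 * real n + 1))) = ln (real n) - ln (2 * (2 * real n + 1))" by this simp
      also have "ln (2 * (2 * real n + 1)) = ln 2 + ln (2 * real n + 1)" by (subst ln_mult) auto
      finally show ?thesis .
    qed
    moreover have "ln (real (2 * n)) = ln 2 + ln (real n)" using elim by (simp add: ln_mult)
    ultimately show ?case unfolding wallis_fact stirling_rest_def
      by (simp add: algebra_simps)
  qed
  ultimately have "(\<lambda>n. ln (\<Prod>k=1..n. (4 * real k^2) / (4 * real k^2 - 1))) \<longlonglongrightarrow> 4 * L - 2 * L + ln (1 / 4)"
    using tendsto_cong by force
  moreover have "(\<lambda>n. ln (\<Prod>k=1..n. (4 * real k^2) / (4 * real k^2 - 1))) \<longlonglongrightarrow> ln (pi / 2)"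
    by (intro tendsto_ln wallis) simp
  ultimately have "4 * L - 2 * L + ln (1 / 4) = ln (pi / 2)" using LIMSEQ_unique by blast
  moreover have "ln (1 / 4 :: real) = - (2 * ln 2)" using ln_realpow[of 2 2] by (simp add: ln_div)
  moreover have "ln (pi / 2) = ln pi - ln 2" "ln (2 * pi) = ln 2 + ln pi" by (auto simp: ln_div ln_mult)
  ultimately have "L = ln (2 * pi) / 2" by simp
  with L show ?thesis by (simp only:)
qed

lemma stirling_rest_bounds:
  assumes "1 \<le> n"
  shows "ln (2 * pi) / 2 \<le> stirling_rest n" and "stirling_rest n \<le> ln (2 * pi) / 2 + 1 / real n"
proof -
  show "ln (2 * pi) / 2 \<le> stirling_rest n"
    by (rule LIMSEQ_le_const2[OF stirling_rest_tendsto])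
      (use stirling_rest_diff(1)[OF assms] in force)
  have "stirling_rest n - 1 / real n \<le> ln (2 * pi) / 2"
  proof (rule LIMSEQ_le_const[OF stirling_rest_tendsto], intro exI allI impI)
    fix m assume "n \<le> m"
    then have "stirling_rest n - stirling_rest m \<le> 1 / real n - 1 / real m"
      using stirling_rest_diff(2)[OF assms] by blast
    moreover have "0 \<le> 1 / real m" by simp
    ultimately show "stirling_rest n - 1 / real n \<le> stirling_rest m" by linarith
  qed
  then show "stirling_rest n \<le> ln (2 * pi) / 2 + 1 / real n" by simp
qed

text \<open>The binomial probability of t for success probability t/k. In Stirling's formula the
  powers cancel and sqrt (k/(2 pi t (k-t))) remains; the errors cost at most a factor e <= 3, and
  1/sqrt (2 pi) is dropped.\<close>

lemma binomial_mode_bound: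
  assumes "1 \<le> t" "t < k"
  shows "real (k choose t) * (real t / real k) ^ t * (real (k - t) / real k) ^ (k - t)
    \<le> 3 * sqrt (real k / (real t * real (k - t)))"
proof -
  define s where "s = k - t"
  have s: "1 \<le> s" "k = t + s" "1 \<le> k" using assms by (auto simp: s_def)
  have pos: "0 < real k" "0 < real t" "0 < real s" using assms s by auto
  have "real (k choose t) = fact k / (fact t * fact s)"
    using binomial_fact[of t k, where 'a = real] assms by (simp add: s_def)
  then have "ln (real (k choose t) * (real t / real k) ^ t * (real s / real k) ^ s)
    = ln (fact k) - ln (fact t) - ln (fact s) + real t * (ln (real t) - ln (real k)) + real s * (ln (real s) - ln (real k))"
    using pos by (simp add: ln_mult ln_div ln_realpow)
  also have "\<dots> = stirling_rest k - stirling_rest t - stirling_rest s + (ln (real k) - ln (real t) - ln (real s)) / 2"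
    using s(2) by (simp add: stirling_rest_def field_simps)
  also have "\<dots> \<le> 1 - ln (2 * pi) / 2 + (ln (real k) - ln (real t) - ln (real s)) / 2"
  proof -
    have "1 / real k \<le> 1" using s by simp
    then show ?thesis
      using stirling_rest_bounds[OF s(3)] stirling_rest_bounds(1)[OF assms(1)] stirling_rest_bounds(1)[OF s(1)]
      by linarith
  qed
  also have "\<dots> \<le> 1 + (ln (real k) - ln (real t) - ln (real s)) / 2"
    using pi_gt3 by simp
  also have "\<dots> = ln (exp 1 * sqrt (real k / (real t * real s)))"
    using pos by (simp add: ln_mult ln_div ln_sqrt)
  finally have "real (k choose t) * (real t / real k) ^ t * (real s / real k) ^ s \<le> exp 1 * sqrt (real k / (real t * real s))"
    using pos assms by (subst (asm) ln_le_cancel_iff) auto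
  also have "\<dots> \<le> 3 * sqrt (real k / (real t * real s))"
    using exp_le by (intro mult_right_mono) auto
  finally show ?thesis by (simp add: s_def)
qed

section \<open>Half-integer powers summed against exponential decay\<close>

lemma sum_inverse_sqrt: "(\<Sum>t=1..m. 1 / sqrt (real t)) \<le> 2 * sqrt (real m)"
proof (induction m)
  case (Suc m)
  define a b where "a = sqrt (real m)" and "b = sqrt (real (Suc m))"
  have ab: "0 \<le> a" "a \<le> b" "0 < b" "b * b = a * a + 1" by (auto simp: a_def b_def)
  have "1 = (b - a) * (b + a)" using ab by (simp add: algebra_simps)
  also have "\<dots> \<le> (b - a) * (2 * b)" using ab by (intro mult_left_mono) auto
  finally have "1 \<le> (2 * b - 2 * a) * b" by (simp add: algebra_simps)
  then have "1 / b \<le> 2 * b - 2 * a" using ab(3) by (simp only: pos_divide_le_eq)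
  then show ?case using Suc by (simp add: a_def b_def)
qed simp

lemma sum_exp_decay:
  assumes "0 < w"
  shows "(\<Sum>t=1..m. exp (- (w * real t))) \<le> 1 / w"
proof -
  define r where "r = exp (- w)"
  have r: "0 < r" "r < 1" using assms by (auto simp: r_def)
  have "(\<Sum>t=1..m. exp (- (w * real t))) * (1 - r) \<le> r"
  proof -
    have "(\<Sum>t=1..m. exp (- (w * real t))) * (1 - r) = r - r ^ Suc m"
    proof (induction m)
      case (Suc m)
      have e: "exp (- (w * real (Suc m))) = r ^ Suc m"
        using exp_of_nat_mult[of "Suc m" "- w"] by (simp add: r_def algebra_simps)
      have "(\<Sum>t=1..Suc m. exp (- (w * real t))) = (\<Sum>t=1..m. exp (- (w * real t))) + r ^ Suc m"
        unfolding e[symmetric] by simp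
      then have "(\<Sum>t=1..Suc m. exp (- (w * real t))) * (1 - r) = (r - r ^ Suc m) + r ^ Suc m * (1 - r)"
        using Suc by (simp only: distrib_right)
      then show ?case by (simp add: algebra_simps)
    qed simp
    then show ?thesis using r by simp
  qed
  moreover have "r \<le> (1 - r) / w"
  proof -
    have "r * (1 + w) \<le> r * exp w" using r exp_ge_add_one_self[of w] by (intro mult_left_mono) auto
    also have "\<dots> = 1" by (simp add: r_def flip: exp_add)
    finally show ?thesis using assms by (simp add: field_simps)
  qed
  ultimately have "(\<Sum>t=1..m. exp (- (w * real t))) * (1 - r) \<le> 1 / w * (1 - r)" by simp
  then show ?thesis using r by (subst (asm) mult_le_cancel_right) auto
qed

text \<open>Up to t = 1/w the exponential is bounded by one; beyond that 1/sqrt t <= sqrt w and the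
  geometric sum is used.\<close>

lemma sum_inverse_sqrt_exp:
  assumes "0 < w"
  shows "(\<Sum>t=1..m. exp (- (w * real t)) / sqrt (real t)) \<le> 3 / sqrt w"
proof -
  define M where "M = nat \<lfloor>1 / w\<rfloor>"
  have M: "real M \<le> 1 / w" using assms by (simp add: M_def)
  have "(\<Sum>t=1..m. exp (- (w * real t)) / sqrt (real t))
    \<le> (\<Sum>t=1..m. (if t \<le> M then 1 / sqrt (real t) else 0) + sqrt w * exp (- (w * real t)))"
  proof (rule sum_mono)
    fix t assume t: "t \<in> {1..m}"
    show "exp (- (w * real t)) / sqrt (real t) \<le> (if t \<le> M then 1 / sqrt (real t) else 0) + sqrt w * exp (- (w * real t))"
    proof (cases "t \<le> M")
      case True
      have "exp (- (w * real t)) / sqrt (real t) \<le> 1 / sqrt (real t)"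
        using assms by (intro divide_right_mono) auto
      moreover have "0 \<le> sqrt w * exp (- (w * real t))" using assms by simp
      ultimately show ?thesis using True by simp
    next
      case False
      then have "1 / w < real t" unfolding M_def using assms by linarith
      then have "1 < w * real t" using assms by (simp add: field_simps)
      then have "1 \<le> sqrt w * sqrt (real t)" by (simp flip: real_sqrt_mult)
      then have "1 / sqrt (real t) \<le> sqrt w" using t by (simp add: divide_le_eq)
      then have "1 / sqrt (real t) * exp (- (w * real t)) \<le> sqrt w * exp (- (w * real t))"
        by (intro mult_right_mono) auto
      then show ?thesis using False by simp
    qed
  qed
  also have "\<dots> = (\<Sum>t\<in>{1..m} \<inter> {..M}. 1 / sqrt (real t)) + sqrt w * (\<Sum>t=1..m. exp (- (w * real t)))"
    by (subst sum.inter_restrict) (simp_all add: sum.distrib sum_distrib_left)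
  also have "(\<Sum>t\<in>{1..m} \<inter> {..M}. 1 / sqrt (real t)) \<le> (\<Sum>t=1..M. 1 / sqrt (real t))"
    by (rule sum_mono2) auto
  also have "\<dots> \<le> 2 * sqrt (1 / w)"
    using sum_inverse_sqrt[of M] M real_sqrt_le_mono[OF M] by linarith
  also have "sqrt w * (\<Sum>t=1..m. exp (- (w * real t))) \<le> sqrt w * (1 / w)"
    using assms by (intro mult_left_mono sum_exp_decay) auto
  also have "sqrt w * (1 / w) = 1 / sqrt w"
    using assms by (simp add: field_simps)
  also have "2 * sqrt (1 / w) = 2 / sqrt w" by (simp add: real_sqrt_divide)
  finally show ?thesis by simp
qed

text \<open>Half of the decay absorbs one factor t, by t exp (-wt/2) <= 2/w, which reduces the sum
  to the preceding one.\<close>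

lemma sum_sqrt_exp:
  assumes "0 < w"
  shows "(\<Sum>t=1..m. sqrt (real t) * exp (- (w * real t))) \<le> 12 / (w * sqrt w)"
proof -
  have "(\<Sum>t=1..m. sqrt (real t) * exp (- (w * real t)))
    \<le> (\<Sum>t=1..m. 2 / w * (exp (- (w / 2 * real t)) / sqrt (real t)))"
  proof (rule sum_mono)
    fix t assume t: "t \<in> {1..m}"
    have "w / 2 * real t \<le> exp (w / 2 * real t)"
      using exp_ge_add_one_self[of "w / 2 * real t"] by linarith
    then have "real t * exp (- (w / 2 * real t)) \<le> 2 / w"
      using assms by (simp add: exp_minus field_simps)
    then have "real t * exp (- (w / 2 * real t)) * (exp (- (w / 2 * real t)) / sqrt (real t))
      \<le> 2 / w * (exp (- (w / 2 * real t)) / sqrt (real t))"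
      by (intro mult_right_mono) auto
    moreover have "real t * exp (- (w / 2 * real t)) * (exp (- (w / 2 * real t)) / sqrt (real t))
      = (real t / sqrt (real t)) * (exp (- (w / 2 * real t)) * exp (- (w / 2 * real t)))"
      by simp
    moreover have "exp (- (w / 2 * real t)) * exp (- (w / 2 * real t)) = exp (- (w * real t))"
      by (simp flip: exp_add)
    moreover have "real t / sqrt (real t) = sqrt (real t)" by (simp add: real_div_sqrt)
    ultimately show "sqrt (real t) * exp (- (w * real t)) \<le> 2 / w * (exp (- (w / 2 * real t)) / sqrt (real t))"
      by metis
  qed
  also have "\<dots> \<le> 2 / w * (3 / sqrt (w / 2))"
    unfolding sum_distrib_left[symmetric]
    using assms by (intro mult_left_mono sum_inverse_sqrt_exp) auto
  also have "\<dots> \<le> 2 / w * (3 / (sqrt w / 2))"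
  proof -
    have "sqrt w / 2 \<le> sqrt (w / 2)"
    proof (rule real_le_rsqrt)
      show "(sqrt w / 2)^2 \<le> w / 2" using assms by (simp add: power_divide)
    qed
    then show ?thesis using assms by (intro mult_left_mono divide_left_mono) auto
  qed
  finally show ?thesis by simp
qed

section \<open>An upper bound for the connection probability\<close>

context conn_seq
begin

lemma ell_kap: "0 < x \<Longrightarrow> ell x = x * (1 / 2 - kap x)"
  by (simp add: ell_def kap_def algebra_simps)

lemma ell_upper: "0 < x \<Longrightarrow> ell x \<le> x / 2"
  using mult_left_mono[of "1 / 2 - kap x" "1 / 2" x] kap_nonneg[of x] by (simp add: ell_kap)

lemma ell_lower:
  assumes "0 < x" "x \<le> 1"
  shows "x / 2 * (1 - x) \<le> ell x"
  using mult_left_mono[of "1 / 2 - x / 2" "1 / 2 - kap x" x] kap_upper[of x] assms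
  by (simp add: ell_kap field_simps)

lemma ell_pos:
  assumes "0 < x" "x < 1"
  shows "0 < ell x"
proof -
  have "0 < x / 2 * (1 - x)" using assms by simp
  also have "\<dots> \<le> ell x" using ell_lower assms by simp
  finally show ?thesis .
qed

text \<open>ell x / x = 1/2 - kap x decreases, because \<open>kap\<close> increases.\<close>

lemma ell_ratio:
  assumes "0 < x" "x \<le> X"
  shows "x / X * ell X \<le> ell x"
proof -
  have "x / X * ell X = x * (1 / 2 - kap X)" using assms by (simp add: ell_kap)
  also have "\<dots> \<le> x * (1 / 2 - kap x)" using kap_mono[of x X] assms by (intro mult_left_mono) auto
  finally show ?thesis using assms by (simp add: ell_kap)
qed

lemma ell_mono:
  assumes "0 < x" "x \<le> X" "X \<le> 1 / 4"
  shows "ell x \<le> ell X"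
proof -
  have "ell X - ell x = (X - x) * (1 / 2 - kap X) - x * (kap X - kap x)"
    using assms by (simp add: ell_kap field_simps)
  moreover have "x * (kap X - kap x) \<le> 1 / 4 * (X - x)"
    using kap_diff[of x X] kap_mono[of x X] assms by (intro mult_mono) auto
  moreover have "(X - x) * (1 / 4) \<le> (X - x) * (1 / 2 - kap X)"
    using kap_upper[of X] assms by (intro mult_left_mono) auto
  ultimately show ?thesis by simp
qed

text \<open>From ln (1 - exp (-x)) = ln x - x/2 + chi x, applied at x + y and x: a logarithm, a
  linear term, and a small correction by an increment of \<open>chi\<close>.\<close>

lemma ln_Phi:
  assumes "1 \<le> s" "0 \<le> y" "x = mu * real s"
  shows "1 \<le> Phi y s"
    and "ln (Phi y s) = real s * (ln (1 + y / x) - y / 2 + (chi (x + y) - chi x))"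
proof -
  have x: "0 < x" using assms mu_pos by simp
  define a b where "a = 1 - exp (- (x + y))" and "b = 1 - exp (- x)"
  have ab: "0 < b" "b \<le> a" using x assms by (auto simp: a_def b_def)
  have P: "Phi y s = (a / b) ^ s" by (simp add: Phi_def a_def b_def assms)
  show "1 \<le> Phi y s" unfolding P using ab by (intro one_le_power) (simp add: field_simps)
  have "ln (1 + y / x) = ln (x + y) - ln x"
  proof -
    have "1 + y / x = (x + y) / x" using x by (simp add: field_simps)
    then show ?thesis using x assms(2) by (simp add: ln_div)
  qed
  moreover have "chi (x + y) = ln a - ln (x + y) + (x + y) / 2" "chi x = ln b - ln x + x / 2"
    using ab x assms by (auto simp: chi_def a_def b_def ln_div)
  ultimately have "ln (1 + y / x) - y / 2 + (chi (x + y) - chi x) = ln a - ln b"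
    by (simp add: field_simps)
  then show "ln (Phi y s) = real s * (ln (1 + y / x) - y / 2 + (chi (x + y) - chi x))"
    unfolding P using ab by (simp add: ln_realpow ln_div)
qed

text \<open>With y = sigma X and xi = s/k the logarithms combine to -k times the difference in
  \<open>perspective_ln_bounds\<close>, and the linear terms give k (1-xi) sigma X/2. The increments
  of \<open>chi\<close> only help in the upper bound; in the lower bound they cost the term with
  X^2.\<close>

lemma ln_Phi_ratio:
  assumes "1 \<le> s" "s \<le> k" "0 \<le> \<sigma>" and X: "X = mu * real k" and \<xi>: "\<xi> = real s / real k"
  shows "ln (Phi (\<sigma> * X) s) - ln (Phi (\<sigma> * X) k)
      \<le> real k * (1 - \<xi>) * (\<sigma> / 2) * (X - \<sigma> / ((\<xi> + \<sigma>) * (1 + \<sigma>)))"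
    and "X + \<sigma> * X \<le> 1 \<Longrightarrow> \<sigma> \<le> 1 \<Longrightarrow>
      - (real k * (1 - \<xi>) * (\<sigma>^2 / (2 * \<xi>^2) - \<sigma> * X / 2 + 2 * \<sigma> * X^2))
        \<le> ln (Phi (\<sigma> * X) s) - ln (Phi (\<sigma> * X) k)"
proof -
  define x y where "x = mu * real s" and "y = \<sigma> * X"
  have k: "1 \<le> k" "0 < real k" using assms by auto
  have pos: "0 < X" "0 < x" "x \<le> X" "0 \<le> y" "0 < \<xi>" "\<xi> \<le> 1"
    using assms mu_pos k by (auto simp: x_def y_def X \<xi>)
  have yx: "y / x = \<sigma> / \<xi>" "y / X = \<sigma>" "real s = real k * \<xi>" "x = \<xi> * X"
    using pos k mu_pos assms by (auto simp: x_def y_def X \<xi>)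
  define \<Delta> where "\<Delta> = (\<lambda>z. chi (z + y) - chi z)"
  have eq: "ln (Phi y s) - ln (Phi y k) = - (real k * (ln (1 + \<sigma>) - \<xi> * ln (1 + \<sigma> / \<xi>)))
     + real k * (1 - \<xi>) * (\<sigma> * X / 2) + (real s * \<Delta> x - real k * \<Delta> X)"
    using ln_Phi(2)[OF assms(1) pos(4) x_def] ln_Phi(2)[OF k(1) pos(4) X]
    unfolding yx(1,2) by (simp add: \<Delta>_def yx(3) y_def field_simps)
  have \<Delta>: "0 \<le> \<Delta> x" "0 \<le> \<Delta> X" "\<Delta> x \<le> \<Delta> X"
    using chi_increment(1) chi_increment_diff(1) pos by (auto simp: \<Delta>_def)
  have "real s * \<Delta> x \<le> real k * \<Delta> X"
    using \<Delta> assms by (intro mult_mono) auto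
  moreover have "real k * (\<sigma>^2 / 2 * (1 - \<xi>) / ((\<xi> + \<sigma>) * (1 + \<sigma>))) \<le> real k * (ln (1 + \<sigma>) - \<xi> * ln (1 + \<sigma> / \<xi>))"
    using perspective_ln_bounds(1)[OF pos(5,6) assms(3)] by (intro mult_left_mono) auto
  moreover have "real k * (1 - \<xi>) * (\<sigma> / 2) * (X - \<sigma> / ((\<xi> + \<sigma>) * (1 + \<sigma>)))
     = real k * (1 - \<xi>) * (\<sigma> * X / 2) - real k * (\<sigma>^2 / 2 * (1 - \<xi>) / ((\<xi> + \<sigma>) * (1 + \<sigma>)))"
  proof -
    have "K * u * (\<sigma> / 2) * (X - \<sigma> / c) = K * u * (\<sigma> * X / 2) - K * (\<sigma>^2 / 2 * u / c)" for K u c :: real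
      by (simp add: right_diff_distrib power2_eq_square mult_ac)
    then show ?thesis .
  qed
  ultimately show "ln (Phi (\<sigma> * X) s) - ln (Phi (\<sigma> * X) k)
      \<le> real k * (1 - \<xi>) * (\<sigma> / 2) * (X - \<sigma> / ((\<xi> + \<sigma>) * (1 + \<sigma>)))"
    using eq unfolding y_def by linarith
  assume le: "X + \<sigma> * X \<le> 1" "\<sigma> \<le> 1"
  have yX: "y \<le> X" using le pos by (simp add: y_def mult_left_le_one_le assms)
  have "real k * (ln (1 + \<sigma>) - \<xi> * ln (1 + \<sigma> / \<xi>)) \<le> real k * ((1 - \<xi>) * \<sigma>^2 / (2 * \<xi>^2))"
    using perspective_ln_bounds(2)[OF pos(5,6) assms(3)] by (intro mult_left_mono) auto
  moreover have "real k * \<Delta> X - real s * \<Delta> x \<le> real k * (1 - \<xi>) * (2 * \<sigma> * X^2)"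
  proof -
    have "\<Delta> X \<le> y * kap (X + y)" using chi_increment(2)[OF pos(1,4)] by (simp add: \<Delta>_def)
    also have "\<dots> \<le> y * ((X + y) / 2)" using kap_upper[of "X + y"] pos le by (intro mult_left_mono) (auto simp: y_def)
    also have "\<dots> \<le> y * X" using yX pos by (intro mult_left_mono) auto
    finally have a: "real k * (1 - \<xi>) * \<Delta> X \<le> real k * (1 - \<xi>) * (y * X)"
      using pos k by (intro mult_left_mono) auto
    have "\<Delta> X - \<Delta> x \<le> y * (X - x)"
      using chi_increment_diff(2)[OF pos(2,3,4)] le by (simp add: \<Delta>_def y_def)
    then have "real s * (\<Delta> X - \<Delta> x) \<le> real k * (y * (X - x))"
      using \<Delta> assms by (intro mult_mono) auto
    then have "real s * (\<Delta> X - \<Delta> x) \<le> real k * (1 - \<xi>) * (y * X)"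
      by (simp add: yx(4) algebra_simps)
    moreover have "real k * \<Delta> X - real s * \<Delta> x = real k * (1 - \<xi>) * \<Delta> X + real s * (\<Delta> X - \<Delta> x)"
      by (simp add: yx(3) algebra_simps)
    ultimately have "real k * \<Delta> X - real s * \<Delta> x \<le> 2 * (real k * (1 - \<xi>) * (y * X))" using a by linarith
    then show ?thesis by (simp add: y_def power2_eq_square mult_ac)
  qed
  moreover have "real k * (1 - \<xi>) * (\<sigma>^2 / (2 * \<xi>^2) - \<sigma> * X / 2 + 2 * \<sigma> * X^2)
    = real k * ((1 - \<xi>) * \<sigma>^2 / (2 * \<xi>^2)) - real k * (1 - \<xi>) * (\<sigma> * X / 2) + real k * (1 - \<xi>) * (2 * \<sigma> * X^2)"
  proof -
    have "K * u * (\<sigma>^2 / A - S / 2 + T) = K * (u * \<sigma>^2 / A) - K * u * (S / 2) + K * u * T" for K u A S T :: real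
      by (simp add: distrib_left right_diff_distrib mult_ac)
    then show ?thesis .
  qed
  ultimately show "- (real k * (1 - \<xi>) * (\<sigma>^2 / (2 * \<xi>^2) - \<sigma> * X / 2 + 2 * \<sigma> * X^2))
        \<le> ln (Phi (\<sigma> * X) s) - ln (Phi (\<sigma> * X) k)"
    using eq unfolding y_def by linarith
qed

text \<open>Bounds for the two quotients on the right of \<open>rho_identity\<close> when y = sigma
  X: together with the factor \<open>ell X\<close> that side is at most 1/k + sigma ell X.\<close>

lemma rhs_terms:
  assumes "1 \<le> k" "X = mu * real k" "0 \<le> \<sigma>"
  shows "0 \<le> mu / (exp X - 1)" "mu / (exp X - 1) \<le> 1 / real k"
    and "0 \<le> (1 - exp (- (\<sigma> * X))) / (exp X - exp (- (\<sigma> * X)))"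
    and "(1 - exp (- (\<sigma> * X))) / (exp X - exp (- (\<sigma> * X))) \<le> \<sigma>"
proof -
  have X: "0 < X" using assms mu_pos by simp
  have eX: "X \<le> exp X - 1" using exp_ge_add_one_self[of X] by linarith
  show "0 \<le> mu / (exp X - 1)" using X mu_pos by simp
  have "mu / (exp X - 1) \<le> mu / X" using eX X mu_pos by (intro divide_left_mono) auto
  also have "mu / X = 1 / real k" using mu_pos assms by simp
  finally show "mu / (exp X - 1) \<le> 1 / real k" .
  have e1: "exp (- (\<sigma> * X)) \<le> 1" using X assms by simp
  have pos: "0 < exp X - exp (- (\<sigma> * X))" using e1 eX X by linarith
  show "0 \<le> (1 - exp (- (\<sigma> * X))) / (exp X - exp (- (\<sigma> * X)))" using pos e1 by simp
  have "1 - exp (- (\<sigma> * X)) \<le> \<sigma> * X" using exp_ge_add_one_self[of "- (\<sigma> * X)"] by linarith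
  also have "\<dots> \<le> \<sigma> * (exp X - exp (- (\<sigma> * X)))" by (rule mult_left_mono) (use e1 eX in linarith, use assms in simp)
  finally show "(1 - exp (- (\<sigma> * X))) / (exp X - exp (- (\<sigma> * X))) \<le> \<sigma>"
    using pos by (simp add: divide_le_eq)
qed

lemma rho_le_1: "1 \<le> k \<Longrightarrow> rho k \<le> 1"
  using member_le_sum[of k "{1..k}" "phi k"] sum_phi[of k] phi_nonneg[of k] by (simp add: phi_self)

text \<open>The choice of $\sigma$ makes both $\sigma^2 k$ and $\sigma / X$ large. The logarithm of the ratio
  below then decreases fast enough, as $s$ moves away from $k$, to absorb $\ln (s/k)$.\<close>

lemma barrier_le:
  assumes "1 \<le> s" "s < k" "1024 \<le> k" and X: "X = mu * real k" "X \<le> 1 / 32"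
    and \<sigma>: "\<sigma> = 16 * (X + 1 / sqrt (real k))"
  shows "Phi (\<sigma> * X) s / Phi (\<sigma> * X) k \<le> real s / real k"
proof -
  define \<xi> where "\<xi> = real s / real k"
  define r where "r = sqrt \<xi>"
  have k0: "0 < real k" using assms by auto
  have X0: "0 < X" using assms mu_pos by auto
  have \<xi>: "0 < \<xi>" "\<xi> < 1" using assms by (auto simp: \<xi>_def)
  have sk: "32 \<le> sqrt (real k)" using assms real_sqrt_le_mono[of 1024 "real k"] by simp
  have \<sigma>0: "0 < \<sigma>" using X0 k0 by (simp add: \<sigma> add_pos_pos)
  have "1 / sqrt (real k) \<le> 1 / 32" using sk by (intro frac_le) auto
  then have "\<sigma> \<le> 16 * (1 / 32 + 1 / 32)" unfolding \<sigma> using X(2) by (intro mult_left_mono add_mono) auto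
  then have \<sigma>1: "\<sigma> \<le> 1" by simp
  have X\<sigma>: "X \<le> \<sigma> / 16" using k0 by (simp add: \<sigma>)
  have \<sigma>k: "16 \<le> \<sigma> * sqrt (real k)"
    using X0 k0 by (simp add: \<sigma> distrib_left distrib_right)
  have r: "0 < r" "r \<le> 1" "r^2 = \<xi>" using \<xi> by (auto simp: r_def)
  \<comment> \<open>Here s >= 1 enters: k xi = s keeps xi away from 0.\<close>
  have rk: "1 \<le> sqrt (real k) * r"
  proof -
    have "sqrt (real k) * r = sqrt (real s)" using k0 by (simp add: r_def \<xi>_def flip: real_sqrt_mult)
    then show ?thesis using assms by simp
  qed
  \<comment> \<open>The aim is (1-xi)/r because -ln xi <= (1-xi)/sqrt xi, which is ln u <= (u -
    1/u)/2 at u = 1/sqrt xi. The two parts of the denominator xi + sigma are treated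
    separately.\<close>
  have "1 / r \<le> (real k * (\<sigma> / 2)) * (\<sigma> / (4 * (\<xi> + \<sigma>)))"
  proof -
    have a: "8 * \<xi> \<le> real k * \<sigma>^2 * r / 2"
    proof -
      have "256 \<le> (\<sigma> * sqrt (real k))^2" using \<sigma>k power_mono[OF \<sigma>k, of 2] by simp
      then have "256 \<le> real k * \<sigma>^2" using k0 by (simp add: power_mult_distrib mult.commute)
      then have "256 * r \<le> real k * \<sigma>^2 * r" using r by (intro mult_right_mono) auto
      moreover have "\<xi> \<le> r" using r power_decreasing[of 1 2 r] by simp
      ultimately show ?thesis using r by linarith
    qed
    have b: "8 * \<sigma> \<le> real k * \<sigma>^2 * r / 2"
    proof -
      have "16 * 1 \<le> (\<sigma> * sqrt (real k)) * (sqrt (real k) * r)"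
        using \<sigma>k rk by (intro mult_mono) auto
      also have "\<dots> = \<sigma> * real k * r" using k0 by simp
      finally have "16 \<le> \<sigma> * real k * r" by simp
      then have "16 * \<sigma> \<le> \<sigma> * real k * r * \<sigma>" using \<sigma>0 by (intro mult_right_mono) auto
      then show ?thesis by (simp add: power2_eq_square mult_ac)
    qed
    have "8 * (\<xi> + \<sigma>) \<le> real k * \<sigma>^2 * r" using a b by simp
    then have "1 / r \<le> real k * \<sigma>^2 / (8 * (\<xi> + \<sigma>))"
      using r \<xi> \<sigma>0 by (simp add: field_simps)
    also have "\<dots> = (real k * (\<sigma> / 2)) * (\<sigma> / (4 * (\<xi> + \<sigma>)))" by (simp add: power2_eq_square)
    finally show ?thesis .
  qed
  \<comment> \<open>As sigma >= 16 X and xi + sigma <= 2, subtracting X loses at most a quarter of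
    sigma/(2 (xi + sigma)).\<close>
  also have "\<dots> \<le> (real k * (\<sigma> / 2)) * (\<sigma> / ((\<xi> + \<sigma>) * (1 + \<sigma>)) - X)"
  proof (intro mult_left_mono)
    have "(\<xi> + \<sigma>) * (1 + \<sigma>) \<le> (\<xi> + \<sigma>) * 2" using \<sigma>0 \<sigma>1 \<xi> by (intro mult_left_mono) auto
    then have "\<sigma> / (2 * (\<xi> + \<sigma>)) \<le> \<sigma> / ((\<xi> + \<sigma>) * (1 + \<sigma>))"
      using \<sigma>0 \<xi> by (intro frac_le) (auto simp: mult.commute)
    moreover have "\<sigma> / 16 \<le> \<sigma> / (8 * (\<xi> + \<sigma>))"
      using \<sigma>0 \<sigma>1 \<xi> by (intro divide_left_mono) auto
    moreover have "\<sigma> / (2 * (\<xi> + \<sigma>)) - \<sigma> / (8 * (\<xi> + \<sigma>)) \<ge> \<sigma> / (4 * (\<xi> + \<sigma>))"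
    proof -
      have g: "S / (4 * b) \<le> S / (2 * b) - S / (8 * b)" if "0 \<le> S / b" for S b :: real
        using that by simp
      show ?thesis by (rule g) (use \<sigma>0 \<xi> in simp)
    qed
    ultimately show "\<sigma> / (4 * (\<xi> + \<sigma>)) \<le> \<sigma> / ((\<xi> + \<sigma>) * (1 + \<sigma>)) - X" using X\<sigma> by linarith
  qed (use \<sigma>0 k0 in auto)
  finally have "(1 - \<xi>) * (1 / r) \<le> (1 - \<xi>) * ((real k * (\<sigma> / 2)) * (\<sigma> / ((\<xi> + \<sigma>) * (1 + \<sigma>)) - X))"
    using \<xi> by (intro mult_left_mono) auto
  moreover have "ln (Phi (\<sigma> * X) s) - ln (Phi (\<sigma> * X) k)
      \<le> real k * (1 - \<xi>) * (\<sigma> / 2) * (X - \<sigma> / ((\<xi> + \<sigma>) * (1 + \<sigma>)))"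
    by (rule ln_Phi_ratio(1)) (use assms \<sigma>0 in \<open>auto simp: \<xi>_def\<close>)
  moreover have "- ln \<xi> \<le> (1 - \<xi>) / r"
  proof -
    have "ln (1 / r) \<le> (1 / r - r) / 2"
    proof -
      have "0 \<le> (1 / r - r) / 2 - ln (1 / r)"
      proof -
        have "- (r - 1 / r) / 2 + ln r \<ge> - (1 - 1 / 1) / 2 + ln 1"
        proof (rule DERIV_nonpos_imp_nonincreasing[of r 1 "\<lambda>r. - (r - 1 / r) / 2 + ln r"])
          fix t assume t: "r \<le> t" "t \<le> 1"
          then have t0: "0 < t" using r by linarith
          have "((\<lambda>r. - (r - 1 / r) / 2 + ln r) has_real_derivative - (1 + 1 / (t * t)) / 2 + 1 / t) (at t)"
            using t0 by (auto intro!: derivative_eq_intros)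
          moreover have "- (1 + 1 / (t * t)) / 2 + 1 / t = - ((1 - 1 / t)^2 / 2)"
            using t0 by (simp add: field_simps power2_eq_square)
          ultimately show "\<exists>y. ((\<lambda>r. - (r - 1 / r) / 2 + ln r) has_real_derivative y) (at t) \<and> y \<le> 0"
            by (metis neg_le_0_iff_le zero_le_power2 divide_nonneg_nonneg zero_le_numeral)
        qed (use r in auto)
        then show ?thesis using r by (simp add: ln_div)
      qed
      then show ?thesis by simp
    qed
    moreover have "ln \<xi> = 2 * ln r" using r ln_realpow[of r 2] by simp
    moreover have "(1 - \<xi>) / r = 1 / r - r" using r(1) unfolding r(3)[symmetric] by (simp add: field_simps power2_eq_square)
    ultimately show ?thesis using r by (simp add: ln_div)
  qed
  moreover have "real k * (1 - \<xi>) * (\<sigma> / 2) * (X - \<sigma> / ((\<xi> + \<sigma>) * (1 + \<sigma>)))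
     = - ((1 - \<xi>) * ((real k * (\<sigma> / 2)) * (\<sigma> / ((\<xi> + \<sigma>) * (1 + \<sigma>)) - X)))"
  proof -
    have "K * u * h * (X - Y) = - (u * ((K * h) * (Y - X)))" for K u h Y :: real
      by (simp add: algebra_simps)
    then show ?thesis .
  qed
  moreover have "(1 - \<xi>) * (1 / r) = (1 - \<xi>) / r" by simp
  ultimately have "ln (Phi (\<sigma> * X) s) - ln (Phi (\<sigma> * X) k) \<le> ln \<xi>" by linarith
  moreover have "1 \<le> Phi (\<sigma> * X) s" "1 \<le> Phi (\<sigma> * X) k"
    using ln_Phi(1) assms \<sigma>0 X0 by auto
  ultimately have "ln (Phi (\<sigma> * X) s / Phi (\<sigma> * X) k) \<le> ln \<xi>" by (simp add: ln_div)
  then show ?thesis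
    using \<xi> \<open>1 \<le> Phi (\<sigma> * X) s\<close> \<open>1 \<le> Phi (\<sigma> * X) k\<close> unfolding \<xi>_def[symmetric]
    by (subst (asm) ln_le_cancel_iff) auto
qed

lemma rho_upper:
  assumes "1 \<le> k" and X: "X = mu * real k" "X \<le> 1 / 32"
  shows "rho k \<le> 1024 * (1 / real k + X^2)"
proof (cases "k < 1024")
  case True
  then have "1 \<le> 1024 * (1 / real k)" using assms by (simp add: field_simps)
  moreover have "0 \<le> X^2" by simp
  ultimately show ?thesis using rho_le_1[OF assms(1)] by (simp only: distrib_left)
next
  case False
  define \<sigma> where "\<sigma> = 16 * (X + 1 / sqrt (real k))"
  have X0: "0 < X" using assms mu_pos by simp
  have \<sigma>0: "0 \<le> \<sigma>" using X0 by (simp add: \<sigma>_def)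
  define B where "B = ell X / Phi (\<sigma> * X) k"
  have P1: "1 \<le> Phi (\<sigma> * X) k" using ln_Phi(1) assms \<sigma>0 X0 by auto
  have eX: "0 < ell X" "ell X \<le> X / 2" using ell_pos ell_upper X0 X by auto
  have B: "0 \<le> B" "B \<le> 1 / 2"
  proof -
    show "0 \<le> B" using eX P1 by (simp add: B_def)
    have "B \<le> ell X / 1" unfolding B_def using eX P1 by (intro divide_left_mono) auto
    then show "B \<le> 1 / 2" using eX X by simp
  qed
  have "0 \<le> (\<Sum>t\<in>{1..<k}. phi k t * (ell (mu * real (k - t)) - B * Phi (\<sigma> * X) (k - t)))"
  proof (intro sum_nonneg mult_nonneg_nonneg)
    fix t assume t: "t \<in> {1..<k}"
    show "0 \<le> phi k t" using phi_nonneg t by simp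
    define s where "s = k - t"
    have s: "1 \<le> s" "s < k" using t by (auto simp: s_def)
    have "B * Phi (\<sigma> * X) s = Phi (\<sigma> * X) s / Phi (\<sigma> * X) k * ell X" by (simp add: B_def)
    also have "\<dots> \<le> real s / real k * ell X"
      using barrier_le[OF s _ X \<sigma>_def] False eX by (intro mult_right_mono) auto
    also have "\<dots> = (mu * real s) / X * ell X" using mu_pos by (simp add: X)
    also have "\<dots> \<le> ell (mu * real s)"
      by (rule ell_ratio) (use s mu_pos in \<open>auto simp: X\<close>)
    finally show "0 \<le> ell (mu * real (k - t)) - B * Phi (\<sigma> * X) (k - t)" by (simp add: s_def)
  qed
  then have "rho k * (1 - B) \<le> mu / (exp X - 1) + ell X * ((1 - exp (- (\<sigma> * X))) / (exp X - exp (- (\<sigma> * X))))"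
    using rho_identity[OF assms(1) _ X(1) B_def] \<sigma>0 X0 by simp
  also have "\<dots> \<le> 1 / real k + X / 2 * \<sigma>"
    using rhs_terms[OF assms(1) X(1) \<sigma>0] eX X0 by (intro add_mono mult_mono) auto
  also have "\<dots> = 1 / real k + 8 * X^2 + 8 * (X * (1 / sqrt (real k)))"
    by (simp add: \<sigma>_def power2_eq_square algebra_simps)
  also have "X * (1 / sqrt (real k)) \<le> (X^2 + (1 / sqrt (real k))^2) / 2"
    using sum_squares_bound[of X "1 / sqrt (real k)"] by (simp add: mult_ac)
  also have "(1 / sqrt (real k))^2 = 1 / real k" by (simp add: power_divide)
  finally have "rho k * (1 - B) \<le> 5 * (1 / real k) + 12 * X^2" by (simp add: add_divide_distrib)
  moreover have "rho k * (1 / 2) \<le> rho k * (1 - B)"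
    using rho_nonneg[OF assms(1)] B by (intro mult_left_mono) auto
  moreover have "0 \<le> 1 / real k" "0 \<le> X^2" by auto
  ultimately have "rho k \<le> 1024 * (1 / real k) + 1024 * X^2" by linarith
  then show ?thesis by (simp only: distrib_left)
qed

end

section \<open>Gaussian decay of the first failure time\<close>

context conn_seq
begin

text \<open>\<^term>\<open>phi k t\<close> is \<^term>\<open>rho t\<close> times the probability that a binomial variable with mean
  about $t + t (k-t) X / (2k)$ takes the value $t$.\<close>

lemma phi_le_gaussian:
  assumes "1 \<le> t" "t < k" and X: "X = mu * real k" "X \<le> 1 / 32"
  shows "phi k t \<le> rho t * (3 * sqrt (real k / (real t * real (k - t)))
    * exp (- (X^2 / 64 * (real t * real (k - t) / real k))))"
proof -
  define s where "s = k - t"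
  have s: "1 \<le> s" "k = t + s" "real k = real t + real s" using assms by (auto simp: s_def)
  have pos: "0 < real k" "0 < real t" "0 < real s" using assms s by auto
  define x where "x = mu * real s"
  define xt where "xt = mu * real t"
  have xp: "0 < x" "0 < xt" "xt + x = X" using pos mu_pos by (auto simp: x_def xt_def X s(3) algebra_simps)
  then have xle: "x \<le> 1 / 32" "0 < X" using X by linarith+
  \<comment> \<open>The probability that a discovery time conditioned to be at most k is at most t;
    it is the success probability of the binomial variable.\<close>
  define \<theta> where "\<theta> = (1 - q ^ t) / (1 - q ^ k)"
  have Dt: "0 < 1 - q ^ t" and Dk: "0 < 1 - q ^ k"
    using one_minus_q_power_pos assms by auto
  have th0: "0 < \<theta>" using Dt Dk by (simp add: \<theta>_def)
  have th1: "1 - \<theta> = (q ^ t - q ^ k) / (1 - q ^ k)" using Dk by (simp add: \<theta>_def field_simps)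
  have qtk: "q ^ k < q ^ t" using assms q_pos q_less_1 by (intro power_strict_decreasing) auto
  then have th2: "0 < 1 - \<theta>" unfolding th1 using Dk by simp
  have phi: "phi k t = rho t * (real ((k - 1) choose (t - 1)) * \<theta> ^ (t - 1) * (1 - \<theta>) ^ s)"
  proof -
    have "(1 - q ^ k) ^ (k - 1) = (1 - q ^ k) ^ (t - 1) * (1 - q ^ k) ^ s"
    proof -
      have "k - 1 = (t - 1) + s" using s(2) assms(1) by simp
      then show ?thesis by (simp only: power_add)
    qed
    then show ?thesis unfolding th1 unfolding phi_def rho_def \<theta>_def s_def[symmetric]
      using Dt by (simp add: power_divide)
  qed
  \<comment> \<open>The relative excess of the mean k theta over t. Its logarithmic form
    \<open>l\<close> is x/2 minus an increment of \<open>chi\<close>, hence between x/4 and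
    x/2.\<close>
  define e where "e = \<theta> * real k / real t - 1"
  define l where "l = x / 2 - (chi (xt + x) - chi xt)"
  have e: "1 + e = exp l"
  proof -
    have ex: "exp (chi z - z / 2) = (1 - exp (- z)) / z" if "0 < z" for z
      using that by (simp add: chi_def)
    have "l = (chi xt - xt / 2) - (chi X - X / 2)" using xp by (simp add: l_def field_simps)
    then have "exp l = ((1 - exp (- xt)) / xt) / ((1 - exp (- X)) / X)"
      using ex[of xt] ex[of X] xp xle by (simp add: exp_diff)
    also have "\<dots> = \<theta> * real k / real t"
      unfolding \<theta>_def q_power using pos mu_pos by (simp add: X xt_def)
    finally show ?thesis by (simp add: e_def)
  qed
  have l: "x / 4 \<le> l" "l \<le> x / 2"
  proof -
    have "chi (xt + x) - chi xt \<le> x * kap (xt + x)" using chi_increment(2)[of xt x] xp by simp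
    also have "\<dots> \<le> x * (X / 2)" using kap_upper[of X] xp xle X by (intro mult_left_mono) auto
    also have "\<dots> \<le> x * (1 / 4)" using X(2) xp(1) by (intro mult_left_mono) auto
    finally show "x / 4 \<le> l" by (simp add: l_def)
    show "l \<le> x / 2" using chi_increment(1)[of xt x] xp by (simp add: l_def)
  qed
  have e4: "x / 4 \<le> e" using l e exp_ge_add_one_self[of l] by linarith
  have e1: "e \<le> 1"
  proof -
    have "exp l \<le> 1 + l + l^2" using l xp xle by (intro exp_bound) auto
    have "l \<le> 1 / 64" using l xle by linarith
    then have "l^2 \<le> (1/64)^2" using l xp by (intro power_mono) auto
    then have "exp l \<le> 2" using \<open>exp l \<le> 1 + l + l^2\<close> \<open>l \<le> 1 / 64\<close> by (simp add: power2_eq_square)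
    then show ?thesis using e by linarith
  qed
  have e0: "0 < e" using e4 xp by linarith
  have \<theta>e: "\<theta> = real t / real k * (1 + e)" using pos by (simp add: e_def)
  have \<theta>e': "1 - \<theta> = real s / real k * (1 - real t * e / real s)"
  proof -
    have "real s / real k * (1 - real t * e / real s) = real s / real k - real t * e / real k"
      using pos by (simp add: right_diff_distrib)
    moreover have "real t / real k + real s / real k = 1" using pos(1) s(3) by (simp flip: add_divide_distrib)
    moreover have "real t / real k * (1 + e) = real t / real k + real t * e / real k"
      by (simp add: distrib_left)
    ultimately show ?thesis unfolding \<theta>e by linarith
  qed
  define v where "v = real t * e / real s"
  have v: "0 < v" "v < 1"
  proof -
    show "0 < v" using pos e0 by (simp add: v_def)
    have "0 < real s / real k * (1 - v)" using th2 \<theta>e' by (simp add: v_def)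
    then have "0 < 1 - v" by (rule zero_less_mult_pos) (use pos in simp)
    then show "v < 1" by simp
  qed
  have A: "(1 + e) ^ (t - 1) \<le> exp (real t * (e - e^2 / 4))"
  proof -
    have "(1 + e) ^ (t - 1) \<le> (1 + e) ^ t" using e0 by (intro power_increasing) auto
    also have "1 + e \<le> exp (e - e^2 / 4)"
    proof -
      have "ln (1 + e) \<le> e - e^2 / 4"
      proof -
        have "0 \<le> e - e^2 / 4 - ln (1 + e)"
        proof (rule nonneg_of_deriv_nonneg[where x = e and h = "\<lambda>e. e - e^2 / 4 - ln (1 + e)" and h' = "\<lambda>t. 1 - t / 2 - inverse (1 + t)"])
          fix t assume t: "0 \<le> t" "t \<le> e"
          have p: "((\<lambda>t. t - t^2 / 4) has_real_derivative 1 - t / 2) (at t)"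
            by (auto intro!: derivative_eq_intros)
          have "((\<lambda>t. ln (1 + t)) has_real_derivative inverse (1 + t)) (at t)"
            using t by (auto intro!: derivative_eq_intros simp: divide_inverse)
          with p show "((\<lambda>e. e - e^2 / 4 - ln (1 + e)) has_real_derivative 1 - t / 2 - inverse (1 + t)) (at t)"
            by (rule DERIV_diff)
          have "t * t \<le> t * 1" using t e1 by (intro mult_left_mono) auto
          then have "1 \<le> (1 - t / 2) * (1 + t)" by (simp add: algebra_simps)
          then have "inverse (1 + t) \<le> 1 - t / 2" using t by (simp add: inverse_eq_divide divide_le_eq)
          then show "0 \<le> 1 - t / 2 - inverse (1 + t)" by simp
        qed (use e0 in auto)
        then show ?thesis by simp
      qed
      then have "exp (ln (1 + e)) \<le> exp (e - e^2 / 4)" by simp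
      then show ?thesis using e0 by simp
    qed
    then have "(1 + e) ^ t \<le> exp (e - e^2 / 4) ^ t" using e0 by (intro power_mono) auto
    also have "exp (e - e^2 / 4) ^ t = exp (real t * (e - e^2 / 4))" by (simp add: exp_of_nat_mult)
    finally show ?thesis .
  qed
  have B: "(1 - v) ^ s \<le> exp (real s * (- v - v^2 / 2))"
  proof -
    have "ln (1 - v) \<le> - v - v^2 / 2"
    proof -
      have "0 \<le> - v - v^2 / 2 - ln (1 - v)"
      proof (rule nonneg_of_deriv_nonneg[where x = v and h = "\<lambda>v. - v - v^2 / 2 - ln (1 - v)" and h' = "\<lambda>t. - 1 - t + inverse (1 - t)"])
        fix t assume t: "0 \<le> t" "t \<le> v"
        then have t1: "0 < 1 - t" using v by linarith
        have p: "((\<lambda>t. - t - t^2 / 2) has_real_derivative - 1 - t) (at t)"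
          by (auto intro!: derivative_eq_intros)
        have "((\<lambda>t. ln (1 - t)) has_real_derivative - inverse (1 - t)) (at t)"
          using t1 by (auto intro!: derivative_eq_intros simp: divide_inverse)
        from DERIV_diff[OF p this] show "((\<lambda>v. - v - v^2 / 2 - ln (1 - v)) has_real_derivative - 1 - t + inverse (1 - t)) (at t)"
          by simp
        have "(1 + t) * (1 - t) \<le> 1" by (simp add: algebra_simps)
        then have "1 + t \<le> inverse (1 - t)" using t1 by (simp add: inverse_eq_divide le_divide_eq)
        then show "0 \<le> - 1 - t + inverse (1 - t)" by simp
      qed (use v in auto)
      then show ?thesis by simp
    qed
    then have "exp (ln (1 - v)) \<le> exp (- v - v^2 / 2)" by simp
    then have "(1 - v) ^ s \<le> exp (- v - v^2 / 2) ^ s" using v by (intro power_mono) auto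
    then show ?thesis by (simp add: exp_of_nat_mult)
  qed
  have AB: "(1 + e) ^ (t - 1) * (1 - v) ^ s \<le> exp (- (X^2 / 64 * (real t * real s / real k)))"
  proof -
    have "(1 + e) ^ (t - 1) * (1 - v) ^ s \<le> exp (real t * (e - e^2 / 4)) * exp (real s * (- v - v^2 / 2))"
      using A B e0 v by (intro mult_mono) auto
    also have "\<dots> = exp (real t * (e - e^2 / 4) + real s * (- v - v^2 / 2))" by (simp add: exp_add)
    \<comment> \<open>Since t e = s v, the first-order terms cancel and a negative multiple of e^2
      is left; this is the Gaussian decay.\<close>
    also have "real t * (e - e^2 / 4) + real s * (- v - v^2 / 2) = - (e^2 * (real t / 4 + real t^2 / (2 * real s)))"
      using pos by (simp add: v_def field_simps power2_eq_square)
    also have "exp (- (e^2 * (real t / 4 + real t^2 / (2 * real s)))) \<le> exp (- (X^2 / 64 * (real t * real s / real k)))"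
    proof -
      have "(x / 4)^2 * (real t / 4 * (real k / real s)) \<le> e^2 * (real t / 4 + real t^2 / (2 * real s))"
      proof (rule mult_mono)
        show "(x / 4)^2 \<le> e^2" using e4 xp by (intro power_mono) auto
        have "real t / 4 * (real k / real s) = real t / 4 + real t^2 / (4 * real s)"
          using pos by (simp add: s(3) field_simps power2_eq_square)
        also have "\<dots> \<le> real t / 4 + real t^2 / (2 * real s)"
          using pos by (intro add_left_mono divide_left_mono) auto
        finally show "real t / 4 * (real k / real s) \<le> real t / 4 + real t^2 / (2 * real s)" .
      qed (use pos in auto)
      moreover have "(x / 4)^2 * (real t / 4 * (real k / real s)) = X^2 / 64 * (real t * real s / real k)"
        using pos mu_pos by (simp add: x_def X field_simps power2_eq_square)
      ultimately show ?thesis by simp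
    qed
    finally show ?thesis .
  qed
  \<comment> \<open>C(k-1,t-1) = (t/k) C(k,t): the extra factor raises the exponent of t/k from t -
    1 to t, so that the bound at the mode applies.\<close>
  have "real ((k - 1) choose (t - 1)) * \<theta> ^ (t - 1) * (1 - \<theta>) ^ s
    = (real (k choose t) * (real t / real k) ^ t * (real s / real k) ^ s) * ((1 + e) ^ (t - 1) * (1 - v) ^ s)"
  proof -
    have "t * (k choose t) = k * ((k - 1) choose (t - 1))"
      using assms times_binomial_minus1_eq by simp
    then have "real t * real (k choose t) = real k * real ((k - 1) choose (t - 1))"
      by (metis of_nat_mult)
    then have c: "real ((k - 1) choose (t - 1)) = real (k choose t) * (real t / real k)"
      using pos by (simp add: field_simps)
    have d: "(real t / real k) ^ t = (real t / real k) * (real t / real k) ^ (t - 1)"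
      using assms by (metis One_nat_def Suc_le_lessD Suc_pred power_Suc)
    show ?thesis unfolding c d \<theta>e'[folded v_def] unfolding \<theta>e power_mult_distrib by simp
  qed
  also have "\<dots> \<le> (3 * sqrt (real k / (real t * real s))) * exp (- (X^2 / 64 * (real t * real s / real k)))"
    by (rule mult_mono[OF binomial_mode_bound[OF assms(1,2), folded s_def] AB]) (use e0 v in auto)
  finally have "real ((k - 1) choose (t - 1)) * \<theta> ^ (t - 1) * (1 - \<theta>) ^ s
    \<le> (3 * sqrt (real k / (real t * real s))) * exp (- (X^2 / 64 * (real t * real s / real k)))" .
  then have "rho t * (real ((k - 1) choose (t - 1)) * \<theta> ^ (t - 1) * (1 - \<theta>) ^ s)
    \<le> rho t * ((3 * sqrt (real k / (real t * real s))) * exp (- (X^2 / 64 * (real t * real s / real k))))"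
    using rho_nonneg assms by (intro mult_left_mono) auto
  then show ?thesis unfolding phi by (simp add: s_def)
qed

text \<open>The factor t comes from the bound on \<open>gap\<close>, which is linear in t to leading
  order. The product t \<open>rho t\<close> is kept bounded by spending half of the Gaussian
  decay.\<close>

lemma phi_early:
  assumes "1 \<le> t" "2 * t \<le> k" and X: "X = mu * real k" "X \<le> 1 / 32" "1 \<le> real k * X^2"
  shows "phi k t * real t \<le> 10^13 * (exp (- (X^2 / 256 * real t)) / sqrt (real t))"
proof -
  define s where "s = k - t"
  define w where "w = X^2 / 256"
  define z where "z = exp (- (w * real t))"
  have k0: "0 < real k" "t < k" using assms by auto
  have t0: "1 \<le> real t" using assms by simp
  have s2: "real k / 2 \<le> real s" using assms by (auto simp: s_def of_nat_diff)
  have X0: "0 < X" using mu_pos k0 by (simp add: X)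
  have w0: "0 < w" using X0 by (simp add: w_def)
  have z: "0 < z" by (simp add: z_def)
  have a: "sqrt (real k / (real t * real s)) \<le> 2 / sqrt (real t)"
  proof -
    have "real k / (real t * real s) \<le> 2^2 / real t"
      using k0 t0 s2 by (simp add: field_simps)
    then have "sqrt (real k / (real t * real s)) \<le> sqrt (2^2 / real t)" by (rule real_sqrt_le_mono)
    then show ?thesis by (simp add: real_sqrt_divide)
  qed
  \<comment> \<open>As s >= k/2, the decay rate in t is at least 2w; one \<open>z\<close> is kept
    for the conclusion and the other is spent on \<open>rho t\<close>.\<close>
  have b: "exp (- (X^2 / 64 * (real t * real s / real k))) \<le> z * z"
  proof -
    have "w * real t * 2 = X^2 / 64 * (real t * (real k / 2) / real k)"
      using k0 by (simp add: w_def)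
    also have "\<dots> \<le> X^2 / 64 * (real t * real s / real k)"
      using k0 s2 by (intro mult_left_mono divide_right_mono) auto
    finally have "exp (- (X^2 / 64 * (real t * real s / real k))) \<le> exp (- (w * real t * 2))" by simp
    also have "\<dots> = z * z" by (simp add: z_def flip: exp_add)
    finally show ?thesis .
  qed
  have c: "rho t * real t * z \<le> 10^12"
  proof -
    define u where "u = w * real t"
    have u0: "0 < u" using w0 t0 by (simp add: u_def)
    have "mu * real t \<le> mu * real k" using k0 mu_pos by (intro mult_left_mono) auto
    then have "rho t \<le> 1024 * (1 / real t + (mu * real t)^2)"
      by (intro rho_upper) (use assms in auto)
    then have "rho t * real t * z \<le> 1024 * (1 / real t + (mu * real t)^2) * real t * z"
      using z by (intro mult_right_mono) auto
    moreover have "1024 * (1 / real t + (mu * real t)^2) * real t * z = 1024 * z + 1024 * (mu^2 * real t^3 * z)"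
      using t0 by (simp add: field_simps power2_eq_square power3_eq_cube)
    moreover have "z \<le> 1" using u0 by (simp add: z_def u_def)
    \<comment> \<open>In terms of u = w t this is u^3 z times 256^3/(k X^2)^2. The exponential
      controls the first factor and k X^2 >= 1 the second.\<close>
    moreover have "mu^2 * real t^3 * z \<le> 6 * 256^3"
    proof -
      have "0 \<le> u^2" by simp
      then have "u^3 / 6 \<le> exp u" using exp_lower_3[of u] u0 by linarith
      then have "u^3 * z \<le> 6" by (simp add: z_def u_def exp_minus field_simps)
      have "mu^2 * real t^3 = u^3 * (mu^2 / w^3)" using w0 by (simp add: u_def power_mult_distrib)
      also have "mu^2 / w^3 = 256^3 / (real k * X^2)^2"
        using k0 mu_pos by (simp add: w_def X power_mult_distrib power_divide field_simps)
      finally have "mu^2 * real t^3 * z = (u^3 * z) * (256^3 / (real k * X^2)^2)" by simp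
      also have "\<dots> \<le> 6 * (256^3 / 1)"
        using \<open>u^3 * z \<le> 6\<close> one_le_power[OF X(3), of 2] k0 X0
        by (intro mult_mono divide_left_mono) auto
      finally show ?thesis by simp
    qed
    ultimately show ?thesis by simp
  qed
  have "phi k t * real t \<le> (rho t * (3 * sqrt (real k / (real t * real s)) * exp (- (X^2 / 64 * (real t * real s / real k))))) * real t"
    using phi_le_gaussian[OF assms(1) k0(2) X(1,2)] t0 by (intro mult_right_mono) (auto simp: s_def)
  also have "\<dots> \<le> (rho t * (3 * (2 / sqrt (real t)) * (z * z))) * real t"
    using a b rho_nonneg[OF assms(1)] t0 z by (intro mult_mono mult_left_mono) auto
  also have "\<dots> = (rho t * real t * z) * (6 * (z / sqrt (real t)))" by simp
  also have "\<dots> \<le> 10^12 * (6 * (z / sqrt (real t)))"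
    using c z by (intro mult_right_mono) auto
  also have "\<dots> \<le> 10^13 * (z / sqrt (real t))"
  proof -
    have g: "10^12 * (6 * a) \<le> 10^13 * a" if "0 \<le> a" for a :: real
      using that by simp
    show ?thesis by (rule g) (use z in simp)
  qed
  finally show ?thesis by (simp add: z_def w_def)
qed

text \<open>For t >= k/2 the bound on \<open>rho t\<close> is of order X^2, since k X^2 >= 1 makes
  1/t at most 2 X^2; the Gaussian decay now acts in s = k - t.\<close>

lemma phi_late:
  assumes "t < k" "k \<le> 2 * t" and X: "X = mu * real k" "X \<le> 1 / 32" "1 \<le> real k * X^2"
  shows "phi k t \<le> 10^5 * X^2 * (exp (- (X^2 / 256 * real (k - t))) / sqrt (real (k - t)))"
proof -
  define s where "s = k - t"
  define z where "z = exp (- (X^2 / 256 * real s))"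
  have k0: "0 < real k" "1 \<le> t" using assms by auto
  have t0: "1 \<le> real t" "real k \<le> 2 * real t" using assms by auto
  have s1: "1 \<le> real s" using assms by (auto simp: s_def)
  have z: "0 < z" by (simp add: z_def)
  have a: "sqrt (real k / (real t * real s)) \<le> 2 / sqrt (real s)"
  proof -
    have "real k / (real t * real s) \<le> 2^2 / real s"
      using k0 t0 s1 by (simp add: field_simps)
    then have "sqrt (real k / (real t * real s)) \<le> sqrt (2^2 / real s)" by (rule real_sqrt_le_mono)
    then show ?thesis by (simp add: real_sqrt_divide)
  qed
  have b: "exp (- (X^2 / 64 * (real t * real s / real k))) \<le> z"
  proof -
    have "X^2 / 256 * real s \<le> X^2 / 64 * (real t * real s / real k)"
    proof -
      have "1 / 4 \<le> real t / real k" using k0 t0 by (simp add: field_simps)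
      then have "X^2 / 64 * real s * (1 / 4) \<le> X^2 / 64 * real s * (real t / real k)" by (intro mult_left_mono) auto
      then show ?thesis by (simp add: mult_ac)
    qed
    then show ?thesis by (simp add: z_def)
  qed
  have c: "rho t \<le> 4096 * X^2"
  proof -
    have m: "mu * real t \<le> X" using assms mu_pos by (auto simp: X)
    have "rho t \<le> 1024 * (1 / real t + (mu * real t)^2)"
      by (rule rho_upper) (use k0 m X in auto)
    moreover have "1 / real t \<le> 2 * X^2"
    proof -
      have "1 / real t \<le> 2 / real k" using t0 k0 by (simp add: field_simps)
      also have "\<dots> \<le> 2 * X^2" using X(3) k0 by (simp add: field_simps)
      finally show ?thesis .
    qed
    moreover have "(mu * real t)^2 \<le> X^2" using m mu_pos by (intro power_mono) auto
    ultimately show ?thesis using zero_le_power2[of X] by (simp only: distrib_left)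
  qed
  have "phi k t \<le> rho t * (3 * sqrt (real k / (real t * real s)) * exp (- (X^2 / 64 * (real t * real s / real k))))"
    using phi_le_gaussian[OF k0(2) assms(1) X(1,2)] by (simp add: s_def)
  also have "\<dots> \<le> (4096 * X^2) * (3 * (2 / sqrt (real s)) * z)"
    using a b c rho_nonneg[OF k0(2)] z by (intro mult_mono mult_left_mono) auto
  also have "\<dots> = 24576 * (X^2 * (z / sqrt (real s)))" by simp
  also have "\<dots> \<le> 10^5 * (X^2 * (z / sqrt (real s)))" using z by (intro mult_right_mono) auto
  finally show ?thesis by (simp add: z_def s_def)
qed

end

section \<open>Asymptotics of the connection probability\<close>

lemma abs_exp_minus_1:
  assumes "(D::real) \<le> 1"
  shows "\<bar>exp D - 1\<bar> \<le> 2 * \<bar>D\<bar>"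
proof (cases "D \<le> 0")
  case True
  then have "\<bar>exp D - 1\<bar> = 1 - exp D" "\<bar>D\<bar> = - D" by auto
  then show ?thesis using exp_ge_add_one_self[of D] True by linarith
next
  case False
  then have "exp D \<le> 1 + D + D^2" using assms by (intro exp_bound) auto
  moreover have "D^2 \<le> D" using False assms by (simp add: power2_eq_square mult_left_le)
  moreover have "1 \<le> exp D" using False by simp
  ultimately show ?thesis using False by simp
qed

context conn_seq
begin

text \<open>With $y = X^2$ the subtracted exponential function is tangent to \<^term>\<open>ell\<close>, up to lower order
  terms, at $s = k$.\<close>

definition gap :: "nat \<Rightarrow> nat \<Rightarrow> real" where
  "gap k s = ell (mu * real s) - ell (mu * real k) / Phi ((mu * real k)^2) k * Phi ((mu * real k)^2) s"

lemma gap_exp: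
  assumes "1 \<le> s" "s \<le> k" "X = mu * real k"
    and D: "D = ln (Phi (X * X) s) - ln (Phi (X * X) k)"
  shows "gap k s = ell (mu * real s) - ell X * exp D"
proof -
  have "1 \<le> Phi (X * X) s" "1 \<le> Phi (X * X) k" using ln_Phi(1) assms by auto
  then have "exp D = Phi (X * X) s / Phi (X * X) k" by (simp add: D exp_diff)
  then show ?thesis by (simp add: gap_def assms(3) power2_eq_square)
qed

text \<open>The case sigma = X of \<open>ln_Phi_ratio\<close>, with 1 - 1/v <= v - 1. The exponent
  can be positive only for t up to about 3 X k and is strongly negative for t of order k.\<close>

lemma exponent_upper:
  assumes "1 \<le> t" "t < k" and X: "X = mu * real k"
    and D: "D = ln (Phi (X * X) (k - t)) - ln (Phi (X * X) k)" "X \<le> 1 / 32"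
  shows "D \<le> real t * (X^2 / 2) * (3 * X - real t / real k)"
proof -
  define \<xi> where "\<xi> = real (k - t) / real k"
  have k0: "0 < real k" using assms by auto
  have X0: "0 < X" using k0 mu_pos by (simp add: X)
  have \<xi>: "1 - \<xi> = real t / real k" "0 < \<xi>" using assms by (auto simp: \<xi>_def of_nat_diff field_simps)
  define v where "v = (\<xi> + X) * (1 + X)"
  have v0: "0 < v" using \<xi> X0 by (simp add: v_def)
  have "D \<le> real k * (1 - \<xi>) * (X / 2) * (X - X / v)"
    unfolding D v_def by (rule ln_Phi_ratio(1)) (use assms X0 in \<open>auto simp: \<xi>_def\<close>)
  also have "\<dots> = real t * (X^2 / 2) * (1 - 1 / v)"
    unfolding \<xi>(1) using k0 by (simp add: power2_eq_square algebra_simps)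
  also have "\<dots> \<le> real t * (X^2 / 2) * (3 * X - real t / real k)"
  proof (rule mult_left_mono)
    have "1 - 1 / v \<le> v - 1"
    proof -
      have "0 \<le> (v - 1)^2 / v" using v0 by simp
      also have "\<dots> = v - 2 + 1 / v" using v0 by (simp add: field_simps power2_eq_square)
      finally show ?thesis by simp
    qed
    moreover have "v - 1 = (\<xi> - 1) + X + \<xi> * X + X * X" by (simp add: v_def algebra_simps)
    moreover have "\<xi> * X \<le> 1 * X"
    proof (rule mult_right_mono)
      have "0 \<le> real t / real k" by simp
      then show "\<xi> \<le> 1" using \<xi>(1) by linarith
    qed (use X0 in simp)
    moreover have "X * X \<le> X * 1" using X0 assms by (intro mult_left_mono) auto
    ultimately show "1 - 1 / v \<le> 3 * X - real t / real k" using \<xi>(1) by linarith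
  qed auto
  finally show ?thesis .
qed

text \<open>\<open>gap k k\<close> is zero. Going from k to k - t changes \<open>ell\<close> by at
  most X t/(2k), and the exponent D by a term X^2 t^2/k and one of order t X^3, which ell X <= X/2
  multiplies.\<close>

lemma gap_early:
  assumes "1 \<le> t" "2 * t \<le> k" and X: "X = mu * real k" "X \<le> 1 / 32" "real k * X^4 \<le> 1 / 2"
  shows "\<bar>gap k (k - t)\<bar> \<le> 4 * (X / real k + X^4) * real t + 4 * (X^3 / real k) * real t * real t"
proof -
  define D where "D = ln (Phi (X * X) (k - t)) - ln (Phi (X * X) k)"
  define \<xi> where "\<xi> = real (k - t) / real k"
  have k0: "0 < real k" "t < k" using assms by auto
  have X0: "0 < X" using k0 mu_pos by (simp add: X)
  have \<xi>: "1 - \<xi> = real t / real k" "1 / 2 \<le> \<xi>" "\<xi> \<le> 1"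
    using assms by (auto simp: \<xi>_def of_nat_diff field_simps)
  have t0: "1 \<le> real t" "real t \<le> real k / 2" using assms by auto
  have up: "D \<le> real t * (X^2 / 2) * (3 * X - real t / real k)"
    by (rule exponent_upper[OF assms(1) k0(2) X(1) D_def X(2)])
  also have "\<dots> \<le> real t * (X^2 / 2) * (3 * X)" using k0 by (intro mult_left_mono) auto
  also have "\<dots> = 3 / 2 * (real t * X^3)" by (simp add: power2_eq_square power3_eq_cube)
  also have "\<dots> \<le> 2 * (real t * X^3)" using X0 by (intro mult_right_mono) auto
  finally have up2: "D \<le> 2 * real t * X^3" by simp
  \<comment> \<open>Needed to linearise exp D. The parabola a (3X - a) in a = t/k has maximum 9
    X^2/4, and k X^4 <= 1/2 does the rest.\<close>
  have "D \<le> 1"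
  proof -
    have "real t * (X^2 / 2) * (3 * X - real t / real k) = (real k * X^2 / 2) * ((real t / real k) * (3 * X - real t / real k))"
      using k0 by simp
    also have "(real t / real k) * (3 * X - real t / real k) \<le> 9 * X^2 / 4"
    proof -
      have g: "a * (3 * X - a) \<le> 9 * X^2 / 4" for a
        using zero_le_power2[of "a - 3 * X / 2"] by (simp add: power2_eq_square field_simps)
      show ?thesis by (rule g)
    qed
    finally have "D \<le> real k * X^2 / 2 * (9 * X^2 / 4)" using up k0 by (simp add: mult_left_mono)
    also have "\<dots> = 9 / 8 * (real k * X^4)" by (simp add: power4_eq_xxxx power2_eq_square)
    finally show ?thesis using X(3) by linarith
  qed
  have low: "- (4 * X^2 * real t * real t / real k + 2 * real t * X^3) \<le> D"
  proof -
    have X1: "X + X * X \<le> 1"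
    proof -
      have "X * X \<le> X * 1" using X0 X by (intro mult_left_mono) auto
      then show ?thesis using X by simp
    qed
    have "- (real k * (1 - \<xi>) * (X^2 / (2 * \<xi>^2) - X * X / 2 + 2 * X * X^2)) \<le> D"
      unfolding D_def by (rule ln_Phi_ratio(2)) (use assms X0 X1 in \<open>auto simp: \<xi>_def\<close>)
    moreover have "real k * (1 - \<xi>) * (X^2 / (2 * \<xi>^2) - X * X / 2 + 2 * X * X^2)
      \<le> 4 * X^2 * real t * real t / real k + 2 * real t * X^3"
    proof -
      have "1 / \<xi>^2 - 1 \<le> 8 * (1 - \<xi>)"
      proof -
        have "1 / 4 \<le> \<xi>^2" using power_mono[OF \<xi>(2), of 2] by (simp add: power_divide)
        have "1 / \<xi>^2 - 1 = (1 - \<xi>) * ((1 + \<xi>) / \<xi>^2)" using \<xi> by (simp add: field_simps power2_eq_square)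
        also have "\<dots> \<le> (1 - \<xi>) * 8"
        proof (rule mult_left_mono)
          have "(1 + \<xi>) / \<xi>^2 \<le> 2 / (1 / 4)" using \<xi>(2,3) \<open>1 / 4 \<le> \<xi>^2\<close> by (intro frac_le) auto
          then show "(1 + \<xi>) / \<xi>^2 \<le> 8" by simp
        qed (use \<xi>(3) in simp)
        finally show ?thesis by simp
      qed
      then have "X^2 / 2 * (1 / \<xi>^2 - 1) \<le> X^2 / 2 * (8 * (real t / real k))" unfolding \<xi>(1) by (intro mult_left_mono) auto
      moreover have "X^2 / (2 * \<xi>^2) - X * X / 2 = X^2 / 2 * (1 / \<xi>^2 - 1)"
        by (simp add: right_diff_distrib power2_eq_square)
      moreover have "2 * X * X^2 = 2 * X^3" "X^2 / 2 * (8 * (real t / real k)) = 4 * X^2 * (real t / real k)"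
        by (simp_all add: power2_eq_square power3_eq_cube)
      ultimately have "X^2 / (2 * \<xi>^2) - X * X / 2 + 2 * X * X^2 \<le> 4 * X^2 * (real t / real k) + 2 * X^3"
        by linarith
      then have "real t * (X^2 / (2 * \<xi>^2) - X * X / 2 + 2 * X * X^2) \<le> real t * (4 * X^2 * (real t / real k) + 2 * X^3)"
        by (intro mult_left_mono) auto
      then show ?thesis unfolding \<xi>(1) using k0 by (simp add: algebra_simps)
    qed
    ultimately show ?thesis by linarith
  qed
  have absD: "\<bar>D\<bar> \<le> 4 * X^2 * real t * real t / real k + 2 * real t * X^3"
  proof -
    have "0 \<le> 4 * X^2 * real t * real t / real k" by simp
    then show ?thesis using up2 low by linarith
  qed
  define x where "x = mu * real (k - t)"
  have x: "0 < x" "x \<le> X" "x / X = \<xi>" using assms mu_pos k0 by (auto simp: x_def X \<xi>_def)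
  have l1: "ell x \<le> ell X" using ell_mono x X by simp
  have l2: "\<xi> * ell X \<le> ell x" using ell_ratio[OF x(1,2)] x(3) by simp
  have lX: "0 \<le> ell X" "ell X \<le> X / 2" using ell_pos[of X] ell_upper[of X] X0 X by auto
  have "gap k (k - t) = ell x - ell X * exp D"
    unfolding x_def by (rule gap_exp) (use assms D_def in auto)
  also have "\<dots> = - (ell X - ell x) - ell X * (exp D - 1)" by (simp add: algebra_simps)
  finally have "\<bar>gap k (k - t)\<bar> \<le> \<bar>ell X - ell x\<bar> + \<bar>ell X * (exp D - 1)\<bar>" by linarith
  also have "\<bar>ell X - ell x\<bar> \<le> (1 - \<xi>) * ell X" using l1 l2 by (simp add: algebra_simps)
  also have "(1 - \<xi>) * ell X \<le> real t / real k * (X / 2)"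
    unfolding \<xi>(1) using lX by (intro mult_left_mono) auto
  also have "\<bar>ell X * (exp D - 1)\<bar> \<le> X / 2 * (2 * (4 * X^2 * real t * real t / real k + 2 * real t * X^3))"
    unfolding abs_mult using lX absD abs_exp_minus_1[OF \<open>D \<le> 1\<close>] X0 by (intro mult_mono) auto
  finally have "\<bar>gap k (k - t)\<bar> \<le> real t / real k * (X / 2) + X / 2 * (2 * (4 * X^2 * real t * real t / real k + 2 * real t * X^3))" by simp
  also have "\<dots> = (1/2 * (X / real k) + 2 * X^4) * real t + 4 * (X^3 / real k) * real t * real t"
    by (simp add: algebra_simps power2_eq_square power3_eq_cube power4_eq_xxxx)
  also have "\<dots> \<le> (4 * (X / real k + X^4)) * real t + 4 * (X^3 / real k) * real t * real t"
  proof -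
    have "0 \<le> X / real k" "0 \<le> X^4" using X0 by auto
    moreover have "1/2 * u + 2 * v \<le> 4 * (u + v)" if "0 \<le> u" "0 \<le> v" for u v :: real
      using that by simp
    ultimately have "1/2 * (X / real k) + 2 * X^4 \<le> 4 * (X / real k + X^4)" by blast
    then show ?thesis by (intro add_right_mono mult_right_mono) auto
  qed
  finally show ?thesis by simp
qed

text \<open>Here D <= -k X^2/10, so the subtracted exponential is negligible and \<open>gap\<close>
  is essentially \<open>ell\<close>, at most half of mu (k - t).\<close>

lemma gap_late:
  assumes "t < k" "k \<le> 2 * t" and X: "X = mu * real k" "X \<le> 1 / 32" "1 \<le> real k * X^2"
  shows "\<bar>gap k (k - t)\<bar> \<le> mu * real (k - t) + 5 / (real k * X)"
proof -
  define D where "D = ln (Phi (X * X) (k - t)) - ln (Phi (X * X) k)"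
  have k0: "0 < real k" "1 \<le> t" using assms by auto
  have X0: "0 < X" using k0 mu_pos by (simp add: X)
  have tk: "1 / 2 \<le> real t / real k" using assms k0 by (simp add: field_simps)
  have "D \<le> real t * (X^2 / 2) * (3 * X - real t / real k)"
    by (rule exponent_upper[OF k0(2) assms(1) X(1) D_def X(2)])
  \<comment> \<open>From t/k >= 1/2 and X <= 1/32, as 3/32 - 1/2 < -2/5.\<close>
  also have "\<dots> \<le> real t * (X^2 / 2) * (- (2 / 5))"
    using tk X by (intro mult_left_mono) auto
  also have "\<dots> = - (real t * (X^2 / 5))" by simp
  also have "\<dots> \<le> - (real k / 2 * (X^2 / 5))"
    using assms by (simp only: neg_le_iff_le, intro mult_right_mono) auto
  finally have D: "D \<le> - (real k * X^2 / 10)" by simp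
  have eD: "exp D \<le> 10 / (real k * X^2)"
  proof -
    define u where "u = real k * X^2 / 10"
    have u: "0 < u" using k0 X0 by (simp add: u_def)
    have "exp D \<le> exp (- u)" using D by (simp add: u_def)
    also have "\<dots> \<le> 1 / u"
    proof -
      have "u \<le> exp u" using exp_ge_add_one_self[of u] by linarith
      then show ?thesis using u by (simp add: exp_minus field_simps)
    qed
    finally show ?thesis by (simp add: u_def)
  qed
  define x where "x = mu * real (k - t)"
  have x: "0 < x" "x < 1"
  proof -
    show "0 < x" using assms mu_pos by (simp add: x_def)
    have "x \<le> X" using mu_pos by (simp add: x_def X)
    then show "x < 1" using X by simp
  qed
  have lx: "0 \<le> ell x" "ell x \<le> x / 2" using ell_pos[of x] ell_upper[of x] x by auto
  have lX: "0 \<le> ell X" "ell X \<le> X / 2" using ell_pos[of X] ell_upper[of X] X0 X by auto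
  have g: "gap k (k - t) = ell x - ell X * exp D"
    unfolding x_def by (rule gap_exp) (use assms D_def in auto)
  have "ell X * exp D \<le> X / 2 * (10 / (real k * X^2))" using lX eD X0 by (intro mult_mono) auto
  also have "\<dots> = 5 / (real k * X)" using X0 k0 by (simp add: field_simps power2_eq_square)
  finally have "ell X * exp D \<le> 5 / (real k * X)" .
  moreover have "0 \<le> ell X * exp D" using lX by simp
  moreover have "0 \<le> 5 / (real k * X)" using X0 by simp
  ultimately have "\<bar>gap k (k - t)\<bar> \<le> x + 5 / (real k * X)"
    unfolding g using lx x by linarith
  then show ?thesis by (simp add: x_def)
qed

text \<open>The decay rate w is of order X^2, so the sums of z/sqrt t and of sqrt t z are of order
  1/X and 1/X^3. Early times then give (X/k + X^4)/X + (X^3/k)/X^3, and late times X^2 (mu/X^3 +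
  1/(k X^2)), where mu/X = 1/k.\<close>

lemma sum_phi_gap:
  assumes "1 \<le> k" and X: "X = mu * real k" "X \<le> 1 / 32" "1 \<le> real k * X^2" "real k * X^4 \<le> 1 / 2"
  shows "\<bar>\<Sum>t\<in>{1..<k}. phi k t * gap k (k - t)\<bar> \<le> 10^19 * (X^3 + 1 / real k)"
proof -
  have k0: "0 < real k" using assms by simp
  have X0: "0 < X" using k0 mu_pos by (simp add: X)
  define w where "w = X^2 / 256"
  have w0: "0 < w" and sw: "sqrt w = X / 16"
    using X0 by (auto simp: w_def real_sqrt_divide)
  define c d where "c = 4 * (X / real k + X^4)" and "d = 4 * (X^3 / real k)"
  have cd: "0 \<le> c" "0 \<le> d" using X0 by (auto simp: c_def d_def)
  define z where "z = (\<lambda>t. exp (- (w * real t)))"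
  have z0: "0 < z t" for t by (simp add: z_def)
  define a where "a = (\<lambda>t. 10^13 * (c * (z t / sqrt (real t)) + d * (sqrt (real t) * z t)))"
  define b where "b = (\<lambda>s. 10^5 * X^2 * (mu * (sqrt (real s) * z s) + 5 / (real k * X) * (z s / sqrt (real s))))"
  have a0: "0 \<le> a t" for t using cd z0[of t] by (simp add: a_def add_nonneg_nonneg)
  have b0: "0 \<le> b t" for t using X0 mu_pos z0[of t] by (simp add: b_def add_nonneg_nonneg)
  have sq: "z t / sqrt (real t) * real t = sqrt (real t) * z t" for t
  proof -
    have "z t / sqrt (real t) * real t = z t * (real t / sqrt (real t))" by simp
    then show ?thesis by (simp only: real_div_sqrt of_nat_0_le_iff mult.commute)
  qed
  have "\<bar>\<Sum>t\<in>{1..<k}. phi k t * gap k (k - t)\<bar> \<le> (\<Sum>t\<in>{1..<k}. \<bar>phi k t * gap k (k - t)\<bar>)"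
    by (rule sum_abs)
  \<comment> \<open>Both majorants are nonnegative, so their sum bounds early and late terms alike
    and the index set need not be split.\<close>
  also have "\<dots> \<le> (\<Sum>t\<in>{1..<k}. a t + b (k - t))"
  proof (rule sum_mono)
    fix t assume t: "t \<in> {1..<k}"
    have p0: "0 \<le> phi k t" using phi_nonneg t by simp
    show "\<bar>phi k t * gap k (k - t)\<bar> \<le> a t + b (k - t)"
    proof (cases "2 * t \<le> k")
      case True
      have "\<bar>phi k t * gap k (k - t)\<bar> \<le> phi k t * (c * real t + d * real t * real t)"
        unfolding abs_mult c_def d_def using gap_early[OF _ True X(1,2,4)] p0 t by (intro mult_mono) auto
      also have "\<dots> = (phi k t * real t) * (c + d * real t)" by (simp add: algebra_simps)
      also have "\<dots> \<le> (10^13 * (z t / sqrt (real t))) * (c + d * real t)"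
        using phi_early[OF _ True X(1,2,3)] t cd by (intro mult_right_mono) (auto simp: z_def w_def)
      also have "\<dots> = 10^13 * (c * (z t / sqrt (real t)) + d * (z t / sqrt (real t) * real t))"
        by (simp only: algebra_simps)
      also have "\<dots> = a t" unfolding sq a_def ..
      finally show ?thesis using b0[of "k - t"] by simp
    next
      case False
      define s where "s = k - t"
      have "\<bar>phi k t * gap k s\<bar> \<le> (10^5 * X^2 * (z s / sqrt (real s))) * (mu * real s + 5 / (real k * X))"
        unfolding abs_mult s_def
        using gap_late[of t k X] phi_late[of t k X] False t X p0 mu_pos X0 z0
        by (intro mult_mono) (auto simp: z_def w_def)
      also have "\<dots> = 10^5 * X^2 * (mu * (z s / sqrt (real s) * real s) + 5 / (real k * X) * (z s / sqrt (real s)))"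
        by (simp only: algebra_simps)
      also have "\<dots> = b s" unfolding sq b_def ..
      finally show ?thesis using a0[of t] by (simp add: s_def)
    qed
  qed
  also have "\<dots> = (\<Sum>t\<in>{1..<k}. a t) + (\<Sum>t\<in>{1..<k}. b (k - t))" by (rule sum.distrib)
  also have "(\<Sum>t\<in>{1..<k}. b (k - t)) = (\<Sum>t\<in>{1..<k}. b t)"
    by (rule sum.reindex_bij_witness[of _ "\<lambda>t. k - t" "\<lambda>t. k - t"]) auto
  also have "(\<Sum>t\<in>{1..<k}. a t) \<le> (\<Sum>t=1..k. a t)" using a0 by (intro sum_mono2) auto
  also have "(\<Sum>t\<in>{1..<k}. b t) \<le> (\<Sum>t=1..k. b t)" using b0 by (intro sum_mono2) auto
  also have "(\<Sum>t=1..k. a t) \<le> 10^18 * 2 * (X^3 + 1 / real k)"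
  proof -
    have "(\<Sum>t=1..k. a t) = 10^13 * (c * (\<Sum>t=1..k. z t / sqrt (real t)) + d * (\<Sum>t=1..k. sqrt (real t) * z t))"
      by (simp add: a_def sum_distrib_left sum.distrib distrib_left)
    also have "\<dots> \<le> 10^13 * (c * (3 / sqrt w) + d * (12 / (w * sqrt w)))"
      using cd sum_inverse_sqrt_exp[OF w0] sum_sqrt_exp[OF w0] unfolding z_def
      by (intro mult_left_mono add_mono) auto
    also have "c * (3 / sqrt w) = 192 * (X^3 + 1 / real k)"
      using X0 k0 by (simp add: sw c_def field_simps power4_eq_xxxx power3_eq_cube)
    also have "d * (12 / (w * sqrt w)) = 196608 * (1 / real k)"
      unfolding sw unfolding w_def d_def using X0 k0 by (simp add: field_simps power2_eq_square power3_eq_cube)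
    also have "10^13 * (192 * (X^3 + 1 / real k) + 196608 * (1 / real k)) \<le> 10^18 * 2 * (X^3 + 1 / real k)"
    proof -
      have g: "10^13 * (192 * (u + v) + 196608 * v) \<le> 10^18 * 2 * (u + v)" if "0 \<le> u" "0 \<le> v" for u v :: real
        using that by simp
      show ?thesis by (rule g) (use X0 in auto)
    qed
    finally show ?thesis .
  qed
  also have "(\<Sum>t=1..k. b t) \<le> 10^10 * (1 / real k)"
  proof -
    have "(\<Sum>t=1..k. b t) = 10^5 * X^2 * (mu * (\<Sum>t=1..k. sqrt (real t) * z t) + 5 / (real k * X) * (\<Sum>t=1..k. z t / sqrt (real t)))"
      by (simp add: b_def sum_distrib_left sum.distrib distrib_left)
    also have "\<dots> \<le> 10^5 * X^2 * (mu * (12 / (w * sqrt w)) + 5 / (real k * X) * (3 / sqrt w))"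
      using mu_pos X0 sum_inverse_sqrt_exp[OF w0] sum_sqrt_exp[OF w0] unfolding z_def
      by (intro mult_left_mono add_mono) auto
    also have "\<dots> = 10^5 * (49152 * (mu / X) + 240 * (1 / real k))"
      unfolding sw unfolding w_def using X0 k0 by (simp add: field_simps power2_eq_square power3_eq_cube)
    also have "mu / X = 1 / real k" using mu_pos k0 by (simp add: X)
    also have "10^5 * (49152 * (1 / real k) + 240 * (1 / real k)) \<le> 10^10 * (1 / real k)"
      using k0 by (simp add: field_simps)
    finally show ?thesis .
  qed
  finally have "\<bar>\<Sum>t\<in>{1..<k}. phi k t * gap k (k - t)\<bar> \<le> 10^18 * 2 * (X^3 + 1 / real k) + 10^10 * (1 / real k)"
    by simp
  also have "\<dots> \<le> 10^19 * (X^3 + 1 / real k)"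
  proof -
    have g: "10^18 * 2 * (u + v) + 10^10 * v \<le> 10^19 * (u + v)" if "0 \<le> u" "0 \<le> v" for u v :: real
      using that by simp
    show ?thesis by (rule g) (use X0 in auto)
  qed
  finally show ?thesis .
qed

text \<open>The main term is ell X times g, where ell X is X/2 and g is X up to relative errors of
  order X. The term rho_k B is of higher order because of \<open>rho_upper\<close>.\<close>

theorem rho_asymptotics:
  assumes "1 \<le> k" and X: "X = mu * real k" "X \<le> 1 / 32" "1 \<le> real k * X^2" "real k * X^4 \<le> 1 / 2"
  shows "\<bar>rho k - X^2 / 2\<bar> \<le> 10^20 * (X^3 + 1 / real k)"
proof -
  have k0: "0 < real k" using assms by simp
  have X0: "0 < X" using k0 mu_pos by (simp add: X)
  define B where "B = ell X / Phi (X^2) k"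
  define S where "S = (\<Sum>t\<in>{1..<k}. phi k t * gap k (k - t))"
  define g where "g = (1 - exp (- (X^2))) / (exp X - exp (- (X^2)))"
  have id: "rho k * (1 - B) + S = mu / (exp X - 1) + ell X * g"
    using rho_identity[OF assms(1) _ X(1) B_def] by (simp add: S_def gap_def g_def B_def X)
  have rt: "0 \<le> mu / (exp X - 1)" "mu / (exp X - 1) \<le> 1 / real k" "0 \<le> g" "g \<le> X"
    using rhs_terms[OF assms(1) X(1), of X] X0 by (auto simp: g_def power2_eq_square)
  have P1: "1 \<le> Phi (X^2) k" using ln_Phi(1) assms by auto
  have lX: "0 < ell X" "ell X \<le> X / 2" "X / 2 * (1 - X) \<le> ell X"
    using ell_pos[of X] ell_upper[of X] ell_lower[of X] X0 X by auto
  have B: "0 \<le> B" "B \<le> X / 2"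
  proof -
    show "0 \<le> B" using lX P1 by (simp add: B_def)
    have "B \<le> ell X / 1" unfolding B_def using lX P1 by (intro divide_left_mono) auto
    then show "B \<le> X / 2" using lX by simp
  qed
  \<comment> \<open>The numerator of g is X^2 up to order X^4, and the denominator is at most X (1 +
    2X).\<close>
  have glow: "X * (1 - 3 * X) \<le> g"
  proof -
    define y where "y = X^2"
    have y: "0 < y" "y \<le> X"
      using X0 X by (auto simp: y_def power2_eq_square mult_left_le)
    have e1: "exp (- y) \<le> 1 - y + y^2 / 2"
    proof -
      have "1 + y + y^2 / 2 \<le> exp y" using exp_lower_Taylor_quadratic[of y] y by simp
      have "1 \<le> (1 - y + y^2 / 2) * (1 + y + y^2 / 2)"
      proof -
        have "(1 - y + y^2 / 2) * (1 + y + y^2 / 2) = 1 + y^2 * y^2 / 4"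
          by (simp add: power2_eq_square field_simps)
        then show ?thesis by simp
      qed
      also have "\<dots> \<le> (1 - y + y^2 / 2) * exp y"
      proof (rule mult_left_mono)
        have "0 \<le> (1 - y)^2 + 1" by (simp add: add_nonneg_nonneg)
        then show "0 \<le> 1 - y + y^2 / 2" by (simp add: power2_eq_square field_simps)
      qed fact
      finally show ?thesis by (simp add: exp_minus field_simps)
    qed
    have e2: "exp X \<le> 1 + X + X^2" using X0 X by (intro exp_bound) auto
    have e3: "1 - y \<le> exp (- y)" using exp_ge_add_one_self[of "- y"] by simp
    have den: "exp X - exp (- y) \<le> X * (1 + 2 * X)"
      using e2 e3 by (simp add: y_def algebra_simps power2_eq_square)
    have "exp (- y) \<le> 1" "1 < exp X" using y X0 by auto
    then have pos: "0 < exp X - exp (- y)" by linarith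
    have "X * (1 - 3 * X) * (exp X - exp (- y)) \<le> X * (1 - 3 * X) * (X * (1 + 2 * X))"
      using den X0 X by (intro mult_left_mono) auto
    also have "\<dots> = y * (1 - X - 6 * y)" by (simp add: y_def power2_eq_square algebra_simps)
    also have "\<dots> \<le> y * (1 - y / 2)" using y by (intro mult_left_mono) auto
    also have "\<dots> \<le> 1 - exp (- y)" using e1 by (simp add: power2_eq_square algebra_simps)
    finally show ?thesis using pos by (simp add: g_def y_def le_divide_eq)
  qed
  have up: "ell X * g \<le> X^2 / 2"
    using mult_mono[OF lX(2) rt(4)] rt lX X0 by (simp add: power2_eq_square)
  have low: "X^2 / 2 - 2 * X^3 \<le> ell X * g"
  proof -
    have "X / 2 * (1 - X) * (X * (1 - 3 * X)) \<le> ell X * g"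
      using lX glow X0 X by (intro mult_mono) auto
    moreover have "X / 2 * (1 - X) * (X * (1 - 3 * X)) = X^2 / 2 - 2 * X^3 + 3 / 2 * X^4"
      by (simp add: power2_eq_square power3_eq_cube power4_eq_xxxx field_simps)
    moreover have "0 \<le> X^4" by simp
    ultimately show ?thesis by linarith
  qed
  have "rho k * B \<le> 1024 * (1 / real k + X^2) * (X / 2)"
    using rho_upper[OF assms(1) X(1,2)] B X0 rho_nonneg[OF assms(1)] by (intro mult_mono) auto
  also have "\<dots> = 512 * (X * (1 / real k)) + 512 * X^3"
    by (simp add: power2_eq_square power3_eq_cube algebra_simps)
  also have "X * (1 / real k) \<le> 1 * (1 / real k)" using X by (intro mult_right_mono) auto
  finally have rB: "rho k * B \<le> 512 * (1 / real k) + 512 * X^3" by simp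
  have rB0: "0 \<le> rho k * B" using B rho_nonneg[OF assms(1)] by simp
  have S: "\<bar>S\<bar> \<le> 10^19 * (X^3 + 1 / real k)"
    unfolding S_def by (rule sum_phi_gap[OF assms])
  have "rho k - X^2 / 2 = rho k * B - S + mu / (exp X - 1) + (ell X * g - X^2 / 2)"
    using id by (simp add: algebra_simps)
  then have "\<bar>rho k - X^2 / 2\<bar> \<le> rho k * B + \<bar>S\<bar> + mu / (exp X - 1) + \<bar>ell X * g - X^2 / 2\<bar>"
    using rB0 rt by linarith
  also have "\<dots> \<le> (512 * (1 / real k) + 512 * X^3) + 10^19 * (X^3 + 1 / real k) + 1 / real k + 2 * X^3"
    using rB S rt(2) up low by (intro add_mono) auto
  also have "\<dots> \<le> 10^20 * (X^3 + 1 / real k)"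
  proof -
    have g: "(512 * v + 512 * u) + 10^19 * (u + v) + v + 2 * u \<le> 10^20 * (u + v)" if "0 \<le> u" "0 \<le> v" for u v :: real
      using that by simp
    show ?thesis by (rule g) (use X0 in auto)
  qed
  finally show ?thesis .
qed

end

section \<open>Expansion of the component size weights\<close>

lemma ln_one_minus_cubic:
  assumes "0 \<le> (v::real)" "v \<le> 1 / 2"
  shows "\<bar>ln (1 - v) + v + v^2 / 2\<bar> \<le> v^3"
proof -
  have d: "((\<lambda>v. ln (1 - v) + v + v^2 / 2) has_real_derivative - inverse (1 - t) + 1 + t) (at t)"
    if "0 \<le> t" "t \<le> v" for t
  proof -
    have "0 < 1 - t" using that assms by linarith
    then have "((\<lambda>t. ln (1 - t)) has_real_derivative - inverse (1 - t)) (at t)"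
      by (auto intro!: derivative_eq_intros simp: divide_inverse)
    moreover have "((\<lambda>t. t^2 / 2) has_real_derivative t) (at t)"
      by (auto intro!: derivative_eq_intros)
    ultimately show ?thesis by (intro DERIV_add DERIV_ident)
  qed
  have i: "1 + t \<le> inverse (1 - t)" "inverse (1 - t) \<le> 1 + t + 3 * t^2" if "0 \<le> t" "t \<le> v" for t
  proof -
    have t1: "0 < 1 - t" "t \<le> 1 / 2" using that assms by linarith+
    have "(1 + t) * (1 - t) \<le> 1" by (simp add: algebra_simps)
    then show "1 + t \<le> inverse (1 - t)" using t1 by (simp add: inverse_eq_divide le_divide_eq)
    have "0 \<le> t^2 * (2 - 3 * t)" using t1 by simp
    then have "1 \<le> (1 + t + 3 * t^2) * (1 - t)" by (simp add: algebra_simps power2_eq_square)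
    then show "inverse (1 - t) \<le> 1 + t + 3 * t^2" using t1 by (simp add: inverse_eq_divide divide_le_eq)
  qed
  have "0 \<le> - (ln (1 - v) + v + v^2 / 2)"
  proof (rule nonneg_of_deriv_nonneg[where x = v and h = "\<lambda>v. - (ln (1 - v) + v + v^2 / 2)" and h' = "\<lambda>t. - (- inverse (1 - t) + 1 + t)"])
    fix t assume t: "0 \<le> t" "t \<le> v"
    show "((\<lambda>v. - (ln (1 - v) + v + v^2 / 2)) has_real_derivative - (- inverse (1 - t) + 1 + t)) (at t)"
      by (rule DERIV_minus[OF d[OF t]])
    show "0 \<le> - (- inverse (1 - t) + 1 + t)" using i(1)[OF t] by linarith
  qed (use assms in auto)
  moreover have "0 \<le> v^3 + (ln (1 - v) + v + v^2 / 2)"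
  proof (rule nonneg_of_deriv_nonneg[where x = v and h = "\<lambda>v. v^3 + (ln (1 - v) + v + v^2 / 2)" and h' = "\<lambda>t. 3 * t^2 + (- inverse (1 - t) + 1 + t)"])
    fix t assume t: "0 \<le> t" "t \<le> v"
    have "((\<lambda>t. t^3) has_real_derivative 3 * t^2) (at t)" by (auto intro!: derivative_eq_intros)
    from DERIV_add[OF this d[OF t]]
    show "((\<lambda>v. v^3 + (ln (1 - v) + v + v^2 / 2)) has_real_derivative 3 * t^2 + (- inverse (1 - t) + 1 + t)) (at t)" .
    show "0 \<le> 3 * t^2 + (- inverse (1 - t) + 1 + t)" using i(2)[OF t] by linarith
  qed (use assms in auto)
  ultimately show ?thesis by linarith
qed

lemma ln_one_plus_cubic:
  assumes "\<bar>e::real\<bar> \<le> 1 / 2"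
  shows "\<bar>ln (1 + e) - e + e^2 / 2\<bar> \<le> \<bar>e\<bar>^3"
proof (cases "e \<le> 0")
  case True
  then show ?thesis using ln_one_minus_cubic[of "- e"] assms by simp
next
  case False
  then have e: "0 \<le> e" by simp
  have d: "((\<lambda>e. ln (1 + e) - e + e^2 / 2) has_real_derivative inverse (1 + t) - 1 + t) (at t)" if "0 \<le> t" for t
  proof -
    have "((\<lambda>t. ln (1 + t)) has_real_derivative inverse (1 + t)) (at t)"
      using that by (auto intro!: derivative_eq_intros simp: divide_inverse)
    moreover have "((\<lambda>t. t^2 / 2) has_real_derivative t) (at t)"
      by (auto intro!: derivative_eq_intros)
    ultimately show ?thesis by (intro DERIV_add DERIV_diff DERIV_ident)
  qed
  have i: "1 - t \<le> inverse (1 + t)" "inverse (1 + t) \<le> 1 - t + 3 * t^2" if "0 \<le> t" for t :: real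
  proof -
    have "(1 - t) * (1 + t) \<le> 1" by (simp add: algebra_simps)
    then show "1 - t \<le> inverse (1 + t)" using that by (simp add: inverse_eq_divide le_divide_eq)
    have "0 \<le> t^2 * (2 + 3 * t)" using that by simp
    then have "1 \<le> (1 - t + 3 * t^2) * (1 + t)" by (simp add: algebra_simps power2_eq_square)
    then show "inverse (1 + t) \<le> 1 - t + 3 * t^2" using that by (simp add: inverse_eq_divide divide_le_eq)
  qed
  have "0 \<le> ln (1 + e) - e + e^2 / 2"
  proof (rule nonneg_of_deriv_nonneg[where x = e and h = "\<lambda>e. ln (1 + e) - e + e^2 / 2" and h' = "\<lambda>t. inverse (1 + t) - 1 + t"])
    show "0 \<le> inverse (1 + t) - 1 + t" if "0 \<le> t" for t :: real using i(1)[OF that] by linarith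
  qed (use e d in auto)
  moreover have "0 \<le> e^3 - (ln (1 + e) - e + e^2 / 2)"
  proof (rule nonneg_of_deriv_nonneg[where x = e and h = "\<lambda>e. e^3 - (ln (1 + e) - e + e^2 / 2)" and h' = "\<lambda>t. 3 * t^2 - (inverse (1 + t) - 1 + t)"])
    fix t assume t: "0 \<le> t" "t \<le> e"
    have "((\<lambda>t. t^3) has_real_derivative 3 * t^2) (at t)" by (auto intro!: derivative_eq_intros)
    from DERIV_diff[OF this d[OF t(1)]]
    show "((\<lambda>e. e^3 - (ln (1 + e) - e + e^2 / 2)) has_real_derivative 3 * t^2 - (inverse (1 + t) - 1 + t)) (at t)" .
    show "0 \<le> 3 * t^2 - (inverse (1 + t) - 1 + t)" using i(2)[OF t(1)] by linarith
  qed (use e in auto)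
  ultimately show ?thesis using e by simp
qed

text \<open>With v = x/2 - x^2/6 + ..., chi x = ln (1 - v) + x/2, and the coefficient of x^2 is 1/6
  - 1/8 = 1/24.\<close>

lemma chi_expansion:
  assumes "0 < x" "x \<le> 1 / 2"
  shows "\<bar>chi x - x^2 / 24\<bar> \<le> x^3"
proof -
  define v where "v = 1 - (1 - exp (- x)) / x"
  have "exp (- x) \<le> 1 - x + x^2 / 2 - x^3 / 6 + x^4 / 24"
  proof -
    have "0 \<le> (1 - x + x^2 / 2 - x^3 / 6 + x^4 / 24) - exp (- x)"
      by (rule nonneg_of_deriv_nonneg[where x = x and h = "\<lambda>x. (1 - x + x^2 / 2 - x^3 / 6 + x^4 / 24) - exp (- x)" and h' = "\<lambda>t. exp (-t) - (1 - t + t^2/2 - t^3/6)"])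
        (use assms exp_minus_lower_3 in \<open>auto intro!: derivative_eq_intros simp: power2_eq_square power3_eq_cube\<close>)
    then show ?thesis by simp
  qed
  then have *: "(x - x^2 / 2 + x^3 / 6 - x^4 / 24) / x \<le> (1 - exp (- x)) / x"
    using assms by (intro divide_right_mono) auto
  have v1: "v \<le> x / 2 - x^2 / 6 + x^3 / 24"
  proof -
    have "(x - x^2 / 2 + x^3 / 6 - x^4 / 24) / x = 1 - x / 2 + x^2 / 6 - x^3 / 24"
      using assms by (simp add: field_simps power2_eq_square power3_eq_cube power4_eq_xxxx)
    with * show ?thesis unfolding v_def by linarith
  qed
  have *: "(1 - exp (- x)) / x \<le> (x - x^2 / 2 + x^3 / 6) / x"
    using exp_minus_lower_3[of x] assms by (intro divide_right_mono) auto
  have v2: "x / 2 - x^2 / 6 \<le> v"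
  proof -
    have "(x - x^2 / 2 + x^3 / 6) / x = 1 - x / 2 + x^2 / 6"
      using assms by (simp add: field_simps power2_eq_square power3_eq_cube)
    with * show ?thesis unfolding v_def by linarith
  qed
  have x2: "x^2 \<le> x / 2" "0 \<le> x^2" using assms by (auto simp: power2_eq_square)
  have x3: "x^3 \<le> x^2 / 2" "0 \<le> x^3" using assms by (auto simp: power2_eq_square power3_eq_cube)
  have v: "0 \<le> v" "v \<le> x / 2" using v1 v2 x2 x3 assms by linarith+
  have c: "\<bar>ln (1 - v) + v + v^2 / 2\<bar> \<le> v^3" using ln_one_minus_cubic v assms by simp
  have "v^3 \<le> (x / 2)^3" using v by (intro power_mono) auto
  then have c3: "v^3 \<le> x^3 / 8" by (simp add: power_divide)
  have "v^2 \<le> (x / 2)^2" using v by (intro power_mono) auto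
  then have q1: "v^2 \<le> x^2 / 4" by (simp add: power_divide)
  have q2: "x^2 / 4 - x^3 / 6 \<le> v^2"
  proof -
    have "0 \<le> x / 2 - x^2 / 6" using x2 assms by linarith
    then have "(x / 2 - x^2 / 6)^2 \<le> v^2" using v2 by (intro power_mono) auto
    moreover have "(x / 2 - x^2 / 6)^2 = x^2 / 4 - x^3 / 6 + (x^2 / 6)^2"
      by (simp add: power2_eq_square power3_eq_cube field_simps)
    ultimately show ?thesis using zero_le_power2[of "x^2 / 6"] by linarith
  qed
  have "chi x = ln (1 - v) + x / 2" using assms by (simp add: chi_def v_def)
  then show ?thesis using c c3 q1 q2 v1 v2 x3 by linarith
qed

lemma ln_binomial:
  assumes "1 \<le> k" "k \<le> n"
  shows "ln (real (n choose k)) = real k * ln (real n) + (\<Sum>i<k. ln (1 - real i / real n)) - ln (fact k)"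
proof -
  have n0: "0 < real n" using assms by simp
  have "real (n choose k) = (\<Prod>i<k. real n - real i) / fact k"
    by (simp add: binomial_gbinomial gbinomial_prod_rev atLeast0LessThan)
  also have "(\<Prod>i<k. real n - real i) = (\<Prod>i<k. real n * (1 - real i / real n))"
    using n0 by (intro prod.cong) (auto simp: field_simps)
  finally have e: "real (n choose k) = real n ^ k * (\<Prod>i<k. 1 - real i / real n) / fact k"
    by (simp add: prod.distrib)
  have pos: "0 < 1 - real i / real n" if "i < k" for i using that assms by simp
  then have "0 < (\<Prod>i<k. 1 - real i / real n)" by (intro prod_pos) auto
  moreover have "ln (\<Prod>i<k. 1 - real i / real n) = (\<Sum>i<k. ln (1 - real i / real n))"
    using assms by (intro ln_prod) auto
  ultimately show ?thesis unfolding e using n0 assms by (simp add: ln_mult ln_div ln_realpow)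
qed

text \<open>Quadratic Taylor expansion of each logarithm. The lower-order parts of the power sums
  cost k/n, the k cubic remainders (k/n)^3 each.\<close>

lemma sum_ln_one_minus:
  assumes "2 * k \<le> n" "1 \<le> k"
  shows "\<bar>(\<Sum>i<k. ln (1 - real i / real n)) + real k^2 / (2 * real n) + real k^3 / (6 * real n^2)\<bar>
    \<le> real k / real n + real k^4 / real n^3"
proof -
  have n0: "0 < real n" using assms by simp
  have kn: "real k / real n \<le> 1 / 2" using assms n0 by (simp add: field_simps)
  have s1: "(\<Sum>i<k. real i / real n) = real k^2 / (2 * real n) - real k / (2 * real n)"
  proof -
    have "(\<Sum>i<m. real i) = (real m^2 - real m) / 2" for m
      by (induction m) (auto simp: power2_eq_square field_simps)
    then show ?thesis by (simp add: sum_divide_distrib[symmetric] diff_divide_distrib)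
  qed
  have s2: "(\<Sum>i<k. (real i / real n)^2 / 2) = real k^3 / (6 * real n^2) - (3 * real k^2 - real k) / (12 * real n^2)"
  proof -
    have "(\<Sum>i<m. real i^2) = real m^3 / 3 - (3 * real m^2 - real m) / 6" for m
      by (induction m) (auto simp: power2_eq_square power3_eq_cube field_simps)
    then have "(\<Sum>i<k. (real i / real n)^2 / 2) = (real k^3 / 3 - (3 * real k^2 - real k) / 6) / (2 * real n^2)"
      by (simp add: power_divide sum_divide_distrib[symmetric])
    also have "\<dots> = real k^3 / (6 * real n^2) - (3 * real k^2 - real k) / (12 * real n^2)"
      by (simp add: diff_divide_distrib)
    finally show ?thesis .
  qed
  have "\<bar>(\<Sum>i<k. ln (1 - real i / real n)) + (\<Sum>i<k. real i / real n) + (\<Sum>i<k. (real i / real n)^2 / 2)\<bar>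
    = \<bar>\<Sum>i<k. ln (1 - real i / real n) + real i / real n + (real i / real n)^2 / 2\<bar>"
    by (simp add: sum.distrib)
  also have "\<dots> \<le> (\<Sum>i<k. \<bar>ln (1 - real i / real n) + real i / real n + (real i / real n)^2 / 2\<bar>)"
    by (rule sum_abs)
  also have "\<dots> \<le> (\<Sum>i<k. (real k / real n)^3)"
  proof (rule sum_mono)
    fix i assume i: "i \<in> {..<k}"
    have le: "real i / real n \<le> real k / real n" using i n0 by (simp add: divide_right_mono)
    have "\<bar>ln (1 - real i / real n) + real i / real n + (real i / real n)^2 / 2\<bar> \<le> (real i / real n)^3"
      by (rule ln_one_minus_cubic[OF _ order_trans[OF le kn]]) simp
    also have "\<dots> \<le> (real k / real n)^3" using le by (intro power_mono) auto
    finally show "\<bar>ln (1 - real i / real n) + real i / real n + (real i / real n)^2 / 2\<bar> \<le> (real k / real n)^3" .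
  qed
  also have "\<dots> = real k^4 / real n^3" by (simp add: power_divide power4_eq_xxxx power3_eq_cube)
  finally have m: "\<bar>(\<Sum>i<k. ln (1 - real i / real n)) + (\<Sum>i<k. real i / real n) + (\<Sum>i<k. (real i / real n)^2 / 2)\<bar>
    \<le> real k^4 / real n^3" .
  have e1: "0 \<le> (3 * real k^2 - real k) / (12 * real n^2)" "(3 * real k^2 - real k) / (12 * real n^2) \<le> real k / (2 * real n)"
  proof -
    have "real k * 1 \<le> real k * real k" using assms by (intro mult_left_mono) auto
    then show "0 \<le> (3 * real k^2 - real k) / (12 * real n^2)"
      by (intro divide_nonneg_nonneg) (auto simp: power2_eq_square)
    have "(3 * real k^2 - real k) / (12 * real n^2) \<le> (6 * real k * real n) / (12 * real n^2)"
    proof (rule divide_right_mono)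
      have "real k * real k \<le> real k * real n" using assms by (intro mult_left_mono) auto
      moreover have "0 \<le> real k * real n" "0 \<le> real k" by auto
      ultimately show "3 * real k^2 - real k \<le> 6 * real k * real n"
        unfolding power2_eq_square mult.assoc by linarith
    qed auto
    also have "\<dots> = real k / (2 * real n)" using n0 by (simp add: power2_eq_square)
    finally show "(3 * real k^2 - real k) / (12 * real n^2) \<le> real k / (2 * real n)" .
  qed
  have "real k / (2 * real n) = (real k / real n) / 2" "0 \<le> real k / real n" by auto
  then show ?thesis using m e1 unfolding s1 s2 by linarith
qed

context conn_seq
begin

text \<open>If k X^2 < 1 then X^2 is below 1/k, and \<open>rho_upper\<close> already has the size of
  the error.\<close>

corollary rho_asymptotics':
  assumes "1 \<le> k" and X: "X = mu * real k" "X \<le> 1 / 32" "real k * X^4 \<le> 1 / 2"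
  shows "\<bar>rho k - X^2 / 2\<bar> \<le> 10^20 * (X^3 + 1 / real k)"
proof (cases "1 \<le> real k * X^2")
  case True
  then show ?thesis using rho_asymptotics assms by blast
next
  case False
  have k0: "0 < real k" using assms by simp
  have X0: "0 < X" using k0 mu_pos by (simp add: X)
  have "X^2 \<le> 1 / real k" using False k0 by (simp add: field_simps)
  moreover have "rho k \<le> 1024 * (1 / real k + X^2)" by (rule rho_upper) (use assms in auto)
  moreover have "0 \<le> rho k" using rho_nonneg assms by simp
  moreover have "0 \<le> X^2" "0 \<le> X^3" "0 \<le> 1 / real k" using X0 by auto
  moreover have g: "\<bar>R - U / 2\<bar> \<le> 10^20 * (W + V)"
    if "U \<le> V" "R \<le> 1024 * (V + U)" "0 \<le> R" "0 \<le> U" "0 \<le> W" "0 \<le> V" for R U V W :: real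
    using that by (simp add: abs_le_iff)
  ultimately show ?thesis by blast
qed

text \<open>This is the weight of size k without its factor \<open>rho k\<close>. Stirling's formula
  is applied to k!; the powers of n and k then cancel, leaving 1/sqrt k and an exact
  exponent.\<close>

lemma ln_weight:
  assumes "1 \<le> k" "k \<le> n" and X: "X = mu * real k" and eps: "eps = mu * real n - 1"
  shows "real ((n - 1) choose (k - 1)) * (1 - q ^ k) ^ (k - 1) * q ^ (k * (n - k))
    = exp (- stirling_rest k + (\<Sum>i<k. ln (1 - real i / real n)) - real k * eps + real k^2 * (1 + eps) / (2 * real n)
        + (real k - 1) * ln (1 + eps) + X / 2 + (real k - 1) * chi X) / sqrt (real k)"
proof -
  have pos: "0 < real k" "0 < real n" "0 < X" using assms mu_pos by auto
  define b where "b = 1 - exp (- X)"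
  have b: "1 - q ^ k = b" "0 < b" using q_power[of k] pos by (auto simp: b_def X)
  have c: "real ((n - 1) choose (k - 1)) = real k / real n * real (n choose k)"
  proof -
    have "k * (n choose k) = n * ((n - 1) choose (k - 1))"
      using assms times_binomial_minus1_eq by simp
    then have "real k * real (n choose k) = real n * real ((n - 1) choose (k - 1))"
      by (metis of_nat_mult)
    then show ?thesis using pos by (simp add: field_simps)
  qed
  have nk: "0 < real (n choose k)" using assms by simp
  define A where "A = real ((n - 1) choose (k - 1)) * b ^ (k - 1) * q ^ (k * (n - k))"
  have A0: "0 < A" unfolding A_def c using pos nk b q_pos by simp
  have "ln A = ln (real k) - ln (real n) + ln (real (n choose k)) + real (k - 1) * ln b + real (k * (n - k)) * ln q"
    unfolding A_def c using pos nk b q_pos by (simp add: ln_mult ln_div ln_realpow)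
  also have "ln (real (n choose k)) = real k * ln (real n) + (\<Sum>i<k. ln (1 - real i / real n)) - ln (fact k)"
    by (rule ln_binomial[OF assms(1,2)])
  also have "ln b = ln X - X / 2 + chi X"
    using b pos by (simp add: chi_def b_def ln_div)
  also have "ln X = ln (1 + eps) - ln (real n) + ln (real k)"
  proof -
    have "X = (1 + eps) / real n * real k" using pos by (simp add: eps X)
    moreover have "0 < 1 + eps" using pos mu_pos by (simp add: eps)
    ultimately show ?thesis using pos by (simp add: ln_mult ln_div)
  qed
  also have "ln q = - mu" by (simp add: mu_def)
  also have "ln (fact k) = stirling_rest k + (real k + 1/2) * ln (real k) - real k"
    by (simp add: stirling_rest_def)
  also have "real (k - 1) = real k - 1" using assms by simp
  also have "real (k * (n - k)) = real k * (real n - real k)" using assms by (simp add: of_nat_diff)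
  finally have "ln A = - stirling_rest k + (\<Sum>i<k. ln (1 - real i / real n)) + real k
      - real k * (mu * real n) + real k * (mu * real k) + (real k - 1) * ln (1 + eps) - (real k - 1) * X / 2 + (real k - 1) * chi X - ln (real k) / 2"
    by (simp add: algebra_simps diff_divide_distrib)
  moreover have "real k * (mu * real k) = real k^2 * (1 + eps) / real n"
    using pos by (simp add: eps power2_eq_square)
  moreover have "real k * (mu * real n) = real k + real k * eps" by (simp add: eps algebra_simps)
  moreover have "(real k - 1) * X / 2 = real k^2 * (1 + eps) / (2 * real n) - X / 2"
    using pos by (simp add: eps X field_simps power2_eq_square)
  moreover have "real k^2 * (1 + eps) / real n = 2 * (real k^2 * (1 + eps) / (2 * real n))" by simp
  moreover have "ln (sqrt (real k)) = ln (real k) / 2" using pos by (simp add: ln_sqrt)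
  ultimately have "ln A = (- stirling_rest k + (\<Sum>i<k. ln (1 - real i / real n)) - real k * eps + real k^2 * (1 + eps) / (2 * real n)
        + (real k - 1) * ln (1 + eps) + X / 2 + (real k - 1) * chi X) - ln (sqrt (real k))"
    by linarith
  then have "exp (ln A) = exp (- stirling_rest k + (\<Sum>i<k. ln (1 - real i / real n)) - real k * eps + real k^2 * (1 + eps) / (2 * real n)
        + (real k - 1) * ln (1 + eps) + X / 2 + (real k - 1) * chi X) / exp (ln (sqrt (real k)))"
    by (simp only: exp_diff)
  then show ?thesis using A0 pos unfolding b(1) A_def by simp
qed

end

section \<open>Local asymptotics in the critical window\<close>

lemma conn_seq_conn_prob:
  assumes "0 < p" "p < 1"
  shows "conn_seq (1 - p) (conn_prob p)"
  by unfold_locales (use assms conn_prob_nonneg conn_prob_identity in auto)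

lemma exp_diff_1_bound: "\<bar>exp T - 1\<bar> \<le> \<bar>T\<bar> * exp \<bar>T::real\<bar>"
proof (cases "0 \<le> T")
  case True
  have "1 - T \<le> exp (- T)" using exp_ge_add_one_self[of "- T"] by simp
  then have "(1 - T) * exp T \<le> exp (- T) * exp T" by (intro mult_right_mono) auto
  then have "exp T - 1 \<le> T * exp T" by (simp add: exp_minus algebra_simps)
  then show ?thesis using True by simp
next
  case False
  have "1 + T \<le> exp T" by (rule exp_ge_add_one_self)
  moreover have "\<bar>T\<bar> * 1 \<le> \<bar>T\<bar> * exp \<bar>T\<bar>" by (intro mult_left_mono) auto
  moreover have "exp T < 1" using False by simp
  ultimately show ?thesis using False by linarith
qed

lemma powr_mult_eq: "a + b = c \<Longrightarrow> (x::real) powr a * x powr b = x powr c"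
  by (simp only: powr_add[symmetric])

lemma powr_div_eq: "a - b = c \<Longrightarrow> (x::real) powr a / x powr b = x powr c"
  by (simp only: powr_diff[symmetric])

lemma powr_pow_eq: "0 < x \<Longrightarrow> real m * a = c \<Longrightarrow> ((x::real) powr a) ^ m = x powr c"
  by (simp only: powr_power)

text \<open>Since 2^24 = 64^4, the quantity n^(1/4), named \<open>r\<close> below, is at least
  64.\<close>

locale near_critical =
  fixes n :: nat and lam :: real
  assumes n_large: "2^24 \<le> n" and lam_bound: "\<bar>lam\<bar> \<le> real n powr (1/12)"
begin

definition r :: real where "r = real n powr (1/4)"

definition p :: real where "p = p_crit n lam"

definition e0 :: real where "e0 = lam * real n powr (-1/3)"

lemma n_pos: "0 < real n" "1 \<le> real n"
  using n_large by (auto simp: Suc_le_eq)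

lemma r_ge: "64 \<le> r"
proof -
  have "(64::real) = (64^4) powr (1/4)" by (simp add: powr_power[symmetric] powr_powr flip: powr_numeral)
  also have "\<dots> \<le> r" unfolding r_def using n_large by (intro powr_mono2) auto
  finally show ?thesis .
qed

lemma r_pow: "r^4 = real n"
  unfolding r_def using n_pos by (simp add: powr_power)

lemma inv_n_le: "4 / real n \<le> 1 / r"
proof -
  have "r * 4 \<le> r * r^3" using r_ge power_mono[OF r_ge, of 3] by (intro mult_left_mono) auto
  then have "4 * r \<le> real n" unfolding r_pow[symmetric] by (simp add: power4_eq_xxxx power3_eq_cube mult_ac)
  then show ?thesis using r_ge n_pos by (simp add: field_simps)
qed

lemma inv_r_le: "1 / r \<le> 1 / real n powr (1/10)"
  unfolding r_def using n_pos by (intro divide_left_mono powr_mono) auto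

lemma e0_bound: "\<bar>e0\<bar> \<le> 1 / r"
proof -
  have "\<bar>e0\<bar> \<le> real n powr (1/12) * real n powr (-1/3)"
    unfolding e0_def abs_mult using lam_bound by (intro mult_mono) auto
  also have "\<dots> = real n powr (- (1/4))" by (rule powr_mult_eq) simp
  also have "\<dots> = 1 / r" by (simp only: r_def powr_minus_divide)
  finally show ?thesis .
qed

lemma p_eq: "real n * p = 1 + e0"
proof -
  have "real n * (lam * real n powr (-4/3)) = lam * (real n powr 1 * real n powr (-4/3))"
    using n_pos by simp
  also have "real n powr 1 * real n powr (-4/3) = real n powr (-1/3)" by (rule powr_mult_eq) simp
  finally show ?thesis using n_pos by (simp add: p_def p_crit_def distrib_left e0_def)
qed

lemma inv_r_small: "1 / r \<le> 1 / 64"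
  using r_ge by (simp add: field_simps)

lemma p_bounds: "0 < p" "p < 1" "p \<le> 2 / real n" "p \<le> 1 / 2"
proof -
  have e: "- (1/64) \<le> e0" "e0 \<le> 1/64" using e0_bound inv_r_small by linarith+
  have "p = (1 + e0) / real n" using p_eq n_pos by (simp add: field_simps)
  then show a: "0 < p" "p \<le> 2 / real n" using e n_pos by (auto intro!: divide_right_mono)
  have "4 / real n \<le> 1 / 64" using inv_n_le inv_r_small by linarith
  then show "p \<le> 1 / 2" using a by linarith
  then show "p < 1" by linarith
qed

sublocale cs: conn_seq "1 - p" "conn_prob p"
  by (rule conn_seq_conn_prob[OF p_bounds(1,2)])

text \<open>\<open>e0\<close> and \<open>eps\<close> are the relative excesses over one of n p and n
  mu. The exact formulas involve \<open>mu\<close>, the limit function involves \<open>e0\<close>;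
  as mu <= p + p^2 and p <= 2/n, they differ by at most 4/n.\<close>

definition eps :: real where "eps = cs.mu * real n - 1"

lemma eps_bounds: "e0 \<le> eps" "eps \<le> e0 + 4 / real n" "\<bar>eps\<bar> \<le> 2 / r" "\<bar>eps\<bar> \<le> 1 / 32"
proof -
  have c: "\<bar>ln (1 - p) + p + p^2 / 2\<bar> \<le> p^3"
    using ln_one_minus_cubic p_bounds by simp
  have "p^3 = p * p^2" by (simp add: power3_eq_cube power2_eq_square)
  also have "\<dots> \<le> 1 / 2 * p^2" using p_bounds by (intro mult_right_mono) auto
  finally have m: "p \<le> cs.mu" "cs.mu \<le> p + p^2" using c by (auto simp: cs.mu_def)
  have "real n * p \<le> real n * cs.mu" using m n_pos by (intro mult_left_mono) auto
  then show a: "e0 \<le> eps" using p_eq by (simp add: eps_def mult.commute)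
  have "real n * cs.mu \<le> real n * (p + p^2)" using m n_pos by (intro mult_left_mono) auto
  also have "\<dots> = 1 + e0 + real n * p^2" using p_eq by (simp add: distrib_left)
  also have "real n * p^2 \<le> real n * (2 / real n)^2" using p_bounds by (intro mult_left_mono power_mono) auto
  also have "\<dots> = 4 / real n" using n_pos by (simp add: power2_eq_square)
  finally show b: "eps \<le> e0 + 4 / real n" by (simp add: eps_def mult.commute)
  show d: "\<bar>eps\<bar> \<le> 2 / r" using a b e0_bound inv_n_le by (simp add: abs_le_iff)
  show "\<bar>eps\<bar> \<le> 1 / 32" using d inv_r_small by linarith
qed

end

locale near_critical_size = near_critical +
  fixes k :: nat
  assumes k_lower: "real n powr (2/3) \<le> real k" and k_upper: "real k \<le> real n powr (3/4)"
begin

definition X :: real where "X = cs.mu * real k"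

lemma k_pos: "0 < real k" "1 \<le> k"
proof -
  have "0 < real n powr (2/3)" using n_pos by simp
  then show "0 < real k" using k_lower by linarith
  then show "1 \<le> k" by simp
qed

lemma k_over_n: "real k / real n \<le> 1 / r"
proof -
  have "real k / real n \<le> real n powr (3/4) / real n powr 1" using k_upper n_pos by (simp add: divide_right_mono)
  also have "\<dots> = real n powr (- (1/4))" by (rule powr_div_eq) simp
  also have "\<dots> = 1 / r" by (simp only: r_def powr_minus_divide)
  finally show ?thesis .
qed

lemma inv_k: "1 / real k \<le> 1 / r"
proof -
  have "r \<le> real n powr (2/3)" unfolding r_def using n_pos by (intro powr_mono) auto
  then show ?thesis using k_lower r_ge by (intro divide_left_mono) auto
qed

lemma two_k_le: "2 * k \<le> n"
proof -
  have "real k / real n \<le> 1 / 2" using k_over_n inv_r_small by linarith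
  then have "2 * real k \<le> real n" using n_pos by (simp add: field_simps)
  then show ?thesis by linarith
qed

lemma X_eq: "X = (1 + eps) * (real k / real n)"
  using n_pos by (simp add: X_def eps_def)

lemma X_bounds: "0 < X" "X \<le> 2 * (real k / real n)" "X \<le> 1 / 32"
proof -
  have e: "0 < 1 + eps" "1 + eps \<le> 2" using eps_bounds(4) by linarith+
  show "0 < X" unfolding X_eq using e k_pos n_pos by simp
  show a: "X \<le> 2 * (real k / real n)" unfolding X_eq using e by (intro mult_right_mono) auto
  show "X \<le> 1 / 32" using a k_over_n inv_r_small by linarith
qed

lemma k4_le: "real k^4 / real n^3 \<le> 1"
proof -
  have "real k^4 \<le> (real n powr (3/4))^4" using k_upper by (intro power_mono) auto
  also have "\<dots> = real n^3" using n_pos by (simp add: powr_power powr_numeral)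
  finally show ?thesis using n_pos by simp
qed

lemma kX3: "real k * X^3 \<le> 8 * (real k^4 / real n^3)"
proof -
  have "X^3 \<le> (2 * (real k / real n))^3" using X_bounds by (intro power_mono) auto
  then have "real k * X^3 \<le> real k * (2 * (real k / real n))^3" by (intro mult_left_mono) auto
  also have "\<dots> = 8 * (real k^4 / real n^3)" by (simp add: power3_eq_cube power4_eq_xxxx)
  finally show ?thesis .
qed

lemma kX4: "real k * X^4 \<le> 1 / 2"
proof -
  have "real k * X^4 = real k * X^3 * X" by (simp add: power3_eq_cube power4_eq_xxxx)
  also have "\<dots> \<le> 8 * X" using kX3 k4_le X_bounds by (intro mult_right_mono) auto
  also have "\<dots> \<le> 16 * (1 / r)" using X_bounds k_over_n by linarith
  also have "\<dots> \<le> 1 / 2" using inv_r_small by linarith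
  finally show ?thesis .
qed

text \<open>A catalogue of the errors met below. The summand |lam|/n^(1/12) of \<open>E1\<close>
  covers k^3 |e0|/n^2 for k <= n^(3/4), and n^2/k^3 is the cube of the summand n^(2/3)/k, which is
  at most one.\<close>

lemma E1_terms:
  shows "real k^4 / real n^3 \<le> E1 k n lam" "real k * \<bar>e0\<bar>^3 \<le> E1 k n lam"
    "real k^3 / real n^2 * \<bar>e0\<bar> \<le> E1 k n lam" "real n^2 / real k^3 \<le> E1 k n lam" "1 / r \<le> E1 k n lam"
    "E1 k n lam \<le> 5" "0 \<le> E1 k n lam"
proof -
  define K L3 Lm I H where "K = real k^4 / real n^3" and "L3 = \<bar>lam\<bar>^3 * real k / real n"
    and "Lm = \<bar>lam\<bar> / real n powr (1/12)" and "I = real n powr (2/3) / real k" and "H = 1 / real n powr (1/10)"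
  have E: "E1 k n lam = K + Lm + L3 + I + H" by (simp add: E1_def K_def L3_def Lm_def I_def H_def)
  have nn: "0 \<le> K" "0 \<le> L3" "0 \<le> Lm" "0 \<le> I" "0 \<le> H"
    using n_pos k_pos by (auto simp: K_def L3_def Lm_def I_def H_def)
  have le: "K \<le> 1" "L3 \<le> 1" "Lm \<le> 1" "I \<le> 1" "H \<le> 1"
  proof -
    show "K \<le> 1" using k4_le by (simp add: K_def)
    have "\<bar>lam\<bar>^3 * real k \<le> (real n powr (1/12))^3 * real n powr (3/4)"
      using lam_bound k_upper by (intro mult_mono power_mono) auto
    also have "\<dots> = real n" using n_pos by (simp add: powr_power flip: powr_add)
    finally show "L3 \<le> 1" using n_pos by (simp add: L3_def)
    show "Lm \<le> 1" using lam_bound n_pos by (simp add: Lm_def)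
    show "I \<le> 1" using k_lower k_pos by (simp add: I_def)
    show "H \<le> 1" using n_pos by (simp add: H_def ge_one_powr_ge_zero)
  qed
  show "real k^4 / real n^3 \<le> E1 k n lam" "E1 k n lam \<le> 5" "0 \<le> E1 k n lam"
    unfolding E using nn le by (auto simp: K_def[symmetric])
  have "real k * \<bar>e0\<bar>^3 = L3"
  proof -
    have "(real n powr (-1/3))^3 = real n powr (- 1)" by (rule powr_pow_eq) (use n_pos in auto)
    also have "\<dots> = 1 / real n" using n_pos by (simp only: powr_minus_divide) simp
    finally show ?thesis by (simp add: e0_def abs_mult power_mult_distrib L3_def)
  qed
  then show "real k * \<bar>e0\<bar>^3 \<le> E1 k n lam" unfolding E using nn by simp
  have "real k^3 / real n^2 * \<bar>e0\<bar> \<le> Lm"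
  proof -
    have "real k^3 / real n^2 \<le> (real n powr (3/4))^3 / real n^2"
      using k_upper by (intro divide_right_mono power_mono) auto
    also have "\<dots> = real n powr (9/4) / real n powr 2" using n_pos by (simp add: powr_power)
    also have "\<dots> = real n powr (1/4)" by (rule powr_div_eq) simp
    finally have "real k^3 / real n^2 * \<bar>e0\<bar> \<le> real n powr (1/4) * \<bar>e0\<bar>" by (intro mult_right_mono) auto
    also have "\<dots> = \<bar>lam\<bar> * (real n powr (1/4) * real n powr (-1/3))" by (simp add: e0_def abs_mult)
    also have "real n powr (1/4) * real n powr (-1/3) = real n powr (- (1/12))" by (rule powr_mult_eq) simp
    also have "\<bar>lam\<bar> * real n powr (- (1/12)) = Lm" unfolding Lm_def powr_minus_divide by simp
    finally show ?thesis .
  qed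
  then show "real k^3 / real n^2 * \<bar>e0\<bar> \<le> E1 k n lam" unfolding E using nn by simp
  have "real n^2 / real k^3 = I^3"
    using n_pos by (simp add: I_def power_divide powr_power)
  also have "\<dots> \<le> I" using nn le power_decreasing[of 1 3 I] by simp
  finally show "real n^2 / real k^3 \<le> E1 k n lam" unfolding E using nn by simp
  have "1 / r \<le> H" using inv_r_le by (simp add: H_def)
  then show "1 / r \<le> E1 k n lam" unfolding E using nn by simp
qed

text \<open>Written in \<open>e0\<close>, so that each of the three monomials can be matched with a
  term of the exponent in \<open>ln_weight\<close>.\<close>

lemma G_eq: "G_fun lam (real k / real n powr (2/3)) = real k^3 / (8 * real n^2) - e0 * real k^2 / (2 * real n) + e0^2 * real k / 2"
proof -
  define a where "a = real k / real n powr (2/3)"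
  have "a^3 = real k^3 / real n^2"
    using n_pos by (simp add: a_def power_divide powr_power)
  moreover have "lam * a^2 = e0 * real k^2 / real n"
  proof -
    have "(real n powr (2/3))^2 = real n powr (4/3)" by (rule powr_pow_eq) (use n_pos in auto)
    then have "1 / (real n powr (2/3))^2 = real n powr (- (4/3))" by (simp only: powr_minus_divide)
    also have "\<dots> = real n powr (-1/3) / real n powr 1" by (rule powr_div_eq[symmetric]) simp
    finally show ?thesis using n_pos by (simp add: a_def e0_def power_divide) (simp add: field_simps)
  qed
  moreover have "lam^2 * a = e0^2 * real k"
  proof -
    have "(real n powr (-1/3))^2 = real n powr (- (2/3))" by (rule powr_pow_eq) (use n_pos in auto)
    then have eq: "(real n powr (-1/3))^2 = 1 / real n powr (2/3)" by (simp only: powr_minus_divide)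
    show ?thesis unfolding a_def e0_def power_mult_distrib eq by simp
  qed
  moreover have "G_fun lam a = a^3 / 8 - (lam * a^2) / 2 + (lam^2 * a) / 2"
    by (simp add: G_fun_def power2_eq_square power3_eq_cube field_simps)
  ultimately show ?thesis by (simp add: a_def[symmetric])
qed

text \<open>\<^term>\<open>T\<close> collects everything in the exponent of the exact weight that should be negligible.\<close>

definition T :: real where
  "T = ln (2 * pi) / 2 - stirling_rest k + (\<Sum>i<k. ln (1 - real i / real n)) - real k * eps
    + real k^2 * (1 + eps) / (2 * real n) + (real k - 1) * ln (1 + eps) + X / 2 + (real k - 1) * chi X
    + G_fun lam (real k / real n powr (2/3))"

text \<open>The three terms of G cancel. For k^3/n^2 the coefficients are -1/6 from the falling
  factorial, 1/24 from \<open>chi\<close> and 1/8 from G; e0 k^2/(2n) meets eps k^2/(2n); and k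
  e0^2/2 meets the quadratic term of ln (1 + eps). The two copies of k^2/(2n) also cancel.\<close>

lemma T_bound: "\<bar>T\<bar> \<le> 40 * E1 k n lam"
proof -
  define E where "E = E1 k n lam"
  note Et = E1_terms[folded E_def]
  define eta where "eta = eps - e0"
  have eta: "0 \<le> eta" "eta \<le> 4 / real n" using eps_bounds by (auto simp: eta_def)
  define kn where "kn = real k / real n"
  have kn: "0 < kn" "kn \<le> 1 / r" "kn \<le> E" using k_pos n_pos k_over_n Et(5) by (auto simp: kn_def)
  have kn1: "kn \<le> 1" using kn inv_r_small by linarith
  have n4: "4 / real n \<le> 1 / 64" using inv_n_le inv_r_small by linarith
  \<comment> \<open>Each part contains one of these cancellations or is small by itself:
    \<open>t3\<close> and \<open>t5\<close> measure the replacement of \<open>eps\<close> by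
    \<open>e0\<close>, \<open>t6\<close> is the stray X/2.\<close>
  define t1 t2 t3 t4 t5 t6 t7 where
    "t1 = ln (2 * pi) / 2 - stirling_rest k" and
    "t2 = (\<Sum>i<k. ln (1 - real i / real n)) + real k^2 / (2 * real n) + real k^3 / (6 * real n^2)" and
    "t3 = eta * real k^2 / (2 * real n)" and
    "t4 = (real k - 1) * ln (1 + eps) - real k * eps + real k * eps^2 / 2" and
    "t5 = real k * (eps^2 - e0^2) / 2" and
    "t6 = X / 2" and
    "t7 = (real k - 1) * chi X - real k^3 / (24 * real n^2)"
  have "T = t1 + t2 + t3 + t4 - t5 + t6 + t7"
    unfolding T_def G_eq t1_def t2_def t3_def t4_def t5_def t6_def t7_def eta_def
    using n_pos by (simp add: field_simps)
  then have "\<bar>T\<bar> \<le> \<bar>t1\<bar> + \<bar>t2\<bar> + \<bar>t3\<bar> + \<bar>t4\<bar> + \<bar>t5\<bar> + \<bar>t6\<bar> + \<bar>t7\<bar>" by linarith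
  moreover have "\<bar>t1\<bar> \<le> E"
    using stirling_rest_bounds[OF k_pos(2)] inv_k Et(5) by (simp add: t1_def)
  moreover have "\<bar>t2\<bar> \<le> 2 * E"
    using sum_ln_one_minus[OF two_k_le k_pos(2)] kn(3) Et(1) by (simp add: t2_def kn_def)
  moreover have "\<bar>t3\<bar> \<le> 2 * E"
  proof -
    have "t3 \<le> (4 / real n) * real k^2 / (2 * real n)"
      unfolding t3_def using eta by (intro divide_right_mono mult_right_mono) auto
    also have "\<dots> = 2 * kn * kn" by (simp add: kn_def power2_eq_square)
    also have "\<dots> \<le> 2 * kn * 1" using kn kn1 by (intro mult_left_mono) auto
    finally show ?thesis using kn eta by (simp add: t3_def)
  qed
  moreover have "\<bar>t4\<bar> \<le> 12 * E"
  proof -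
    define l where "l = ln (1 + eps)"
    have c: "\<bar>l - eps + eps^2 / 2\<bar> \<le> \<bar>eps\<bar>^3" using ln_one_plus_cubic eps_bounds(4) by (simp add: l_def)
    have e1: "\<bar>eps\<bar>^3 \<le> 4 * (\<bar>e0\<bar>^3 + eta^3)"
    proof -
      have "\<bar>eps\<bar> \<le> \<bar>e0\<bar> + eta" using eta by (simp add: eta_def)
      then have "\<bar>eps\<bar>^3 \<le> (\<bar>e0\<bar> + eta)^3" by (intro power_mono) auto
      also have "\<dots> = 4 * (\<bar>e0\<bar>^3 + eta^3) - 3 * (\<bar>e0\<bar> + eta) * (\<bar>e0\<bar> - eta)^2"
        by (simp add: power2_eq_square power3_eq_cube algebra_simps)
      also have "\<dots> \<le> 4 * (\<bar>e0\<bar>^3 + eta^3)" using eta by simp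
      finally show ?thesis .
    qed
    have e3: "\<bar>l\<bar> \<le> 4 * E"
    proof -
      have "\<bar>eps\<bar> * \<bar>eps\<bar> \<le> \<bar>eps\<bar> * (1 / 32)" using eps_bounds by (intro mult_left_mono) auto
      then have a: "eps^2 \<le> \<bar>eps\<bar> / 32" by (simp add: power2_eq_square)
      have "\<bar>eps\<bar>^3 = eps^2 * \<bar>eps\<bar>" by (simp add: power2_eq_square power3_eq_cube)
      also have "\<dots> \<le> eps^2 * 1" using eps_bounds(4) by (intro mult_left_mono) auto
      finally have "\<bar>l\<bar> \<le> 2 * \<bar>eps\<bar>" using c a by linarith
      then show ?thesis using eps_bounds(3) Et(5) by linarith
    qed
    have "real k * eta^3 \<le> E"
    proof -
      have "eta^3 \<le> (4 / real n)^3" using eta by (intro power_mono) auto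
      also have "\<dots> = 4 / real n * (4 / real n)^2" by (simp add: power2_eq_square power3_eq_cube)
      also have "\<dots> \<le> 4 / real n * (1 / 64)^2" using n4 n_pos by (intro mult_left_mono power_mono) auto
      also have "\<dots> \<le> 1 / real n" using n_pos by (simp add: power2_eq_square field_simps)
      finally have "real k * eta^3 \<le> real k * (1 / real n)" by (intro mult_left_mono) auto
      then show ?thesis using kn(3) by (simp add: kn_def)
    qed
    then have ke: "real k * \<bar>eps\<bar>^3 \<le> 8 * E - 2 * E + 2 * E"
      using mult_left_mono[OF e1, of "real k"] Et(2) by (simp add: distrib_left)
    have "t4 = real k * (l - eps + eps^2 / 2) - l" by (simp add: t4_def l_def algebra_simps)
    then have "\<bar>t4\<bar> \<le> real k * \<bar>l - eps + eps^2 / 2\<bar> + \<bar>l\<bar>" 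
      using abs_triangle_ineq4[of "real k * (l - eps + eps^2 / 2)" l] by (simp add: abs_mult)
    also have "\<dots> \<le> real k * \<bar>eps\<bar>^3 + \<bar>l\<bar>" using c by (intro add_right_mono mult_left_mono) auto
    finally show ?thesis using ke e3 by linarith
  qed
  moreover have "\<bar>t5\<bar> \<le> 2 * E"
  proof -
    have "eps^2 - e0^2 = eta * (eps + e0)" by (simp add: eta_def power2_eq_square algebra_simps)
    moreover have "\<bar>eps + e0\<bar> \<le> 1" using eps_bounds(4) e0_bound inv_r_small by linarith
    moreover have "eta * \<bar>eps + e0\<bar> \<le> 4 / real n * 1"
      using eta \<open>\<bar>eps + e0\<bar> \<le> 1\<close> by (intro mult_mono) auto
    ultimately have "\<bar>eps^2 - e0^2\<bar> \<le> 4 / real n * 1"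
      using eta by (simp add: abs_mult)
    then have "real k * \<bar>eps^2 - e0^2\<bar> / 2 \<le> real k * (4 / real n * 1) / 2"
      by (intro divide_right_mono mult_left_mono) auto
    then have "\<bar>t5\<bar> \<le> real k * (4 / real n) / 2" by (simp add: t5_def abs_mult)
    then show ?thesis using kn(3) by (simp add: kn_def)
  qed
  moreover have "\<bar>t6\<bar> \<le> E" using X_bounds kn(3) by (simp add: t6_def kn_def)
  moreover have "\<bar>t7\<bar> \<le> 20 * E"
  proof -
    have c: "\<bar>chi X - X^2 / 24\<bar> \<le> X^3" using chi_expansion X_bounds by simp
    have a1: "\<bar>(real k - 1) * (chi X - X^2 / 24)\<bar> \<le> 8 * E"
    proof -
      have "\<bar>(real k - 1) * (chi X - X^2 / 24)\<bar> \<le> real k * X^3"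
        unfolding abs_mult using c k_pos by (intro mult_mono) auto
      then show ?thesis using kX3 Et(1) by linarith
    qed
    have a2: "X^2 / 24 \<le> E"
    proof -
      have "X * X \<le> X * 1" using X_bounds by (intro mult_left_mono) auto
      moreover have "X \<le> 2 * E" using X_bounds(2) kn(3) unfolding kn_def by linarith
      ultimately show ?thesis unfolding power2_eq_square using Et(7) by linarith
    qed
    have a3: "\<bar>real k * X^2 / 24 - real k^3 / (24 * real n^2)\<bar> \<le> 5 * E"
    proof -
      have "real k * X^2 / 24 - real k^3 / (24 * real n^2) = real k^3 / real n^2 * (eps * (2 + eps) / 24)"
        unfolding X_eq using n_pos by (simp add: field_simps power2_eq_square power3_eq_cube)
      also have "\<bar>\<dots>\<bar> \<le> real k^3 / real n^2 * (\<bar>e0\<bar> + 4 / real n)"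
      proof -
        have "\<bar>eps * (2 + eps)\<bar> \<le> \<bar>eps\<bar> * 24" unfolding abs_mult using eps_bounds(4) by (intro mult_left_mono) auto
        then have "\<bar>eps * (2 + eps) / 24\<bar> \<le> \<bar>e0\<bar> + 4 / real n" using eps_bounds(1,2) by (simp add: abs_le_iff) linarith
        then have "\<bar>real k^3 / real n^2\<bar> * \<bar>eps * (2 + eps) / 24\<bar> \<le> \<bar>real k^3 / real n^2\<bar> * (\<bar>e0\<bar> + 4 / real n)"
          by (intro mult_left_mono) auto
        then show ?thesis by (simp only: abs_mult) simp
      qed
      also have "\<dots> = real k^3 / real n^2 * \<bar>e0\<bar> + 4 * (kn * kn * kn)"
        by (simp add: distrib_left kn_def power2_eq_square power3_eq_cube)
      also have "kn * kn * kn \<le> 1 * 1 * kn" using kn kn1 by (intro mult_mono) auto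
      finally show ?thesis using Et(3) kn(3) by linarith
    qed
    have "t7 = (real k - 1) * (chi X - X^2 / 24) - X^2 / 24 + (real k * X^2 / 24 - real k^3 / (24 * real n^2))"
      by (simp add: t7_def left_diff_distrib right_diff_distrib diff_divide_distrib)
    then show ?thesis using a1 a2 a3 zero_le_power2[of X] Et(7) by linarith
  qed
  ultimately show ?thesis unfolding E_def by linarith
qed

text \<open>The weight is the claimed density times R exp T, where R compares rho_k with k^2/(2
  n^2), the leading form of X^2/2. Both R - 1 and T are bounded by multiples of
  \<open>E1\<close>.\<close>

lemma weight_asymptotics:
  "\<bar>real ((n - 1) choose (k - 1)) * (conn_prob p k * (1 - p) ^ (k * (n - k)))
     - real k powr (3/2) / (sqrt (8 * pi) * real n ^ 2) * exp (- G_fun lam (real k / real n powr (2/3)))\<bar>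
   \<le> 10^22 * exp 200 * (real k powr (3/2) / (sqrt (8 * pi) * real n ^ 2) * exp (- G_fun lam (real k / real n powr (2/3))))
      * E1 k n lam"
proof -
  define E g R W where "E = E1 k n lam"
    and "g = real k powr (3/2) / (sqrt (8 * pi) * real n ^ 2) * exp (- G_fun lam (real k / real n powr (2/3)))"
    and "R = cs.rho k * (2 * real n^2 / real k^2)"
    and "W = real ((n - 1) choose (k - 1)) * (conn_prob p k * (1 - p) ^ (k * (n - k)))"
  note Et = E1_terms[folded E_def]
  have g0: "0 < g" using k_pos n_pos by (simp add: g_def)
  have W: "W = g * (R * exp T)"
  proof -
    define S where "S = - stirling_rest k + (\<Sum>i<k. ln (1 - real i / real n)) - real k * eps + real k^2 * (1 + eps) / (2 * real n)
        + (real k - 1) * ln (1 + eps) + X / 2 + (real k - 1) * chi X"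
    have "W = cs.rho k * (real ((n - 1) choose (k - 1)) * (1 - (1 - p) ^ k) ^ (k - 1) * (1 - p) ^ (k * (n - k)))"
      using cs.one_minus_q_power_pos[OF k_pos(2)] by (simp add: W_def cs.rho_def)
    also have "\<dots> = cs.rho k * (exp S / sqrt (real k))"
      using cs.ln_weight[OF k_pos(2) _ X_def eps_def] two_k_le by (simp add: S_def)
    also have "exp S = exp T * exp (- G_fun lam (real k / real n powr (2/3))) / sqrt (2 * pi)"
    proof -
      have "S = T + - G_fun lam (real k / real n powr (2/3)) - ln (sqrt (2 * pi))"
        by (simp add: S_def T_def ln_sqrt)
      then show ?thesis by (simp only: exp_diff exp_add) simp
    qed
    also have "cs.rho k * (exp T * exp (- G_fun lam (real k / real n powr (2/3))) / sqrt (2 * pi) / sqrt (real k)) = g * (R * exp T)"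
    proof -
      have "real k powr (3/2) = real k * sqrt (real k)"
      proof -
        have "real k powr (3/2) = real k powr 1 * real k powr (1/2)" by (rule powr_mult_eq[symmetric]) simp
        then show ?thesis using k_pos by (simp add: powr_half_sqrt)
      qed
      moreover have "sqrt (8 * pi) = 2 * sqrt (2 * pi)"
        using real_sqrt_mult[of 4 "2 * pi"] by simp
      moreover have "real k = sqrt (real k) * sqrt (real k)" by simp
      ultimately show ?thesis unfolding g_def R_def using k_pos n_pos
        by (simp add: field_simps power2_eq_square)
    qed
    finally show ?thesis .
  qed
  have R: "\<bar>R - 1\<bar> \<le> 2 * 10^21 * E"
  proof -
    define kn where "kn = real k / real n"
    have kn: "0 < kn" "kn \<le> E" using k_pos n_pos k_over_n Et(5) by (auto simp: kn_def)
    define c where "c = 2 * real n^2 / real k^2"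
    have c0: "0 < c" using k_pos n_pos by (simp add: c_def)
    have "R - 1 = (cs.rho k - X^2 / 2) * c + (X^2 / 2 * c - 1)" by (simp add: R_def c_def algebra_simps)
    moreover have "X^2 / 2 * c - 1 = eps * (2 + eps)"
      unfolding X_eq c_def using k_pos n_pos by (simp add: field_simps power2_eq_square)
    ultimately have "\<bar>R - 1\<bar> \<le> \<bar>cs.rho k - X^2 / 2\<bar> * c + \<bar>eps * (2 + eps)\<bar>"
      using abs_triangle_ineq[of "(cs.rho k - X^2 / 2) * c" "X^2 / 2 * c - 1"] abs_mult[of "cs.rho k - X^2 / 2" c] c0 by simp
    also have "\<bar>cs.rho k - X^2 / 2\<bar> * c \<le> 10^20 * (X^3 + 1 / real k) * c"
      using cs.rho_asymptotics'[OF k_pos(2) X_def X_bounds(3) kX4] c0 by (intro mult_right_mono) auto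
    also have "10^20 * (X^3 + 1 / real k) * c = 10^20 * (X^3 * c + 2 * (real n^2 / real k^3))"
      using k_pos by (simp add: c_def field_simps power2_eq_square power3_eq_cube)
    also have "X^3 * c \<le> 16 * E"
    proof -
      have "X^3 * c \<le> (2 * kn)^3 * c"
        using X_bounds c0 by (intro mult_right_mono power_mono) (auto simp: kn_def)
      also have "\<dots> = 16 * kn" using k_pos n_pos by (simp add: kn_def c_def field_simps power2_eq_square power3_eq_cube)
      finally show ?thesis using kn by linarith
    qed
    also have "\<bar>eps * (2 + eps)\<bar> \<le> 6 * E"
    proof -
      have "\<bar>eps * (2 + eps)\<bar> \<le> \<bar>eps\<bar> * 3" unfolding abs_mult using eps_bounds(4) by (intro mult_left_mono) auto
      then show ?thesis using eps_bounds(3) Et(5) by linarith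
    qed
    finally have "\<bar>R - 1\<bar> \<le> 10^20 * (16 * E + 2 * (real n^2 / real k^3)) + 6 * E" by simp
    then show ?thesis using Et(4,7) by simp
  qed
  \<comment> \<open>From |T| <= 40 E1 and E1 <= 5; hence the constant exp 200.\<close>
  have T200: "\<bar>T\<bar> \<le> 200" using T_bound Et(6) by (simp add: E_def)
  then have eT: "exp \<bar>T\<bar> \<le> exp 200" "exp T \<le> exp 200" by auto
  have "\<bar>R * exp T - 1\<bar> = \<bar>(R - 1) * exp T + (exp T - 1)\<bar>" by (simp add: algebra_simps)
  also have "\<dots> \<le> \<bar>R - 1\<bar> * exp T + \<bar>exp T - 1\<bar>"
    using abs_triangle_ineq[of "(R - 1) * exp T" "exp T - 1"] by (simp add: abs_mult)
  also have "\<dots> \<le> (2 * 10^21 * E) * exp 200 + (40 * E) * exp 200"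
  proof (intro add_mono mult_mono R eT(2))
    have "\<bar>exp T - 1\<bar> \<le> \<bar>T\<bar> * exp \<bar>T\<bar>" by (rule exp_diff_1_bound)
    also have "\<dots> \<le> (40 * E) * exp 200" using T_bound eT Et(7) by (intro mult_mono) (auto simp: E_def)
    finally show "\<bar>exp T - 1\<bar> \<le> (40 * E) * exp 200" .
  qed (use Et(7) in auto)
  also have "\<dots> \<le> 10^22 * exp 200 * E" using Et(7) by (simp add: algebra_simps)
  finally have m: "\<bar>R * exp T - 1\<bar> \<le> 10^22 * exp 200 * E" .
  have "\<bar>W - g\<bar> = g * \<bar>R * exp T - 1\<bar>"
    unfolding W using g0 abs_mult[of g "R * exp T - 1"] by (simp add: right_diff_distrib)
  also have "\<dots> \<le> g * (10^22 * exp 200 * E)" using m g0 by (intro mult_left_mono) auto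
  finally show ?thesis unfolding W_def[symmetric] g_def[symmetric] E_def[symmetric] by (simp add: mult_ac)
qed

end

section \<open>The limiting density and its approximate primitive\<close>

lemma G_fun_has_deriv: "(G_fun lam has_real_derivative G_deriv lam x) (at x)"
  unfolding G_fun_def[abs_def] G_deriv_def
  by (auto intro!: derivative_eq_intros simp: power2_eq_square algebra_simps)

lemma G_deriv_has_deriv: "(G_deriv lam has_real_derivative 3 * x / 4 - lam) (at x)"
  unfolding G_deriv_def[abs_def]
  by (auto intro!: derivative_eq_intros)

text \<open>Expanded around x = 3 lam, G' has only nonnegative terms in x/3 - lam and x. This is
  where the condition k >= 3 lam n^(2/3) of part (b) enters.\<close>

lemma G_deriv_lower:
  assumes "3 * lam \<le> x" "0 \<le> x"
  shows "x^2 / 12 \<le> G_deriv lam x" and "x * (3 * x / 4 - lam) \<le> 9 * G_deriv lam x" and "0 \<le> 3 * x / 4 - lam"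
proof -
  have e: "G_deriv lam x = (x / 3 - lam)^2 / 2 + 2 / 3 * (x * (x / 3 - lam)) + 7 / 72 * x^2"
    by (simp add: G_deriv_def power2_eq_square field_simps)
  have nn: "0 \<le> (x / 3 - lam)^2" "0 \<le> x * (x / 3 - lam)" "0 \<le> x^2" using assms by auto
  show "x^2 / 12 \<le> G_deriv lam x" unfolding e using nn by linarith
  have "x * (3 * x / 4 - lam) = x * (x / 3 - lam) + 5 / 12 * x^2" by (simp add: power2_eq_square field_simps)
  moreover have "Q + 5 / 12 * S \<le> 9 * (P / 2 + 2 / 3 * Q + 7 / 72 * S)" if "0 \<le> P" "0 \<le> Q" "0 \<le> S" for P Q S :: real
    using that by (simp add: field_simps)
  ultimately show "x * (3 * x / 4 - lam) \<le> 9 * G_deriv lam x" unfolding e using nn by metis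
  show "0 \<le> 3 * x / 4 - lam" using assms by linarith
qed

definition dens :: "real \<Rightarrow> real \<Rightarrow> real" where
  "dens lam x = x powr (3/2) * exp (- G_fun lam x)"

text \<open>The logarithmic derivative of \<open>dens\<close> is about -G', so this is minus an
  approximate primitive of \<open>dens\<close>; up to constants it is the main term in (b).\<close>

definition prim :: "real \<Rightarrow> real \<Rightarrow> real" where
  "prim lam x = dens lam x / G_deriv lam x"

lemma dens_pos: "0 < x \<Longrightarrow> 0 < dens lam x"
  by (simp add: dens_def)

lemma dens_has_deriv:
  assumes "0 < x"
  shows "(dens lam has_real_derivative dens lam x * (3 / (2 * x) - G_deriv lam x)) (at x)"
proof -
  have eq: "x powr (3/2) / x = x powr (3/2 - 1)" using powr_diff[of x "3/2" 1] assms by simp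
  have p: "((\<lambda>x. x powr (3/2)) has_real_derivative (3/2) * (x powr (3/2) / x)) (at x)"
    unfolding eq by (rule has_real_derivative_powr[OF assms])
  have "((\<lambda>x. exp (- G_fun lam x)) has_real_derivative exp (- G_fun lam x) * - G_deriv lam x) (at x)"
    by (rule DERIV_chain2[OF DERIV_exp DERIV_minus[OF G_fun_has_deriv]])
  from DERIV_mult[OF p this]
  have "((\<lambda>x. x powr (3/2) * exp (- G_fun lam x)) has_real_derivative
     (3/2) * (x powr (3/2) / x) * exp (- G_fun lam x) + exp (- G_fun lam x) * - G_deriv lam x * x powr (3/2)) (at x)" .
  then show ?thesis unfolding dens_def[abs_def]
    by (rule DERIV_cong) (simp add: algebra_simps)
qed

text \<open>The quotient rule leaves 3/(2xD) - D'/D^2, relative to \<open>dens\<close>. With D >=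
  1/12 and x D' <= 9 D these are at most 18/x and 108/x, which add to 126/x.\<close>

lemma prim_has_deriv:
  assumes "3 * lam \<le> x" "1 \<le> x"
  obtains \<theta> where "(prim lam has_real_derivative - dens lam x + \<theta>) (at x)" "\<bar>\<theta>\<bar> \<le> 126 * dens lam x / x"
proof -
  have x0: "0 < x" using assms by simp
  define D D' where "D = G_deriv lam x" and "D' = 3 * x / 4 - lam"
  have "1 / 12 \<le> x^2 / 12" using assms by simp
  then have D: "x^2 / 12 \<le> D" "0 < D" "1 / 12 \<le> D" "x * D' \<le> 9 * D" "0 \<le> D'"
    using G_deriv_lower[OF assms(1)] x0 by (auto simp: D_def D'_def simp del: divide_le_cancel)
  define \<theta> where "\<theta> = dens lam x * (3 / (2 * x * D) - D' / D^2)"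
  have "(prim lam has_real_derivative (dens lam x * (3 / (2 * x) - D) * D - dens lam x * D') / (D * D)) (at x)"
    unfolding prim_def[abs_def] D_def D'_def
    using D(2) by (intro DERIV_divide dens_has_deriv G_deriv_has_deriv x0) (simp add: D_def)
  moreover have "(dens lam x * (3 / (2 * x) - D) * D - dens lam x * D') / (D * D) = - dens lam x + \<theta>"
    using D x0 by (simp add: \<theta>_def field_simps power2_eq_square)
  ultimately have 1: "(prim lam has_real_derivative - dens lam x + \<theta>) (at x)" by simp
  have "0 \<le> 3 / (2 * x * D)" "3 / (2 * x * D) \<le> 18 / x"
  proof -
    show "0 \<le> 3 / (2 * x * D)" using D x0 by simp
    have "3 / (2 * x * D) = (3 / (2 * D)) / x" by simp
    also have "\<dots> \<le> 18 / x" using D x0 by (intro divide_right_mono) (auto simp: field_simps)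
    finally show "3 / (2 * x * D) \<le> 18 / x" .
  qed
  moreover have "0 \<le> D' / D^2" "D' / D^2 \<le> 108 / x"
  proof -
    show "0 \<le> D' / D^2" using D by simp
    have "D' / D^2 = (x * D' / D) / D / x" using D x0 by (simp add: power2_eq_square)
    also have "\<dots> \<le> 9 / (1 / 12) / x"
    proof (intro divide_right_mono)
      have "x * D' / D \<le> 9" using D by (simp add: divide_le_eq)
      then show "x * D' / D / D \<le> 9 / (1 / 12)" using D x0 by (intro frac_le) auto
    qed (use x0 in auto)
    finally show "D' / D^2 \<le> 108 / x" by simp
  qed
  moreover have "126 / x = 18 / x + 108 / x" by (simp add: add_divide_distrib[symmetric])
  moreover have "0 \<le> 108 / x" "0 \<le> 18 / x" using x0 by auto
  ultimately have "\<bar>3 / (2 * x * D) - D' / D^2\<bar> \<le> 126 / x" by linarith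
  then have "\<bar>\<theta>\<bar> \<le> dens lam x * (126 / x)"
    unfolding \<theta>_def abs_mult using dens_pos[OF x0, of lam] by (intro mult_mono) auto
  then have 2: "\<bar>\<theta>\<bar> \<le> 126 * dens lam x / x" by (simp add: mult.commute)
  show ?thesis by (rule that[OF 1 2])
qed

text \<open>The logarithm of \<open>dens\<close> has derivative 3/(2t) - G'(t), of modulus at most B
  + 2, so over a length h it moves by at most (B + 2) h.\<close>

lemma dens_step:
  assumes "1 \<le> x" "x \<le> z" "z \<le> x + h" "3 * lam \<le> x" "(B + 2) * h \<le> 1"
    and B: "\<And>t. x \<le> t \<Longrightarrow> t \<le> x + h \<Longrightarrow> G_deriv lam t \<le> B"
  shows "\<bar>dens lam z - dens lam x\<bar> \<le> 2 * ((B + 2) * h) * dens lam x"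
proof -
  have Bl: "\<bar>3 / (2 * t) - G_deriv lam t\<bar> \<le> B + 2" if "x \<le> t" "t \<le> x + h" for t
  proof -
    have t: "1 \<le> t" "3 * lam \<le> t" using that assms by linarith+
    have "0 \<le> G_deriv lam t" using G_deriv_lower(1)[OF t(2)] t zero_le_power2[of t] by linarith
    moreover have "0 \<le> 3 / (2 * t)" "3 / (2 * t) \<le> 2" using t by (auto simp: field_simps)
    ultimately show ?thesis using B[OF that] by linarith
  qed
  define L where "L = (\<lambda>t. ln (dens lam t))"
  have Ld: "(L has_real_derivative 3 / (2 * t) - G_deriv lam t) (at t)" if "1 \<le> t" for t
  proof -
    have "0 < t" using that by simp
    from DERIV_chain2[OF DERIV_ln_divide[OF dens_pos[OF this, of lam]] dens_has_deriv[OF this]]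
    show ?thesis unfolding L_def using dens_pos[OF \<open>0 < t\<close>, of lam] by simp
  qed
  have "\<bar>L z - L x\<bar> \<le> (B + 2) * (z - x)"
  proof (cases "x = z")
    case False
    then have xz: "x < z" using assms by simp
    obtain c where c: "x < c" "c < z" "L z - L x = (z - x) * (3 / (2 * c) - G_deriv lam c)"
      using MVT2[OF xz, of L "\<lambda>t. 3 / (2 * t) - G_deriv lam t"] Ld assms by force
    have "\<bar>L z - L x\<bar> = (z - x) * \<bar>3 / (2 * c) - G_deriv lam c\<bar>" using c xz by (simp add: abs_mult)
    also have "\<dots> \<le> (z - x) * (B + 2)" using Bl[of c] c assms by (intro mult_left_mono) auto
    finally show ?thesis by (simp add: mult.commute)
  qed simp
  moreover have B2: "0 \<le> B + 2" using Bl[of x] assms by linarith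
  ultimately have L: "\<bar>L z - L x\<bar> \<le> (B + 2) * h"
    using mult_left_mono[OF _ B2, of "z - x" h] assms by simp
  have "dens lam z = dens lam x * exp (L z - L x)"
    using dens_pos[of z lam] dens_pos[of x lam] assms by (simp add: L_def exp_diff)
  then have "\<bar>dens lam z - dens lam x\<bar> = dens lam x * \<bar>exp (L z - L x) - 1\<bar>"
    using dens_pos[of x lam] assms abs_mult[of "dens lam x" "exp (L z - L x) - 1"] by (simp add: right_diff_distrib)
  also have "\<dots> \<le> dens lam x * (2 * \<bar>L z - L x\<bar>)"
    using abs_exp_minus_1[of "L z - L x"] L assms dens_pos[of x lam] by (intro mult_left_mono) auto
  also have "\<dots> \<le> dens lam x * (2 * ((B + 2) * h))"
    using L dens_pos[of x lam] assms by (intro mult_left_mono) auto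
  finally show ?thesis by (simp add: mult.commute)
qed

text \<open>Mean value theorem on one mesh interval. The intermediate point costs a factor at most 3
  in \<open>dens\<close>, which turns 126 into 378.\<close>

lemma prim_step:
  assumes "1 \<le> x" "0 < h" "3 * lam \<le> x" "(B + 2) * h \<le> 1"
    and B: "\<And>t. x \<le> t \<Longrightarrow> t \<le> x + h \<Longrightarrow> G_deriv lam t \<le> B"
  shows "\<bar>(prim lam x - prim lam (x + h)) - h * dens lam x\<bar> \<le> h * dens lam x * (378 / x + 2 * ((B + 2) * h))"
proof -
  have "\<exists>d. (prim lam has_real_derivative d) (at t) \<and> \<bar>d + dens lam t\<bar> \<le> 126 * dens lam t / t" if "x \<le> t" for t
  proof -
    have t: "3 * lam \<le> t" "1 \<le> t" using that assms by linarith+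
    obtain \<theta> where "(prim lam has_real_derivative - dens lam t + \<theta>) (at t)" "\<bar>\<theta>\<bar> \<le> 126 * dens lam t / t"
      using prim_has_deriv[OF t] .
    then show ?thesis by (intro exI[of _ "- dens lam t + \<theta>"]) simp
  qed
  then obtain d where d: "\<And>t. x \<le> t \<Longrightarrow> (prim lam has_real_derivative d t) (at t)"
    "\<And>t. x \<le> t \<Longrightarrow> \<bar>d t + dens lam t\<bar> \<le> 126 * dens lam t / t"
    by metis
  have xh: "x < x + h" using assms by simp
  obtain c where c: "x < c" "c < x + h" "prim lam (x + h) - prim lam x = (x + h - x) * d c"
    using MVT2[OF xh, of "prim lam" d] d(1) by force
  have s: "\<bar>dens lam c - dens lam x\<bar> \<le> 2 * ((B + 2) * h) * dens lam x"
    by (rule dens_step) (use c assms in auto)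
  have dx: "0 < dens lam x" using dens_pos assms by simp
  have "dens lam c \<le> 3 * dens lam x"
  proof -
    have "2 * ((B + 2) * h) * dens lam x \<le> 2 * 1 * dens lam x"
      using assms dx by (intro mult_right_mono mult_left_mono) auto
    then show ?thesis using s by linarith
  qed
  then have "126 * dens lam c / c \<le> 126 * (3 * dens lam x) / x"
    using c assms dx by (intro frac_le) auto
  moreover have "126 * (3 * dens lam x) / x = dens lam x * (378 / x)" by simp
  moreover have "\<bar>d c + dens lam c\<bar> \<le> 126 * dens lam c / c" using d(2)[of c] c by simp
  ultimately have e: "\<bar>d c + dens lam c\<bar> \<le> dens lam x * (378 / x)" by linarith
  have "(prim lam x - prim lam (x + h)) - h * dens lam x = - (h * ((d c + dens lam c) - (dens lam c - dens lam x)))"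
    using c(3) by (simp add: algebra_simps)
  then have "\<bar>(prim lam x - prim lam (x + h)) - h * dens lam x\<bar> = h * \<bar>(d c + dens lam c) - (dens lam c - dens lam x)\<bar>"
    using assms by (simp add: abs_mult)
  also have "\<dots> \<le> h * (dens lam x * (378 / x) + 2 * ((B + 2) * h) * dens lam x)"
    using e s assms by (intro mult_left_mono) linarith+
  finally show ?thesis by (simp add: algebra_simps)
qed

lemma G_fun_tangent:
  assumes "3 * lam \<le> a" "0 \<le> a" "a \<le> x"
  shows "G_fun lam a + G_deriv lam a * (x - a) \<le> G_fun lam x"
proof -
  have "G_fun lam a - G_deriv lam a * a \<le> G_fun lam x - G_deriv lam a * x"
  proof (rule DERIV_nonneg_imp_nondecreasing[OF assms(3), where f = "\<lambda>t. G_fun lam t - G_deriv lam a * t"])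
    fix t assume t: "a \<le> t" "t \<le> x"
    have "G_deriv lam a \<le> G_deriv lam t"
    proof (rule DERIV_nonneg_imp_nondecreasing[OF t(1), where f = "G_deriv lam"])
      fix s assume "a \<le> s" "s \<le> t"
      then have "0 \<le> 3 * s / 4 - lam" using assms by linarith
      then show "\<exists>y. (G_deriv lam has_real_derivative y) (at s) \<and> 0 \<le> y"
        using G_deriv_has_deriv by blast
    qed
    moreover have "((\<lambda>t. G_fun lam t - G_deriv lam a * t) has_real_derivative G_deriv lam t - G_deriv lam a * 1) (at t)"
      by (intro DERIV_diff G_fun_has_deriv DERIV_cmult DERIV_ident)
    ultimately show "\<exists>y. ((\<lambda>t. G_fun lam t - G_deriv lam a * t) has_real_derivative y) (at t) \<and> 0 \<le> y"
      by (intro exI[of _ "G_deriv lam t - G_deriv lam a * 1"]) auto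
  qed
  then show ?thesis by (simp add: algebra_simps)
qed

text \<open>The factor (x/a)^4 pays for the growth of \<open>E1\<close> with the component size, see
  \<open>E1_scale\<close>. Convexity of G gives decay at rate G'(a), and half of it absorbs all
  powers of x/a.\<close>

lemma dens_decay:
  assumes "3 * lam \<le> a" "1 \<le> a" "a \<le> x"
  shows "dens lam x * (x / a)^4 \<le> 144^6 * 3 * (dens lam a * exp (- (G_deriv lam a / 2 * (x - a))))"
proof -
  have a0: "0 < a" "0 < x" using assms by auto
  define y where "y = x / a"
  have y: "1 \<le> y" using assms a0 by (simp add: y_def)
  define D where "D = G_deriv lam a"
  have D: "a^2 / 12 \<le> D" using G_deriv_lower(1) assms by (simp add: D_def)
  have p: "x powr (3/2) \<le> a powr (3/2) * y^2"
  proof -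
    have "x powr (3/2) = a powr (3/2) * y powr (3/2)" using a0 by (simp add: y_def powr_divide)
    also have "y powr (3/2) \<le> y powr 2" using y by (intro powr_mono) auto
    finally show ?thesis using y a0 by (simp add: mult_left_mono)
  qed
  \<comment> \<open>The power is 4 plus 2 for the growth of x^(3/2). Since 144 = 6 * 24, (y/144)^6
    <= exp (y/24), and D >= a^2/12 makes y/24 at most 1 + D (x-a)/2; the 3 bounds e.\<close>
  have y6: "y^6 \<le> 144^6 * 3 * exp (D / 2 * (x - a))"
  proof -
    have "y / 144 \<le> exp (y / 144)" using exp_ge_add_one_self[of "y / 144"] by linarith
    then have "(y / 144)^6 \<le> exp (y / 144)^6" using y by (intro power_mono) auto
    also have "exp (y / 144)^6 = exp (y / 24)" using exp_of_nat_mult[of 6 "y / 144"] by simp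
    finally have "y^6 \<le> 144^6 * exp (y / 24)" by (simp add: power_divide field_simps)
    also have "y / 24 \<le> 1 + D / 2 * (x - a)"
    proof -
      have "y = 1 + (x - a) / a" using a0 by (simp add: y_def field_simps)
      moreover have "(x - a) / a / 24 \<le> D / 2 * (x - a)"
      proof -
        have "1 / a \<le> a^2" using a0 one_le_power[OF assms(2), of 3] by (simp add: divide_le_eq power2_eq_square power3_eq_cube)
        then have "1 / a / 24 \<le> a^2 / 24" by (rule divide_right_mono) simp
        also have "\<dots> \<le> D / 2" using D by linarith
        finally have "1 / a / 24 \<le> D / 2" .
        then have "1 / a / 24 * (x - a) \<le> D / 2 * (x - a)" using assms by (intro mult_right_mono) auto
        then show ?thesis by simp
      qed
      moreover have "y / 24 = 1 / 24 + (x - a) / a / 24"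
        unfolding \<open>y = 1 + (x - a) / a\<close> by (rule add_divide_distrib)
      moreover have "1 / 24 \<le> (1::real)" by simp
      ultimately show ?thesis by (simp only: add_mono)
    qed
    then have "144^6 * exp (y / 24) \<le> 144^6 * exp (1 + D / 2 * (x - a))" by simp
    also have "exp (1 + D / 2 * (x - a)) \<le> 3 * exp (D / 2 * (x - a))"
      using exp_le by (simp add: exp_add)
    finally show ?thesis by simp
  qed
  have "dens lam x * y^4 = (x powr (3/2) * y^4) * exp (- G_fun lam x)" by (simp add: dens_def)
  also have "\<dots> \<le> (a powr (3/2) * y^2 * y^4) * exp (- (G_fun lam a + D * (x - a)))"
    using p y G_fun_tangent[of lam a x] assms a0 by (intro mult_mono) (auto simp: D_def)
  also have "\<dots> = dens lam a * (y^6 * exp (- (D * (x - a))))"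
  proof -
    have "exp (- (G_fun lam a + D * (x - a))) = exp (- G_fun lam a) * exp (- (D * (x - a)))"
      by (simp flip: exp_add)
    moreover have "y^2 * y^4 = y^6" by (simp flip: power_add)
    ultimately show ?thesis by (simp add: dens_def mult_ac)
  qed
  also have "\<dots> \<le> dens lam a * (144^6 * 3 * exp (D / 2 * (x - a)) * exp (- (D * (x - a))))"
    using y6 dens_pos[OF a0(1), of lam] by (intro mult_left_mono mult_right_mono) auto
  also have "144^6 * 3 * exp (D / 2 * (x - a)) * exp (- (D * (x - a))) = 144^6 * 3 * exp (- (D / 2 * (x - a)))"
    unfolding mult.assoc by (simp flip: exp_add)
  finally show ?thesis by (simp add: y_def D_def mult_ac)
qed

section \<open>The tail beyond the critical window\<close>

context near_critical
begin

definition weight :: "nat \<Rightarrow> real" where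
  "weight j = real ((n - 1) choose (j - 1)) * (conn_prob p j * (1 - p) ^ (j * (n - j)))"

lemma r_powers: "real n powr (3/4) = r^3" "real n powr (1/12) \<le> r"
proof -
  show "real n powr (3/4) = r^3" unfolding r_def by (rule powr_pow_eq[symmetric]) (use n_pos in auto)
  show "real n powr (1/12) \<le> r" unfolding r_def using n_pos by (intro powr_mono) auto
qed

text \<open>Each factor of the falling factorial shrinks by 1 - d/(n+d-i-1). The term of second
  order in j/n is kept because in \<open>weight_tail\<close> the first-order term nearly cancels
  against the change in the power of 1 - p.\<close>

lemma binomial_ratio:
  assumes "1 \<le> j" "j \<le> n"
  shows "real ((n - 1) choose (j - 1)) \<le> real ((n + d - 1) choose (j - 1))
     * exp (- (real d * ((real j - 1) / real (n + d) + real j * (real j - 1) / (2 * real (n + d)^2))))"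
proof -
  define n' where "n' = n + d"
  have n'0: "0 < real n'" using n_pos by (simp add: n'_def)
  have g: "real ((m - 1) choose (j - 1)) = (\<Prod>i<j-1. real m - real (i + 1)) / fact (j - 1)" if "1 \<le> m" for m
    using that by (simp add: binomial_gbinomial gbinomial_prod_rev atLeast0LessThan of_nat_diff algebra_simps)
  have n1: "1 \<le> n" "1 \<le> n'" using assms by (auto simp: n'_def)
  have "(\<Prod>i<j-1. real n - real (i + 1))
    \<le> (\<Prod>i<j-1. (real n' - real (i + 1)) * exp (- (real d * (1 / real n' + real (i + 1) / real n'^2))))"
  proof (rule prod_mono)
    fix i assume "i \<in> {..<j-1}"
    then have i: "i + 1 < n" using assms by auto
    then have i': "real (i + 1) < real n" by simp
    have pos: "0 < real n' - real (i + 1)" using i' by (simp add: n'_def)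
    have a: "1 / real n' + real (i + 1) / real n'^2 \<le> 1 / (real n' - real (i + 1))"
    proof -
      have "(1 / real n' + real (i + 1) / real n'^2) * (real n' - real (i + 1)) = 1 - (real (i + 1) / real n')^2"
        using n'0 by (simp add: field_simps power2_eq_square)
      also have "\<dots> \<le> 1" by simp
      finally show ?thesis using pos by (simp add: le_divide_eq)
    qed
    have "real n - real (i + 1) = (real n' - real (i + 1)) * (1 - real d / (real n' - real (i + 1)))"
      using pos by (simp add: n'_def right_diff_distrib)
    also have "1 - real d / (real n' - real (i + 1)) \<le> exp (- (real d / (real n' - real (i + 1))))"
      using exp_ge_add_one_self[of "- (real d / (real n' - real (i + 1)))"] by simp
    also have "\<dots> \<le> exp (- (real d * (1 / real n' + real (i + 1) / real n'^2)))"
      using mult_left_mono[OF a, of "real d"] by simp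
    finally have "real n - real (i + 1) \<le> (real n' - real (i + 1)) * exp (- (real d * (1 / real n' + real (i + 1) / real n'^2)))"
      using pos by (simp add: mult_left_mono)
    then show "0 \<le> real n - real (i + 1) \<and> real n - real (i + 1)
      \<le> (real n' - real (i + 1)) * exp (- (real d * (1 / real n' + real (i + 1) / real n'^2)))"
      using i' by simp
  qed
  also have "\<dots> = (\<Prod>i<j-1. real n' - real (i + 1)) * exp (- (\<Sum>i<j-1. real d * (1 / real n' + real (i + 1) / real n'^2)))"
    by (simp add: prod.distrib exp_sum[symmetric] sum_negf)
  also have "(\<Sum>i<j-1. real d * (1 / real n' + real (i + 1) / real n'^2))
     = real d * ((real j - 1) / real n' + real j * (real j - 1) / (2 * real n'^2))"
  proof -
    have "(\<Sum>i<m. real (i + 1)) = real (m + 1) * real m / 2" for m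
      by (induction m) (auto simp: field_simps)
    from this[of "j - 1"] have s: "(\<Sum>i<j-1. real (i + 1)) = real j * (real j - 1) / 2"
      using assms by (simp add: of_nat_diff)
    have "(\<Sum>i<j-1. real d * (1 / real n' + real (i + 1) / real n'^2))
      = real d * (real (j - 1) * (1 / real n') + (\<Sum>i<j-1. real (i + 1)) / real n'^2)"
      unfolding sum_distrib_left[symmetric] sum.distrib sum_divide_distrib[symmetric] by simp
    then show ?thesis unfolding s using assms by (simp add: of_nat_diff)
  qed
  finally show ?thesis unfolding g[OF n1(1)] g[OF n1(2)[unfolded n'_def], folded n'_def] n'_def[symmetric]
    by (simp add: divide_right_mono)
qed

text \<open>Adding \<open>d\<close> vertices multiplies the weight of size $j$ by an explicit factor. For \<open>d\<close> near
  $\frac{3}{20} n^{3/4}$ that factor is at least $e^{r/80}$ for all $j \ge n^{3/4}$, while the new weights still sum to one.\<close>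

lemma weight_tail:
  assumes lam: "lam \<le> real n powr (1/12) / 5" and K: "\<And>j. j \<in> K \<Longrightarrow> r^3 \<le> real j \<and> j \<le> n"
  shows "(\<Sum>j\<in>K. weight j) \<le> exp (- (r / 80))"
proof -
  \<comment> \<open>For d = c r^3, the worst size j = r^3 and the largest lam, the exponent gained
    is about c (c - 3/10) r. The minimum is at c = 3/20, with value -9r/400, which leaves a margin
    below -r/80.\<close>
  define d where "d = nat \<lceil>3 / 20 * r^3\<rceil>"
  have r3: "262144 \<le> r^3" using power_mono[OF r_ge, of 3] by simp
  have d: "3 / 20 * r^3 \<le> real d" "real d \<le> 3 / 20 * r^3 + 1"
    using r3 by (auto simp: d_def)
  define dl where "dl = real d / real n"
  have rn: "r^3 / real n = 1 / r" unfolding r_pow[symmetric] using r_ge by (simp add: field_simps power4_eq_xxxx power3_eq_cube)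
  have ir: "0 < 1 / r" "1 / r \<le> 1 / 64" using r_ge inv_r_small by auto
  have inn: "1 / real n \<le> 1 / 262144 * (1 / r)"
  proof -
    have "1 / real n = 1 / r^3 * (1 / r)" unfolding r_pow[symmetric] by (simp add: power4_eq_xxxx power3_eq_cube)
    also have "\<dots> \<le> 1 / 262144 * (1 / r)" using r3 ir by (intro mult_right_mono divide_left_mono) auto
    finally show ?thesis by simp
  qed
  have dl: "3 / 20 * (1 / r) \<le> dl" "dl \<le> 3 / 20 * (1 / r) + 1 / real n" "0 \<le> dl"
  proof -
    have "3 / 20 * r^3 / real n \<le> dl" unfolding dl_def using d n_pos by (intro divide_right_mono) auto
    then show "3 / 20 * (1 / r) \<le> dl" using rn by simp
    have "dl \<le> (3 / 20 * r^3 + 1) / real n" unfolding dl_def using d n_pos by (intro divide_right_mono) auto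
    then show "dl \<le> 3 / 20 * (1 / r) + 1 / real n" using rn by (simp add: add_divide_distrib)
  qed (simp add: dl_def)
  have n': "real (n + d) = real n * (1 + dl)" using n_pos by (simp add: dl_def distrib_left)
  have dl1: "0 < 1 + dl" "dl \<le> 1 / 4" using dl ir inn by linarith+
  have eps: "eps \<le> 1 / 5 * (1 / r) + 4 / real n"
  proof -
    have "lam * real n powr (-1/3) \<le> real n powr (1/12) / 5 * real n powr (-1/3)"
      using lam by (intro mult_right_mono) auto
    also have "\<dots> = 1 / 5 * (real n powr (1/12) * real n powr (-1/3))" by simp
    also have "real n powr (1/12) * real n powr (-1/3) = real n powr (- (1/4))" by (rule powr_mult_eq) simp
    also have "\<dots> = 1 / r" by (simp only: r_def powr_minus_divide)
    finally show ?thesis using eps_bounds(2) unfolding e0_def by linarith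
  qed
  have ratio: "weight j \<le> exp (- (r / 80)) * (real ((n + d - 1) choose (j - 1)) * conn_prob p j * (1 - p) ^ (j * (n + d - j)))"
    if j: "r^3 \<le> real j" "j \<le> n" for j
  proof -
    have "1 \<le> real j" using j r3 by linarith
    then have j1: "1 \<le> j" by simp
    \<comment> \<open>The exponent gained per added vertex: exp (d B) bounds the old weight divided
      by the new one.\<close>
    define B where "B = cs.mu * real j - (real j - 1) / real (n + d) - real j * (real j - 1) / (2 * real (n + d)^2)"
    have qq: "(1 - p) ^ (j * (n - j)) = (1 - p) ^ (j * (n + d - j)) * exp (real d * (cs.mu * real j))"
    proof -
      have "n + d - j = (n - j) + d" using j by simp
      then have "j * (n + d - j) = j * (n - j) + j * d" by (simp only: distrib_left)
      then show ?thesis unfolding cs.q_power by (simp add: algebra_simps flip: exp_add)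
    qed
    have "weight j \<le> (real ((n + d - 1) choose (j - 1)) * exp (- (real d * ((real j - 1) / real (n + d) + real j * (real j - 1) / (2 * real (n + d)^2)))))
        * (conn_prob p j * (1 - p) ^ (j * (n - j)))"
      unfolding weight_def using binomial_ratio[OF j1 j(2), of d] p_bounds conn_prob_nonneg[of p j]
      by (intro mult_right_mono) auto
    also have "\<dots> = (real ((n + d - 1) choose (j - 1)) * conn_prob p j * (1 - p) ^ (j * (n + d - j))) *
       (exp (- (real d * ((real j - 1) / real (n + d) + real j * (real j - 1) / (2 * real (n + d)^2)))) * exp (real d * (cs.mu * real j)))"
      unfolding qq by (simp add: mult_ac)
    also have "exp (- (real d * ((real j - 1) / real (n + d) + real j * (real j - 1) / (2 * real (n + d)^2)))) * exp (real d * (cs.mu * real j))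
       = exp (real d * B)"
      unfolding B_def by (simp add: algebra_simps flip: exp_add)
    also have "(real ((n + d - 1) choose (j - 1)) * conn_prob p j * (1 - p) ^ (j * (n + d - j))) * exp (real d * B) \<le> (real ((n + d - 1) choose (j - 1)) * conn_prob p j * (1 - p) ^ (j * (n + d - j))) * exp (- (r / 80))"
    proof (rule mult_left_mono)
      have i1: "1 - dl \<le> 1 / (1 + dl)" and i2: "1 - 2 * dl \<le> 1 / (1 + dl)^2"
      proof -
        have "(1 - dl) * (1 + dl) \<le> 1" by (simp add: algebra_simps)
        then show "1 - dl \<le> 1 / (1 + dl)" using dl1 by (simp add: le_divide_eq)
        have "(1 - 2 * dl) * (1 + dl)^2 = 1 - dl^2 * (3 + 2 * dl)" by (simp add: algebra_simps power2_eq_square)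
        also have "\<dots> \<le> 1" using dl by simp
        finally show "1 - 2 * dl \<le> 1 / (1 + dl)^2" using dl1 by (simp add: le_divide_eq)
      qed
      have "(real j - 1) * (1 - dl) / real n \<le> (real j - 1) * (1 / (1 + dl)) / real n"
        using i1 j1 by (intro divide_right_mono mult_left_mono) auto
      then have b1: "(real j - 1) * (1 - dl) / real n \<le> (real j - 1) / real (n + d)" unfolding n' by (simp add: mult.commute)
      have "real j * (real j - 1) * (1 - 2 * dl) / (2 * real n^2) \<le> real j * (real j - 1) * (1 / (1 + dl)^2) / (2 * real n^2)"
        using i2 j1 by (intro divide_right_mono mult_left_mono) auto
      then have b2: "real j * (real j - 1) * (1 - 2 * dl) / (2 * real n^2) \<le> real j * (real j - 1) / (2 * real (n + d)^2)"
        unfolding n' by (simp add: power_mult_distrib mult_ac)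
      have mu: "cs.mu * real j = real j * (1 + eps) / real n" using n_pos by (simp add: eps_def)
      \<comment> \<open>What remains of B after the factor j/n is taken out; the excess dl/n has the
        right sign and is dropped.\<close>
      define S where "S = eps + dl + 1 / real j - (real j - 1) / real n / 2 * (1 - 2 * dl)"
      have "B \<le> real j * (1 + eps) / real n - (real j - 1) * (1 - dl) / real n - real j * (real j - 1) * (1 - 2 * dl) / (2 * real n^2)"
        unfolding B_def mu using b1 b2 by linarith
      also have "\<dots> \<le> real j / real n * S"
      proof -
        have "real j / real n * S = real j * (1 + eps) / real n - (real j - 1) * (1 - dl) / real n - real j * (real j - 1) * (1 - 2 * dl) / (2 * real n^2)
          + dl / real n"
          unfolding S_def using n_pos j1 by (simp add: field_simps power2_eq_square)
        then show ?thesis using dl n_pos by simp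
      qed
      finally have BS: "B \<le> real j / real n * S" .
      \<comment> \<open>In units of 1/r the main terms are at most 1/5 + 3/20 - 1/2 = -3/20, from
        \<open>eps\<close>, \<open>dl\<close> and j/(2n); the difference 1/100 to 7/50 pays for all
        lower-order errors.\<close>
      have S: "S \<le> - (7 / 50 * (1 / r))"
      proof -
        have ij: "1 / real j \<le> 1 / 4096 * (1 / r)"
        proof -
          have "1 / real j \<le> 1 / r^3" by (intro frac_le) (use j r3 in linarith)+
          also have "\<dots> = 1 / r^2 * (1 / r)" by (simp add: power2_eq_square power3_eq_cube)
          also have "\<dots> \<le> 1 / 64^2 * (1 / r)"
            using r_ge ir power_mono[OF r_ge, of 2] by (intro mult_right_mono divide_left_mono) auto
          finally show ?thesis by simp
        qed
        have jn: "1 / r - 1 / real n \<le> (real j - 1) / real n"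
        proof -
          have "(r^3 - 1) / real n \<le> (real j - 1) / real n" using j n_pos by (intro divide_right_mono) auto
          then show ?thesis using rn by (simp add: diff_divide_distrib)
        qed
        have f1: "(1 / r - 1 / real n) / 2 * (1 - 2 * dl) \<le> (real j - 1) / real n / 2 * (1 - 2 * dl)"
          using jn dl1 by (intro mult_right_mono divide_right_mono) auto
        have f2: "(1 / r - 1 / real n) / 2 * (1 - 2 * dl) = (1 / r - 1 / real n) / 2 - (1 / r - 1 / real n) * dl"
          by (simp add: algebra_simps diff_divide_distrib)
        have f3: "(1 / r - 1 / real n) * dl \<le> 1 / r * (3 / 20 * (1 / 64) + 1 / 262144 * (1/64))"
        proof (rule mult_mono)
          show "dl \<le> 3 / 20 * (1 / 64) + 1 / 262144 * (1 / 64)" using dl ir inn by linarith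
        qed (use dl(3) ir n_pos in auto)
        have f5: "eps \<le> 1 / 5 * (1 / r) + 4 * (1 / real n)" using eps by simp
        have f4: "1 / r * (3 / 20 * (1 / 64) + 1 / 262144 * (1 / 64)) \<le> 1 / 400 * (1 / r)"
          using ir by (simp add: field_simps)
        have g: "e + x + ij - Y \<le> - (7 / 50 * \<rho>)"
          if "U \<le> Y" "U = (\<rho> - \<nu>) / 2 - W" "W \<le> 1 / 400 * \<rho>" "e \<le> 1 / 5 * \<rho> + 4 * \<nu>" "x \<le> 3 / 20 * \<rho> + \<nu>"
            "ij \<le> 1 / 4096 * \<rho>" "\<nu> \<le> 1 / 262144 * \<rho>" "0 < \<rho>" for e x ij Y \<rho> \<nu> U W :: real
        proof -
          have "Y \<ge> \<rho> / 2 - \<nu> / 2 - W" using that by (simp add: diff_divide_distrib)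
          then have "e + x + ij - Y \<le> (1 / 5 * \<rho> + 3 / 20 * \<rho> - \<rho> / 2) + (1 / 4096 * \<rho> + 1 / 400 * \<rho>) + (11 / 2) * \<nu>"
            using that by (simp add: field_simps)
          also have "\<dots> \<le> - (7 / 50 * \<rho>)" using that by (simp add: field_simps)
          finally show ?thesis .
        qed
        show ?thesis unfolding S_def
          by (rule g[OF f1 f2 order_trans[OF f3 f4] f5 dl(2) ij inn ir(1)])
      qed
      have jr: "1 / r \<le> real j / real n"
      proof -
        have "r^3 / real n \<le> real j / real n" using j n_pos by (intro divide_right_mono) auto
        then show ?thesis using rn by simp
      qed
      have "B \<le> real j / real n * (- (7 / 50 * (1 / r)))"
        using BS S mult_left_mono[OF S, of "real j / real n"] by simp
      also have "\<dots> \<le> 1 / r * (- (7 / 50 * (1 / r)))"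
        using jr ir by (intro mult_right_mono_neg) auto
      finally have B: "B \<le> - (7 / 50 * (1 / r * (1 / r)))" by simp
      then have "real d * B \<le> real d * (- (7 / 50 * (1 / r * (1 / r))))" by (intro mult_left_mono) auto
      also have "\<dots> \<le> (3 / 20 * r^3) * (- (7 / 50 * (1 / r * (1 / r))))"
        using d ir by (intro mult_right_mono_neg) auto
      also have "\<dots> = - (21 / 1000 * r)" using r_ge by (simp add: power3_eq_cube)
      also have "\<dots> \<le> - (r / 80)" using r_ge by simp
      finally show "exp (real d * B) \<le> exp (- (r / 80))" by simp
    qed (use p_bounds conn_prob_nonneg[of p j] in auto)
    finally show ?thesis by (simp add: mult.commute)
  qed
  have "(\<Sum>j\<in>K. weight j) \<le> (\<Sum>j\<in>K. exp (- (r / 80)) * (real ((n + d - 1) choose (j - 1)) * conn_prob p j * (1 - p) ^ (j * (n + d - j))))"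
    using ratio K by (intro sum_mono) auto
  also have "\<dots> = exp (- (r / 80)) * (\<Sum>j\<in>K. real ((n + d - 1) choose (j - 1)) * conn_prob p j * (1 - p) ^ (j * (n + d - j)))"
    by (simp add: sum_distrib_left)
  also have "(\<Sum>j\<in>K. real ((n + d - 1) choose (j - 1)) * conn_prob p j * (1 - p) ^ (j * (n + d - j)))
    \<le> (\<Sum>j=1..n + d. real ((n + d - 1) choose (j - 1)) * conn_prob p j * (1 - p) ^ (j * (n + d - j)))"
  proof (rule sum_mono2)
    show "K \<subseteq> {1..n + d}"
    proof
      fix j assume "j \<in> K"
      then have "r^3 \<le> real j" "j \<le> n" using K by auto
      then have "1 \<le> real j" using r3 by linarith
      then show "j \<in> {1..n + d}" using \<open>j \<le> n\<close> by simp
    qed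
  qed (use p_bounds conn_prob_nonneg in auto)
  also have "\<dots> = 1" by (rule conn_prob_identity) (use n_pos in simp)
  finally show ?thesis by simp
qed

end

section \<open>Summation of the local estimates\<close>

text \<open>With y = j/k >= 1 every summand of \<open>E1\<close> grows at most by y^4, the growth of
  k^4/n^3; the summand n^(2/3)/k even decreases.\<close>

lemma E1_scale:
  assumes "1 \<le> k" "k \<le> j" "0 < n"
  shows "E1 j n lam \<le> E1 k n lam * (real j / real k)^4"
proof -
  have k0: "0 < real k" "real k \<le> real j" "0 < real n" using assms by auto
  define y where "y = real j / real k"
  have y: "1 \<le> y" "real j = y * real k" using k0 by (auto simp: y_def)
  have y4: "1 \<le> y^4" "y \<le> y^4" using y power_increasing[of 1 4 y] by auto
  have "E1 j n lam = y^4 * (real k^4 / real n^3) + \<bar>lam\<bar> / real n powr (1/12)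
     + y * (\<bar>lam\<bar>^3 * real k / real n) + (real n powr (2/3) / real k) / y + 1 / real n powr (1/10)"
    unfolding E1_def y(2) by (simp add: power_mult_distrib mult_ac)
  also have "\<dots> \<le> y^4 * (real k^4 / real n^3) + y^4 * (\<bar>lam\<bar> / real n powr (1/12))
     + y^4 * (\<bar>lam\<bar>^3 * real k / real n) + y^4 * (real n powr (2/3) / real k) + y^4 * (1 / real n powr (1/10))"
  proof (intro add_mono mult_right_mono)
    have le: "u \<le> y^4 * u" if "0 \<le> u" for u using mult_right_mono[OF y4(1) that] by simp
    show "\<bar>lam\<bar> / real n powr (1/12) \<le> y^4 * (\<bar>lam\<bar> / real n powr (1/12))" by (rule le) simp
    show "1 / real n powr (1/10) \<le> y^4 * (1 / real n powr (1/10))" by (rule le) simp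
    have "(real n powr (2/3) / real k) / y \<le> (real n powr (2/3) / real k) / 1"
      using y by (intro divide_left_mono) auto
    also have "\<dots> \<le> y^4 * (real n powr (2/3) / real k)" using le[of "real n powr (2/3) / real k"] by simp
    finally show "(real n powr (2/3) / real k) / y \<le> y^4 * (real n powr (2/3) / real k)" .
  qed (use y4 in auto)
  also have "\<dots> = E1 k n lam * y^4" unfolding E1_def by (simp only: distrib_left mult.commute[of _ "y^4"])
  finally show ?thesis by (simp add: y_def)
qed

context near_critical
begin

definition crit_size :: real where "crit_size = real n powr (2/3)"

text \<open>The probability of size j is about kappa times \<open>dens\<close> at j/crit_size. A sum
  over sizes is a Riemann sum of mesh 1/crit_size, whence the product
  \<open>kappa * crit_size\<close> in front of \<open>prim\<close>.\<close>

definition kappa :: real where "kappa = 1 / (sqrt (8 * pi) * real n)"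

lemma crit_size_facts: "0 < crit_size" "1 \<le> crit_size" "kappa * crit_size = 1 / (sqrt (8 * pi) * real n powr (1/3))"
proof -
  show "0 < crit_size" "1 \<le> crit_size" using n_pos by (auto simp: crit_size_def ge_one_powr_ge_zero)
  have "real n powr (2/3) * real n powr (1/3) = real n powr 1" by (rule powr_mult_eq) simp
  then have "real n = crit_size * real n powr (1/3)" using n_pos by (simp add: crit_size_def)
  then have "kappa * crit_size = crit_size / (sqrt (8 * pi) * (crit_size * real n powr (1/3)))" by (simp add: kappa_def)
  then show "kappa * crit_size = 1 / (sqrt (8 * pi) * real n powr (1/3))" using \<open>0 < crit_size\<close> by simp
qed

lemma density_eq:
  "real j powr (3/2) / (sqrt (8 * pi) * real n ^ 2) * exp (- G_fun lam (real j / real n powr (2/3)))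
    = kappa * dens lam (real j / crit_size)"
proof -
  have "crit_size powr (3/2) = real n" unfolding crit_size_def powr_powr using n_pos by simp
  then have "(real j / crit_size) powr (3/2) = real j powr (3/2) / real n"
    using crit_size_facts(1) by (simp add: powr_divide)
  then show ?thesis by (simp add: dens_def kappa_def crit_size_def power2_eq_square)
qed

lemma prim_eq:
  "a powr (3/2) / (sqrt (8 * pi) * real n powr (1/3) * G_deriv lam a) * exp (- G_fun lam a)
    = kappa * crit_size * prim lam a"
  unfolding crit_size_facts(3) by (simp add: prim_def dens_def)

text \<open>Up to n^(3/4) the local estimates are summed and compared with telescoping differences
  of \<open>prim\<close>. The boundary value of \<open>prim\<close> contributes 12 E2 and the sizes
  beyond n^(3/4) one more E2.\<close>

lemma weight_tail_asymptotics:
  assumes lam: "lam \<le> real n powr (1/12) / 5"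
    and k: "3 * lam * crit_size \<le> real k" "crit_size \<le> real k" "real k \<le> real n powr (3/4)"
  shows "\<bar>(\<Sum>j=k..n. weight j) - kappa * crit_size * prim lam (real k / crit_size)\<bar>
    \<le> (10^22 * exp 200 + 380) * 144^6 * 9 * (kappa * crit_size * prim lam (real k / crit_size)) * E1 k n lam + 13 * E2 n"
proof -
  define M where "M = nat \<lfloor>real n powr (3/4)\<rfloor>"
  define x where "x = (\<lambda>j. real j / crit_size)"
  define a where "a = x k"
  \<comment> \<open>The rescaled size n^(3/4)/n^(2/3), which is also the bound on |lam|; hence G' is
    of order b^2 on the whole range.\<close>
  define b where "b = real n powr (1/12)"
  define h where "h = 1 / crit_size"
  define E where "E = E1 k n lam"
  \<comment> \<open>\<open>S1\<close> is the main sum; \<open>S4\<close> carries the weights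
    (x_j/a)^4, so that every relative error can be expressed by \<open>E1\<close> at the starting
    size k.\<close>
  define S1 S4 where "S1 = (\<Sum>j=k..M. dens lam (x j))" and "S4 = (\<Sum>j=k..M. dens lam (x j) * (x j / a)^4)"
  note sc = crit_size_facts
  interpret s: near_critical_size n lam k
    by unfold_locales (use k in \<open>auto simp: crit_size_def\<close>)
  have k1: "1 \<le> k" "0 < real k" using s.k_pos by auto
  have kM: "k \<le> M" using k(3) by (simp add: M_def le_nat_floor)
  have M: "real M \<le> real n powr (3/4)" "real n powr (3/4) < real (Suc M)" by (simp_all add: M_def) linarith
  have a: "1 \<le> a" "3 * lam \<le> a" using k sc by (auto simp: a_def x_def le_divide_eq)
  have b1: "1 \<le> b" using n_pos by (simp add: b_def ge_one_powr_ge_zero)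
  have h: "0 < h" "h \<le> 1" using sc by (auto simp: h_def)
  have xb: "x j \<le> b" if "j \<le> M" for j
  proof -
    have "x j \<le> real n powr (3/4) / crit_size"
      unfolding x_def using that M(1) sc by (intro divide_right_mono) auto
    also have "\<dots> = b" unfolding crit_size_def b_def by (rule powr_div_eq) simp
    finally show ?thesis .
  qed
  have xa: "a \<le> x j" if "k \<le> j" for j
    unfolding a_def x_def using that sc by (intro divide_right_mono) auto
  have xs: "x (Suc j) = x j + h" for j by (simp add: x_def h_def add_divide_distrib add.commute)
  have Dub: "G_deriv lam t \<le> 4 * b^2" if "0 \<le> t" "t \<le> 2 * b" for t
  proof -
    have l: "\<bar>lam\<bar> \<le> b" using lam_bound by (simp add: b_def)
    have "t^2 \<le> (2 * b)^2" using that by (intro power_mono) auto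
    moreover have "\<bar>lam * t\<bar> \<le> b * (2 * b)" unfolding abs_mult using l that b1 by (intro mult_mono) auto
    moreover have "lam^2 \<le> b^2" using power_mono[OF l, of 2] by simp
    ultimately show ?thesis unfolding G_deriv_def by (simp add: power2_eq_square)
  qed
  \<comment> \<open>The relative variation of \<open>dens\<close> over one mesh step: b^2 h = n^(1/6
    - 2/3) = 1/r^2.\<close>
  have Bh: "(4 * b^2 + 2) * h \<le> 1 / r"
  proof -
    have "b^2 = real n powr (1/6)" unfolding b_def by (rule powr_pow_eq) (use n_pos in auto)
    then have "b^2 * h = real n powr (- (1/2))" unfolding h_def crit_size_def using powr_div_eq[of "1/6" "2/3" "- (1/2)" "real n"] by simp
    also have "\<dots> = 1 / r^2"
    proof -
      have "r^2 = real n powr (1/2)" unfolding r_def by (rule powr_pow_eq) (use n_pos in auto)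
      then show ?thesis by (simp only: powr_minus_divide)
    qed
    finally have bh: "b^2 * h = 1 / r^2" .
    have "1 \<le> b^2" using b1 by simp
    then have "(4 * b^2 + 2) * h \<le> (6 * b^2) * h" using h by (intro mult_right_mono) auto
    also have "\<dots> = 6 / r * (1 / r)" using bh by (simp add: power2_eq_square)
    also have "\<dots> \<le> 1 * (1 / r)" using r_ge by (intro mult_right_mono) auto
    finally show ?thesis by simp
  qed
  have ir: "1 / r \<le> E" using s.E1_terms(5) by (simp add: E_def)
  have E0: "0 \<le> E" using s.E1_terms(7) by (simp add: E_def)
  have D: "0 < G_deriv lam a" "G_deriv lam a \<le> crit_size"
  proof -
    have "1 / 12 \<le> a^2 / 12" using a by simp
    then show "0 < G_deriv lam a" using G_deriv_lower(1)[OF a(2)] a by linarith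
    have "G_deriv lam a \<le> 4 * b^2" using xb[OF kM] b1 a by (intro Dub) (auto simp: a_def)
    also have "\<dots> \<le> crit_size"
    proof -
      have "(4 * b^2 + 2) * h \<le> 1" using Bh inv_r_small by linarith
      then show ?thesis using sc by (simp add: h_def divide_le_eq)
    qed
    finally show "G_deriv lam a \<le> crit_size" .
  qed
  have da: "0 < dens lam a" using dens_pos a by simp
  have pa: "0 < prim lam a" using da D by (simp add: prim_def)
  have dx: "0 \<le> dens lam (x j)" if "k \<le> j" for j
    using dens_pos[of "x j" lam] xa[OF that] a by linarith
  have S4: "S4 \<le> 144^6 * 9 * (crit_size * prim lam a)"
  proof -
    \<comment> \<open>The decay per unit of size. The geometric series is at most 1 + 1/w, of order
      crit_size/G'(a), and \<open>dens\<close> at a divided by G'(a) is \<open>prim\<close>.\<close>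
    define w where "w = G_deriv lam a / 2 * h"
    have w: "0 < w" using D h by (simp add: w_def)
    have "S4 \<le> (\<Sum>j=k..M. 144^6 * 3 * dens lam a * exp (- (w * real (j - k))))"
      unfolding S4_def
    proof (rule sum_mono)
      fix j assume j: "j \<in> {k..M}"
      have "dens lam (x j) * (x j / a)^4 \<le> 144^6 * 3 * (dens lam a * exp (- (G_deriv lam a / 2 * (x j - a))))"
        using dens_decay[OF a(2,1) xa] j by simp
      also have "x j - a = h * real (j - k)" using j by (simp add: a_def x_def h_def of_nat_diff diff_divide_distrib)
      finally show "dens lam (x j) * (x j / a)^4 \<le> 144^6 * 3 * dens lam a * exp (- (w * real (j - k)))"
        by (simp add: w_def mult_ac)
    qed
    also have "\<dots> = 144^6 * 3 * dens lam a * (\<Sum>j=k..M. exp (- (w * real (j - k))))"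
      by (simp add: sum_distrib_left)
    also have "(\<Sum>j=k..M. exp (- (w * real (j - k)))) = (\<Sum>i=0..M - k. exp (- (w * real i)))"
      by (rule sum.reindex_bij_witness[of _ "\<lambda>i. i + k" "\<lambda>j. j - k"]) (use kM in auto)
    also have "\<dots> = 1 + (\<Sum>i=1..M - k. exp (- (w * real i)))"
      by (simp add: sum.atLeast_Suc_atMost)
    also have "144^6 * 3 * dens lam a * (1 + (\<Sum>i=1..M - k. exp (- (w * real i)))) \<le> 144^6 * 3 * dens lam a * (3 * (crit_size / G_deriv lam a))"
    proof (rule mult_left_mono)
      have "(\<Sum>i=1..M - k. exp (- (w * real i))) \<le> 1 / w" by (rule sum_exp_decay[OF w])
      also have "1 / w = 2 * (crit_size / G_deriv lam a)" by (simp add: w_def h_def)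
      finally have "(\<Sum>i=1..M - k. exp (- (w * real i))) \<le> 2 * (crit_size / G_deriv lam a)" .
      moreover have "1 \<le> crit_size / G_deriv lam a" using D by (simp add: le_divide_eq)
      ultimately show "1 + (\<Sum>i=1..M - k. exp (- (w * real i))) \<le> 3 * (crit_size / G_deriv lam a)" by linarith
    qed (use da in simp)
    finally show ?thesis by (simp add: prim_def mult_ac)
  qed
  have S1: "S1 \<le> S4"
    unfolding S1_def S4_def
  proof (rule sum_mono)
    fix j assume j: "j \<in> {k..M}"
    have "1 \<le> (x j / a)^4" using xa[of j] j a by (intro one_le_power) auto
    then show "dens lam (x j) \<le> dens lam (x j) * (x j / a)^4" using mult_left_mono[OF _ dx[of j], of 1] j by simp
  qed
  have S10: "0 \<le> S1" unfolding S1_def using dx by (intro sum_nonneg) auto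
  have ia: "1 / a \<le> E"
  proof -
    have "1 / a = real n powr (2/3) / real k" using k1 sc by (simp add: a_def x_def crit_size_def)
    then show ?thesis using n_pos k1 by (simp add: E_def E1_def)
  qed
  \<comment> \<open>Each step has relative error at most 378/x_j + 2/r, that is 380 E, since 1/a and
    1/r are both below E.\<close>
  have tele: "\<bar>(prim lam a - prim lam (x (Suc M))) - h * S1\<bar> \<le> h * (380 * E * S1)"
  proof -
    have "(prim lam a - prim lam (x (Suc M))) - h * S1 = (\<Sum>j=k..M. (prim lam (x j) - prim lam (x (j + 1))) - h * dens lam (x j))"
      using sum_natinterval_diff[of "\<lambda>j. prim lam (x j)" k M] kM
      by (simp add: S1_def sum_subtractf sum_distrib_left a_def)
    also have "\<bar>\<dots>\<bar> \<le> (\<Sum>j=k..M. \<bar>(prim lam (x j) - prim lam (x (j + 1))) - h * dens lam (x j)\<bar>)" by (rule sum_abs)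
    also have "\<dots> \<le> (\<Sum>j=k..M. h * (380 * E) * dens lam (x j))"
    proof (rule sum_mono)
      fix j assume j: "j \<in> {k..M}"
      have xj: "1 \<le> x j" "3 * lam \<le> x j" "x j \<le> b" using xa[of j] xb[of j] a j by auto
      have "\<bar>(prim lam (x j) - prim lam (x j + h)) - h * dens lam (x j)\<bar>
        \<le> h * dens lam (x j) * (378 / x j + 2 * ((4 * b^2 + 2) * h))"
      proof (rule prim_step)
        show "(4 * b^2 + 2) * h \<le> 1" using Bh inv_r_small by linarith
        show "G_deriv lam t \<le> 4 * b^2" if "x j \<le> t" "t \<le> x j + h" for t
          using that xj h b1 by (intro Dub) linarith+
      qed (use xj h in auto)
      also have "\<dots> \<le> h * dens lam (x j) * (380 * E)"
      proof (rule mult_left_mono)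
        have "1 / x j \<le> 1 / a" using xa[of j] j a by (intro divide_left_mono) auto
        moreover have "378 / x j = 378 * (1 / x j)" by simp
        ultimately show "378 / x j + 2 * ((4 * b^2 + 2) * h) \<le> 380 * E" using ia Bh ir by linarith
      qed (use h dx[of j] j in auto)
      finally show "\<bar>(prim lam (x j) - prim lam (x (j + 1))) - h * dens lam (x j)\<bar> \<le> h * (380 * E) * dens lam (x j)"
        using xs[of j] by (simp add: mult_ac)
    qed
    also have "\<dots> = h * (380 * E * S1)" by (simp add: S1_def sum_distrib_left[symmetric])
    finally show ?thesis .
  qed
  have kap: "0 < kappa" "kappa * crit_size \<le> 1"
  proof -
    show "0 < kappa" using n_pos by (simp add: kappa_def)
    have "1 \<le> real n powr (1/3)" using n_pos by (simp add: ge_one_powr_ge_zero)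
    moreover have "1 \<le> sqrt (8 * pi)" using pi_gt3 by simp
    ultimately have "1 * 1 \<le> sqrt (8 * pi) * real n powr (1/3)" by (intro mult_mono) auto
    then show "kappa * crit_size \<le> 1" unfolding sc(3) by simp
  qed
  \<comment> \<open>The boundary term of the telescoping sum, at the first size above
    n^(3/4).\<close>
  define P where "P = kappa * crit_size * prim lam (x (Suc M))"
  have P: "0 \<le> P" "P \<le> 12 * E2 n"
  proof -
    define z where "z = x (Suc M)"
    have "real n powr (3/4) / crit_size = b" unfolding crit_size_def b_def by (rule powr_div_eq) simp
    then have zb: "b \<le> z" unfolding z_def x_def using M(2) sc by (metis divide_right_mono less_imp_le)
    have z: "1 \<le> z" "3 * lam \<le> z" using zb b1 lam by (auto simp: b_def)
    have Dz: "z^2 / 12 \<le> G_deriv lam z" using G_deriv_lower(1)[OF z(2)] z by simp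
    have z2: "0 < z^2 / 12" using z by simp
    \<comment> \<open>From z >= b and lam <= b/5 one gets z - 2 lam >= 3b/5, and (1/8)(3/5)^2 =
      9/200. As b^3 = r this exceeds r/80.\<close>
    have "9 / 200 * b^3 \<le> G_fun lam z"
    proof -
      have "3 * b / 5 \<le> z - 2 * lam" using zb lam by (simp add: b_def)
      then have "(3 * b / 5)^2 \<le> (z - 2 * lam)^2" using b1 by (intro power_mono) auto
      then have "b / 8 * (3 * b / 5)^2 \<le> z / 8 * (z - 2 * lam)^2" using zb b1 by (intro mult_mono) auto
      then show ?thesis by (simp add: G_fun_def power2_eq_square power3_eq_cube)
    qed
    moreover have "b^3 = r" unfolding b_def r_def by (rule powr_pow_eq) (use n_pos in auto)
    ultimately have G: "r / 80 \<le> G_fun lam z" using r_ge by linarith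
    have "dens lam z \<le> z^2 * exp (- (r / 80))"
    proof -
      have "z powr (3/2) \<le> z powr 2" using z by (intro powr_mono) auto
      then show ?thesis unfolding dens_def using z G by (intro mult_mono) auto
    qed
    then have "prim lam z \<le> (z^2 * exp (- (r / 80))) / (z^2 / 12)"
      unfolding prim_def using Dz z2 z by (intro frac_le) auto
    also have "\<dots> = 12 * exp (- (r / 80))" using z by simp
    also have "\<dots> \<le> 12 * E2 n"
    proof -
      have "1 * exp (- (r / 80)) \<le> r * exp (- (r / 80))" using r_ge by (intro mult_right_mono) auto
      then show ?thesis by (simp add: E2_def r_def)
    qed
    finally have pz: "prim lam z \<le> 12 * E2 n" .
    have "0 < dens lam z" using dens_pos z by simp
    moreover have "0 < G_deriv lam z" using Dz z2 by linarith
    ultimately have p0: "0 \<le> prim lam z" by (simp add: prim_def)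
    then show "0 \<le> P" using kap sc by (simp add: P_def z_def)
    have "P \<le> 1 * prim lam z" unfolding P_def z_def[symmetric] using kap(2) p0 by (rule mult_right_mono)
    then show "P \<le> 12 * E2 n" using pz by simp
  qed
  define g where "g = kappa * crit_size * prim lam a"
  have kS4: "kappa * S4 \<le> 144^6 * 9 * g"
    using mult_left_mono[OF S4, of kappa] kap by (simp add: g_def mult_ac)
  have main: "\<bar>kappa * S1 - g\<bar> \<le> P + 380 * E * (kappa * S4)"
  proof -
    have "kappa * crit_size * \<bar>(prim lam a - prim lam (x (Suc M))) - h * S1\<bar> \<le> kappa * crit_size * (h * (380 * E * S1))"
      using tele kap sc by (intro mult_left_mono) auto
    moreover have sh: "crit_size * h = 1" using sc by (simp add: h_def)
    have "kappa * crit_size * (h * (380 * E * S1)) = kappa * (crit_size * h) * (380 * E * S1)" by (simp add: mult_ac)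
    moreover have "kappa * crit_size * \<bar>(prim lam a - prim lam (x (Suc M))) - h * S1\<bar> = \<bar>g - P - kappa * S1\<bar>"
    proof -
      have "g - P - kappa * S1 = g - P - kappa * (crit_size * h) * S1" unfolding sh by simp
      also have "\<dots> = kappa * crit_size * ((prim lam a - prim lam (x (Suc M))) - h * S1)"
        by (simp add: g_def P_def right_diff_distrib mult_ac)
      finally show ?thesis using kap sc by (simp add: abs_mult)
    qed
    ultimately have "\<bar>g - P - kappa * S1\<bar> \<le> kappa * (380 * E * S1)" unfolding sh by simp
    also have "\<dots> \<le> kappa * (380 * E * S4)" using S1 E0 kap by (intro mult_left_mono) auto
    finally have "\<bar>g - P - kappa * S1\<bar> \<le> 380 * E * (kappa * S4)" by (simp add: mult_ac)
    then show ?thesis using P(1) by linarith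
  qed
  have loc: "\<bar>(\<Sum>j=k..M. weight j) - kappa * S1\<bar> \<le> 10^22 * exp 200 * E * (kappa * S4)"
  proof -
    have "\<bar>(\<Sum>j=k..M. weight j) - kappa * S1\<bar> = \<bar>\<Sum>j=k..M. weight j - kappa * dens lam (x j)\<bar>"
      by (simp add: S1_def sum_subtractf sum_distrib_left)
    also have "\<dots> \<le> (\<Sum>j=k..M. \<bar>weight j - kappa * dens lam (x j)\<bar>)" by (rule sum_abs)
    also have "\<dots> \<le> (\<Sum>j=k..M. 10^22 * exp 200 * E * kappa * (dens lam (x j) * (x j / a)^4))"
    proof (rule sum_mono)
      fix j assume j: "j \<in> {k..M}"
      interpret t: near_critical_size n lam j
        by unfold_locales (use k j M(1) in \<open>auto simp: crit_size_def\<close>)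
      have "\<bar>weight j - kappa * dens lam (x j)\<bar> \<le> 10^22 * exp 200 * (kappa * dens lam (x j)) * E1 j n lam"
        using t.weight_asymptotics unfolding density_eq weight_def x_def .
      also have "\<dots> \<le> 10^22 * exp 200 * (kappa * dens lam (x j)) * (E * (x j / a)^4)"
      proof (rule mult_left_mono)
        have "x j / a = real j / real k" using sc by (simp add: x_def a_def)
        then show "E1 j n lam \<le> E * (x j / a)^4" using E1_scale[of k j n lam] k1 j n_pos by (simp add: E_def)
      qed (use kap dx[of j] j in auto)
      finally show "\<bar>weight j - kappa * dens lam (x j)\<bar> \<le> 10^22 * exp 200 * E * kappa * (dens lam (x j) * (x j / a)^4)"
        by (simp only: mult_ac)
    qed
    also have "\<dots> = 10^22 * exp 200 * E * (kappa * S4)"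
      by (simp add: S4_def sum_distrib_left[symmetric] mult.assoc)
    finally show ?thesis .
  qed
  have Mn: "M \<le> n"
  proof -
    have "real n powr (3/4) \<le> real n powr 1" using n_pos by (intro powr_mono) auto
    then have "real M \<le> real n" using M(1) n_pos by simp
    then show ?thesis by simp
  qed
  have tail: "0 \<le> (\<Sum>j=Suc M..n. weight j)" "(\<Sum>j=Suc M..n. weight j) \<le> E2 n"
  proof -
    show "0 \<le> (\<Sum>j=Suc M..n. weight j)"
      unfolding weight_def using p_bounds conn_prob_nonneg[of p] by (intro sum_nonneg) auto
    have "(\<Sum>j=Suc M..n. weight j) \<le> exp (- (r / 80))"
    proof (rule weight_tail[OF lam])
      fix j assume "j \<in> {Suc M..n}"
      then have "real (Suc M) \<le> real j" "j \<le> n" by (auto simp del: of_nat_Suc)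
      then show "r^3 \<le> real j \<and> j \<le> n" using M(2) r_powers(1) by linarith
    qed
    also have "\<dots> \<le> r * exp (- (r / 80))" using r_ge by (simp add: mult_le_cancel_right1)
    finally show "(\<Sum>j=Suc M..n. weight j) \<le> E2 n" by (simp add: E2_def r_def)
  qed
  have "(\<Sum>j=k..n. weight j) = (\<Sum>j=k..M. weight j) + (\<Sum>j=Suc M..n. weight j)"
  proof -
    have "{k..n} = {k..M} \<union> {Suc M..n}" using kM Mn by auto
    then show ?thesis by (simp add: sum.union_disjoint)
  qed
  then have "\<bar>(\<Sum>j=k..n. weight j) - g\<bar> \<le> 10^22 * exp 200 * E * (kappa * S4) + (P + 380 * E * (kappa * S4)) + E2 n"
    using loc main tail by linarith
  also have "\<dots> = (10^22 * exp 200 + 380) * E * (kappa * S4) + (P + E2 n)" by (simp only: algebra_simps)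
  also have "\<dots> \<le> (10^22 * exp 200 + 380) * E * (144^6 * 9 * g) + (12 * E2 n + E2 n)"
    using kS4 E0 P(2) by (intro add_mono mult_left_mono) (auto simp: add_nonneg_nonneg)
  finally have "\<bar>(\<Sum>j=k..n. weight j) - g\<bar> \<le> (10^22 * exp 200 + 380) * E * (144^6 * 9 * g) + (12 * E2 n + E2 n)" .
  moreover have "(10^22 * exp 200 + 380) * E * (144^6 * 9 * g) = (10^22 * exp 200 + 380) * 144^6 * 9 * g * E"
    by (simp only: mult_ac)
  moreover have "12 * E2 n + E2 n = 13 * E2 n" by simp
  ultimately have "\<bar>(\<Sum>j=k..n. weight j) - g\<bar> \<le> (10^22 * exp 200 + 380) * 144^6 * 9 * g * E + 13 * E2 n"
    by (simp only:)
  then show ?thesis unfolding g_def E_def a_def x_def .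
qed

end

theorem theorem2p2:
  "\<exists>C::real. \<exists>N::nat. \<forall>n\<ge>N. \<forall>(lam::real) (k::nat) (v::nat). v < n \<longrightarrow>
     (let a = real k / real n powr (2/3); p = p_crit n lam in
      (\<bar>lam\<bar> \<le> real n powr (1/12) \<and> real n powr (2/3) \<le> real k \<and> real k \<le> real n powr (3/4) \<longrightarrow>
        (let g = real k powr (3/2) / (sqrt (8 * pi) * real n ^ 2) * exp (- G_fun lam a) in
         \<bar>ER_prob n p (\<lambda>E. card (component E v) = k) - g\<bar> \<le> C * \<bar>g\<bar> * E1 k n lam))
      \<and>
      (- (real n powr (1/12)) \<le> lam \<and> lam \<le> real n powr (1/12) / 5 \<and>
       max (3 * lam) 1 * real n powr (2/3) \<le> real k \<and> real k \<le> real n powr (3/4) \<longrightarrow>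
        (let g = a powr (3/2) / (sqrt (8 * pi) * real n powr (1/3) * G_deriv lam a) * exp (- G_fun lam a) in
         \<bar>ER_prob n p (\<lambda>E. card (component E v) \<ge> k) - g\<bar> \<le> C * \<bar>g\<bar> * E1 k n lam + C * E2 n)))"
proof -
  \<comment> \<open>\<open>CA\<close> and \<open>CB\<close> are the constants of the local and of
    the tail estimate, and 13 is the coefficient of \<open>E2\<close>; their sum serves both parts,
    with threshold N = 2^24.\<close>
  define CA CB where "CA = (10^22 * exp 200 :: real)" and "CB = (10^22 * exp 200 + 380) * 144^6 * (9::real)"
  define C where "C = CA + CB + 13"
  have CC: "0 \<le> CA" "0 \<le> CB" "CA \<le> C" "CB \<le> C" "13 \<le> C" by (auto simp: CA_def CB_def C_def add_nonneg_nonneg)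
  have part_a: "\<bar>ER_prob n (p_crit n lam) (\<lambda>E. card (component E v) = k) - g\<bar> \<le> C * \<bar>g\<bar> * E1 k n lam"
    if "2^24 \<le> n" "v < n" "\<bar>lam\<bar> \<le> real n powr (1/12)" "real n powr (2/3) \<le> real k" "real k \<le> real n powr (3/4)"
      and g: "g = real k powr (3/2) / (sqrt (8 * pi) * real n ^ 2) * exp (- G_fun lam (real k / real n powr (2/3)))"
    for n k v :: nat and lam g :: real
  proof -
    interpret near_critical_size n lam k by unfold_locales (use that in auto)
    have "{k} \<subseteq> {1..n}" using k_pos two_k_le by auto
    then have "ER_prob n p (\<lambda>E. card (component E v) = k) = weight k"
      using ER_prob_component[OF \<open>v < n\<close>, of "{k}" p] by (simp add: weight_def)
    then have "\<bar>ER_prob n p (\<lambda>E. card (component E v) = k) - g\<bar> \<le> CA * g * E1 k n lam"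
      using weight_asymptotics by (simp add: weight_def g CA_def)
    moreover have "0 \<le> g" by (simp add: g)
    moreover have "CA * g * E1 k n lam \<le> C * g * E1 k n lam"
      using CC E1_terms(7) \<open>0 \<le> g\<close> by (intro mult_right_mono) auto
    ultimately show ?thesis by (simp add: p_def)
  qed
  have part_b: "\<bar>ER_prob n (p_crit n lam) (\<lambda>E. card (component E v) \<ge> k) - g\<bar> \<le> C * \<bar>g\<bar> * E1 k n lam + C * E2 n"
    if "2^24 \<le> n" "v < n" "- (real n powr (1/12)) \<le> lam" "lam \<le> real n powr (1/12) / 5"
      "max (3 * lam) 1 * real n powr (2/3) \<le> real k" "real k \<le> real n powr (3/4)"
      and a: "a = real k / real n powr (2/3)"
      and g: "g = a powr (3/2) / (sqrt (8 * pi) * real n powr (1/3) * G_deriv lam a) * exp (- G_fun lam a)"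
    for n k v :: nat and lam g a :: real
  proof -
    have sc0: "0 \<le> real n powr (2/3)" by simp
    have k: "3 * lam * real n powr (2/3) \<le> real k" "real n powr (2/3) \<le> real k"
      using that(5) mult_right_mono[OF max.cobounded1[of "3 * lam" 1] sc0]
        mult_right_mono[OF max.cobounded2[of 1 "3 * lam"] sc0] by linarith+
    have n0: "0 \<le> real n powr (1/12)" by simp
    interpret near_critical_size n lam k
      by unfold_locales (use that k n0 in \<open>auto simp: abs_le_iff\<close>)
    have "ER_prob n p (\<lambda>E. card (component E v) \<ge> k) = ER_prob n p (\<lambda>E. card (component E v) \<in> {k..n})"
      unfolding ER_prob_def
    proof (rule sum.cong[OF refl])
      fix E assume "E \<in> Pow (all_edges n)"
      then have "component E v \<subseteq> {..<n}"
        using component_subset[of E "{..<n}" v] \<open>v < n\<close> by (auto simp: all_edges_def edges_def)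
      then have "card (component E v) \<le> n" using card_mono[of "{..<n}"] by force
      then show "(if k \<le> card (component E v) then p ^ card E * (1 - p) ^ (card (all_edges n) - card E) else 0)
        = (if card (component E v) \<in> {k..n} then p ^ card E * (1 - p) ^ (card (all_edges n) - card E) else 0)"
        by simp
    qed
    also have "\<dots> = (\<Sum>j=k..n. weight j)"
      using ER_prob_component[OF \<open>v < n\<close>, of "{k..n}" p] k_pos by (auto simp: weight_def)
    finally have er: "ER_prob n p (\<lambda>E. card (component E v) \<ge> k) = (\<Sum>j=k..n. weight j)" .
    have gk: "g = kappa * crit_size * prim lam (real k / crit_size)"
      unfolding g prim_eq by (simp add: a crit_size_def)
    have b: "\<bar>ER_prob n p (\<lambda>E. card (component E v) \<ge> k) - g\<bar> \<le> CB * g * E1 k n lam + 13 * E2 n"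
      unfolding er gk CB_def by (rule weight_tail_asymptotics) (use that k in \<open>auto simp: crit_size_def\<close>)
    have E2: "0 \<le> E2 n" by (simp add: E2_def)
    have "CB * g \<le> CB * \<bar>g\<bar>" using CC by (intro mult_left_mono) auto
    also have "\<dots> \<le> C * \<bar>g\<bar>" using CC by (intro mult_right_mono) auto
    finally have "CB * g \<le> C * \<bar>g\<bar>" .
    then have "CB * g * E1 k n lam \<le> C * \<bar>g\<bar> * E1 k n lam" using E1_terms(7) by (rule mult_right_mono)
    moreover have "13 * E2 n \<le> C * E2 n" using CC E2 by (intro mult_right_mono) auto
    ultimately show ?thesis using b by (simp add: p_def)
  qed
  show ?thesis
    unfolding Let_def
    by (intro exI[of _ C] exI[of _ "2^24"] allI impI conjI) (use part_a part_b in auto)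
qed

end
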